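(* Let $\nu\ge0$. (i) Let $A=[a_1,a_2]$, $B=[b_1,b_2]$ be intervals in $[0,\infty)$ with lengths $a=a_2-a_1>0$, $b=b_2-b_1>0$, and let $T>0$. Then there is a sequence $\{u_k\}_{k\in\mathbb{N}^+}\subset L^2(\mathbb{R}^+)$ with $\int_{\mathbb{R}^+}|u_k(x)|^2dx=1$ for all $k$ such that $$\lim_{k\to\infty}\int_{A^c}|u_k(x)|^2dx=\lim_{k\to\infty}\int_B|u(x,T;u_k)|^2dx=0.$$ (ii) Let $A=[a_1,a_2]$, $B=[b_1,b_2]$ be intervals in $[0,\infty)$ with lengths $a=a_2-a_1>0$, $b=b_2-b_1>0$, and let $S_1,S_2>0$. Then there is a sequence $\{u_k\}_{k\in\mathbb{N}^+}\subset L^2(\mathbb{R}^+)$ with $\int_{\mathbb{R}^+}|u_k(x)|^2dx=1$ for all $k$ such that $$\lim_{k\to\infty}\int_{A^c}|u(x,S_1;u_k)|^2dx=\lim_{k\to\infty}\int_0^{S_2}\int_B|u(x,t;u_k)|^2dxdt=0.$$ (iii) For each measurable $A\subset\mathbb{R}^+$ such that $A^c$ has positive Lebesgue measure, and each $T>0$, there is no constant $C>0$ such that for all $u_0\in L^2(\mathbb{R}^+)$, $$\int_{\mathbb{R}^+}|u_0(x)|^2dx\le C\int_A|u(x,T;u_0)|^2dx.$$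
   Context: $\mathbb{R}^+=(0,\infty)$, $L^2(\mathbb{R}^+)=L^2(\mathbb{R}^+;\mathbb{C})$, $C_0^\infty(\mathbb{R}^+)$ denotes complex-valued smooth functions with compact support in $(0,\infty)$, and $E^c=\mathbb{R}^+\setminus E$. For $\nu\ge0$, $H_\nu$ is the Friedrichs extension in $L^2(\mathbb{R}^+)$ of the operator $-\partial_x^2+(\nu^2-\frac14)\frac1{x^2}$ with domain $C_0^\infty(\mathbb{R}^+)$. For $u_0\in L^2(\mathbb{R}^+)$, $u(x,t;u_0)=(e^{-itH_\nu}u_0)(x)$ denotes the solution of $i\partial_tu=H_\nu u$, $u(\cdot,0)=u_0$. *)

theory Defs
  imports "HOL-Analysis.Analysis"
begin

section \<open>Square-integrable functions\<close>

text \<open>Elements of \<open>L\<^sup>2\<close> are represented by functions. Everything below is invariant under changing a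
  representative on a null set.\<close>

definition L2 :: "'a measure \<Rightarrow> ('a \<Rightarrow> complex) set" where
  "L2 M = {f \<in> borel_measurable M. integrable M (\<lambda>x. (cmod (f x))\<^sup>2)}"

definition L2_inner :: "'a measure \<Rightarrow> ('a \<Rightarrow> complex) \<Rightarrow> ('a \<Rightarrow> complex) \<Rightarrow> complex" where
  "L2_inner M f g = (LINT x|M. f x * cnj (g x))"

definition L2_norm :: "'a measure \<Rightarrow> ('a \<Rightarrow> complex) \<Rightarrow> real" where
  "L2_norm M f = sqrt (LINT x|M. (cmod (f x))\<^sup>2)"


section \<open>Friedrichs extension\<close>

text \<open>An unbounded operator in \<open>L\<^sup>2\<close> is given by its graph.\<close>

type_synonym 'a L2_operator = "(('a \<Rightarrow> complex) \<times> ('a \<Rightarrow> complex)) set"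

text \<open>The domain of the closure of the form \<open>q(\<phi>, \<psi>) = \<langle>S \<phi>, \<psi>\<rangle>\<close> of a symmetric operator \<open>S\<close> that is
  bounded below: the \<open>L\<^sup>2\<close>-limits of sequences in the domain of \<open>S\<close> that are Cauchy for \<open>q\<close>. Since the
  sequences also converge in \<open>L\<^sup>2\<close>, it does not matter which multiple of the \<open>L\<^sup>2\<close>-norm is added
  to \<open>q\<close> to obtain the form norm.\<close>

definition form_domain :: "'a measure \<Rightarrow> 'a L2_operator \<Rightarrow> ('a \<Rightarrow> complex) set" where
  "form_domain M S =
     {f \<in> L2 M. \<exists>\<phi> h :: nat \<Rightarrow> 'a \<Rightarrow> complex.
        (\<forall>n. (\<phi> n, h n) \<in> S) \<and>
        (\<lambda>n. L2_norm M (\<lambda>x. \<phi> n x - f x)) \<longlonglongrightarrow> 0 \<and>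
        (\<forall>\<epsilon>>0. \<exists>N. \<forall>m\<ge>N. \<forall>n\<ge>N.
           cmod (L2_inner M (\<lambda>x. h m x - h n x) (\<lambda>x. \<phi> m x - \<phi> n x)) < \<epsilon>)}"

definition adjoint_graph :: "'a measure \<Rightarrow> 'a L2_operator \<Rightarrow> 'a L2_operator" where
  "adjoint_graph M S =
     {(f, g). f \<in> L2 M \<and> g \<in> L2 M \<and> (\<forall>(\<phi>, h) \<in> S. L2_inner M f h = L2_inner M g \<phi>)}"

text \<open>The Friedrichs extension of \<open>S\<close> is the restriction of the adjoint of \<open>S\<close> to the domain of the
  closed form (see e.g. Weidmann, Linear Operators in Hilbert Spaces, Section 5.5).\<close>

definition friedrichs_extension :: "'a measure \<Rightarrow> 'a L2_operator \<Rightarrow> 'a L2_operator" where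
  "friedrichs_extension M S = {(f, g) \<in> adjoint_graph M S. f \<in> form_domain M S}"


section \<open>The unitary group generated by a self-adjoint operator\<close>

definition unitary_group :: "'a measure \<Rightarrow> (real \<Rightarrow> ('a \<Rightarrow> complex) \<Rightarrow> 'a \<Rightarrow> complex) \<Rightarrow> bool" where
  "unitary_group M U \<longleftrightarrow>
     (\<forall>t. \<forall>f\<in>L2 M. U t f \<in> L2 M) \<and>
     (\<forall>t. \<forall>f\<in>L2 M. \<forall>g\<in>L2 M. \<forall>a b.
        AE x in M. U t (\<lambda>y. a * f y + b * g y) x = a * U t f x + b * U t g x) \<and>
     (\<forall>t. \<forall>f\<in>L2 M. L2_norm M (U t f) = L2_norm M f) \<and>
     (\<forall>f\<in>L2 M. AE x in M. U 0 f x = f x) \<and>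
     (\<forall>s t. \<forall>f\<in>L2 M. AE x in M. U (s + t) f x = U s (U t f) x) \<and>
     (\<forall>f\<in>L2 M. ((\<lambda>t. L2_norm M (\<lambda>x. U t f x - f x)) \<longlongrightarrow> 0) (at 0))"

text \<open>\<open>U\<close> is the group \<open>exp (- i t H)\<close> in the sense of Stone's theorem: the domain of \<open>H\<close> consists of
  exactly those \<open>f\<close> for which the \<open>L\<^sup>2\<close>-derivative of \<open>t \<mapsto> U t f\<close> at \<open>0\<close> exists, and
  this derivative is \<open>- i H f\<close>. For self-adjoint \<open>H\<close> such a \<open>U\<close> exists, and \<open>U t f\<close> is uniquely determined
  almost everywhere for each \<open>f \<in> L\<^sup>2\<close> and each \<open>t\<close>.\<close>

definition generated_by ::
    "'a measure \<Rightarrow> (real \<Rightarrow> ('a \<Rightarrow> complex) \<Rightarrow> 'a \<Rightarrow> complex) \<Rightarrow> 'a L2_operator \<Rightarrow> bool" where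
  "generated_by M U H \<longleftrightarrow>
     unitary_group M U \<and>
     (\<forall>f\<in>L2 M. \<forall>g\<in>L2 M. (f, g) \<in> H \<longleftrightarrow>
        ((\<lambda>t. L2_norm M (\<lambda>x. (U t f x - f x) / complex_of_real t - (- \<i> * g x))) \<longlongrightarrow> 0) (at 0))"

definition exp_minus_i :: "'a measure \<Rightarrow> 'a L2_operator \<Rightarrow> real \<Rightarrow> ('a \<Rightarrow> complex) \<Rightarrow> 'a \<Rightarrow> complex" where
  "exp_minus_i M H = (SOME U. generated_by M U H)"


section \<open>The Schroedinger operator with inverse square potential on the half-line\<close>

definition halfline :: "real measure" where
  "halfline = lebesgue_on {0<..}"

definition vderiv :: "(real \<Rightarrow> complex) \<Rightarrow> real \<Rightarrow> complex" where
  "vderiv f = (\<lambda>x. vector_derivative f (at x))"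

text \<open>Functions in \<open>C\<^sub>0\<^sup>\<infinity>(0, \<infinity>)\<close> are extended by zero to the whole real line.\<close>

definition test_functions :: "(real \<Rightarrow> complex) set" where
  "test_functions =
     {\<phi>. (\<forall>n x. (vderiv ^^ n) \<phi> differentiable (at x)) \<and>
         compact (closure {x. \<phi> x \<noteq> 0}) \<and> closure {x. \<phi> x \<noteq> 0} \<subseteq> {0<..}}"

definition min_operator :: "real \<Rightarrow> real L2_operator" where
  "min_operator \<nu> =
     {(\<phi>, \<lambda>x. - vderiv (vderiv \<phi>) x + complex_of_real ((\<nu>\<^sup>2 - 1/4) * (1 / x\<^sup>2)) * \<phi> x) | \<phi>.
        \<phi> \<in> test_functions}"

definition H_op :: "real \<Rightarrow> real L2_operator" where
  "H_op \<nu> = friedrichs_extension halfline (min_operator \<nu>)"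

definition sol :: "real \<Rightarrow> (real \<Rightarrow> complex) \<Rightarrow> real \<Rightarrow> real \<Rightarrow> complex" where
  "sol \<nu> u0 t x = exp_minus_i halfline (H_op \<nu>) t u0 x"

end

theory Submission
  imports Defs "HOL-Real_Asymp.Real_Asymp"
begin

text \<open>
  With \<open>c = \<nu> + 1/2\<close> and \<open>L = d/dx - c/x\<close> one has \<open>H\<^sub>\<nu> = L\<^sup>* L\<close>. On the functions
  \<open>G\<^sub>\<zeta>(x) = \<zeta> powr (- (c + 1/2)) x\<^sup>c exp (- x\<^sup>2 / (2 \<zeta>))\<close>, \<open>Re \<zeta> > 0\<close>, which span a dense subspace, \<open>H\<^sub>\<nu>\<close> acts
  as \<open>- 2 d/d\<zeta>\<close>. Hence \<open>exp (- i t H\<^sub>\<nu>)\<close> is given there by the translation \<open>\<zeta> \<mapsto> \<zeta> + 2 i t\<close>, and this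
  formula also serves to construct the group; that the \<open>G\<^sub>\<zeta>\<close> span a core follows from the heat flow
  \<open>\<zeta> \<mapsto> \<zeta> + 2 s\<close>. Testing against the \<open>G\<^sub>\<zeta>\<close> shows the intertwining relation
  \<open>x\<^sup>2 exp (- i t H) = exp (- i t H) M\<^sup>* (4 t\<^sup>2 H) M\<close> with \<open>M = exp (i x\<^sup>2 / (4 t))\<close> on smooth functions with
  compact support. For \<open>f\<^sub>k = exp (i k x) \<beta>(x)\<close> the function \<open>M\<^sup>* (4 t\<^sup>2 H) M f\<^sub>k\<close> is
  \<open>4 t\<^sup>2 k\<^sup>2 f\<^sub>k + O(k)\<close>, so that \<open>exp (- i t H) f\<^sub>k\<close> equals \<open>x\<^sup>2 / (4 t\<^sup>2 k\<^sup>2) exp (- i t H) f\<^sub>k\<close> up to an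
  error \<open>O(1/k)\<close> and tends to \<open>0\<close> on every bounded set, for every \<open>t \<noteq> 0\<close>. Part (iii) only needs that
  \<open>exp (- i T H)\<close> is onto.
\<close>

section \<open>The Hilbert space \<open>L\<^sup>2(0, \<infinity>)\<close>\<close>

text \<open>\<open>exp_minus_i\<close> is a choice among all groups with the given generator. A
  group must therefore be constructed before it has any property, and afterwards it is known through
  its generator alone; its values on G_\<zeta> are recovered by a uniqueness argument. Functions
  modulo null sets are made a type, which gives access to completeness, projections and vector
  derivatives. The inner product of that type is the real part of the complex one, so families of
  vectors carry a complex scalar \<open>a\<close>. The delicate point is that Gaussians lie in the
  form domain even for \<nu> = 0, that is c = 1/2. Cutting off x^c near 0 on the scale a leaves an
  error of size a/x^2 times sqrt x on {a..}, a majorant whose norm does not shrink with a. The error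
  tends to zero weakly only, and closed subspaces are weakly closed; hence the arguments by
  orthogonality. The packets f_k do not depend on t. This permits dominated convergence in (ii),
  with data exp (i S1 H) f_k: the solution is f_k at the single exceptional time t = S1.\<close>

lemma borel_measurable_cnj [measurable]: "cnj \<in> borel_measurable borel"
  by (intro borel_measurable_continuous_onI continuous_intros)

lemma L2_measurable [measurable_dest]: "f \<in> L2 M \<Longrightarrow> f \<in> borel_measurable M"
  by (simp add: L2_def)

lemma L2_integrable: "f \<in> L2 M \<Longrightarrow> integrable M (\<lambda>x. (cmod (f x))\<^sup>2)"
  by (simp add: L2_def)

lemma L2_bound:
  assumes "g \<in> L2 M" and [measurable]: "f \<in> borel_measurable M"
    and "AE x in M. cmod (f x) \<le> C * cmod (g x)"
  shows "f \<in> L2 M"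
proof -
  have "integrable M (\<lambda>x. (cmod (f x))\<^sup>2)"
  proof (rule Bochner_Integration.integrable_bound)
    show "integrable M (\<lambda>x. C\<^sup>2 * (cmod (g x))\<^sup>2)"
      using L2_integrable[OF assms(1)] by simp
    show "AE x in M. norm ((cmod (f x))\<^sup>2) \<le> norm (C\<^sup>2 * (cmod (g x))\<^sup>2)"
      using assms(3)
    proof eventually_elim
      case (elim x)
      then have "(cmod (f x))\<^sup>2 \<le> (C * cmod (g x))\<^sup>2"
        by (intro power_mono) auto
      then show ?case by (simp add: power_mult_distrib)
    qed
  qed simp
  then show ?thesis by (simp add: L2_def)
qed

lemma L2_zero: "(\<lambda>x. 0) \<in> L2 M"
  by (simp add: L2_def)

lemma L2_scale: "f \<in> L2 M \<Longrightarrow> (\<lambda>x. a * f x) \<in> L2 M"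
  by (rule L2_bound[where C = "cmod a"]) (auto simp: norm_mult)

lemma cmod_add_power2_le: "(cmod (a + b))\<^sup>2 \<le> 2 * (cmod a)\<^sup>2 + 2 * (cmod b)\<^sup>2"
proof -
  have "(cmod (a + b))\<^sup>2 \<le> (cmod a + cmod b)\<^sup>2"
    by (intro power_mono norm_triangle_ineq) auto
  also have "\<dots> \<le> 2 * (cmod a)\<^sup>2 + 2 * (cmod b)\<^sup>2"
    using zero_le_power2[of "cmod a - cmod b"] by (simp add: power2_eq_square algebra_simps)
  finally show ?thesis .
qed

lemma L2_add:
  assumes "f \<in> L2 M" "g \<in> L2 M"
  shows "(\<lambda>x. f x + g x) \<in> L2 M"
proof -
  note [measurable] = assms[THEN L2_measurable]
  have "integrable M (\<lambda>x. (cmod (f x + g x))\<^sup>2)"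
    by (rule Bochner_Integration.integrable_bound
          [where f = "\<lambda>x. 2 * (cmod (f x))\<^sup>2 + 2 * (cmod (g x))\<^sup>2"])
       (use L2_integrable[OF assms(1)] L2_integrable[OF assms(2)] cmod_add_power2_le in auto)
  then show ?thesis by (simp add: L2_def)
qed

lemma L2_diff:
  assumes "f \<in> L2 M" "g \<in> L2 M"
  shows "(\<lambda>x. f x - g x) \<in> L2 M"
  using L2_add[OF assms(1) L2_scale[OF assms(2), of "-1"]] by simp

lemma L2_inner_integrable:
  assumes "f \<in> L2 M" "g \<in> L2 M"
  shows "integrable M (\<lambda>x. f x * cnj (g x))"
proof -
  note [measurable] = assms[THEN L2_measurable]
  show ?thesis
  proof (rule Bochner_Integration.integrable_bound)
    show "integrable M (\<lambda>x. (cmod (f x))\<^sup>2 + (cmod (g x))\<^sup>2)"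
      using L2_integrable[OF assms(1)] L2_integrable[OF assms(2)] by auto
    have "cmod a * cmod b \<le> (cmod a)\<^sup>2 + (cmod b)\<^sup>2" for a b
    proof -
      have "2 * (cmod a * cmod b) \<le> (cmod a)\<^sup>2 + (cmod b)\<^sup>2"
        using zero_le_power2[of "cmod a - cmod b"] by (simp add: power2_eq_square algebra_simps)
      moreover have "0 \<le> cmod a * cmod b" by simp
      ultimately show ?thesis by linarith
    qed
    then show "AE x in M. norm (f x * cnj (g x)) \<le> norm ((cmod (f x))\<^sup>2 + (cmod (g x))\<^sup>2)"
      by (auto simp: norm_mult)
  qed simp
qed

lemma L2_inner_self: "L2_inner M f f = complex_of_real (LINT x|M. (cmod (f x))\<^sup>2)"
  by (simp add: L2_inner_def flip: complex_norm_square integral_complex_of_real of_real_power)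

section \<open>Square-integrable functions modulo null sets as an inner product space\<close>

definition ae_eq :: "(real \<Rightarrow> complex) \<Rightarrow> (real \<Rightarrow> complex) \<Rightarrow> bool" where
  "ae_eq f g \<longleftrightarrow> f \<in> L2 halfline \<and> g \<in> L2 halfline \<and> (AE x in halfline. f x = g x)"

\<comment> \<open>Membership in \<open>L2 halfline\<close> is part of \<open>ae_eq\<close>, so the
  relation is partial and only square-integrable functions have a class. A type, rather than a set
  of classes, is what \<open>real_inner\<close> and \<open>complete_space\<close> can be
  instantiated at.\<close>
quotient_type hl2 = "real \<Rightarrow> complex" / partial: ae_eq
proof (rule part_equivpI)
  show "\<exists>x. ae_eq x x"
    unfolding ae_eq_def using L2_zero by blast
  show "symp ae_eq"
    by (rule sympI) (auto simp: ae_eq_def elim: eventually_mono)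
  show "transp ae_eq"
    by (rule transpI) (auto simp: ae_eq_def elim: eventually_elim2)
qed

instantiation hl2 :: real_vector
begin

lift_definition zero_hl2 :: hl2 is "\<lambda>x. 0"
  by (simp add: ae_eq_def L2_zero)

lift_definition plus_hl2 :: "hl2 \<Rightarrow> hl2 \<Rightarrow> hl2" is "\<lambda>f g x. f x + g x"
  by (auto simp: ae_eq_def intro: L2_add)

lift_definition minus_hl2 :: "hl2 \<Rightarrow> hl2 \<Rightarrow> hl2" is "\<lambda>f g x. f x - g x"
  by (auto simp: ae_eq_def intro: L2_diff)

lift_definition uminus_hl2 :: "hl2 \<Rightarrow> hl2" is "\<lambda>f x. - f x"
  using L2_scale[where a = "-1"] by (auto simp: ae_eq_def)

lift_definition scaleR_hl2 :: "real \<Rightarrow> hl2 \<Rightarrow> hl2" is "\<lambda>r f x. complex_of_real r * f x"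
  by (auto simp: ae_eq_def intro: L2_scale)

instance
proof
  fix a b c :: hl2 and r s :: real
  show "a + b + c = a + (b + c)"
    by transfer (simp add: ae_eq_def algebra_simps L2_add)
  show "a + b = b + a"
    by transfer (simp add: ae_eq_def algebra_simps L2_add)
  show "0 + a = a"
    by transfer (simp add: ae_eq_def)
  show "- a + a = 0"
    by transfer (simp add: ae_eq_def L2_zero)
  show "a - b = a + - b"
    by transfer (simp add: ae_eq_def L2_diff)
  show "r *\<^sub>R (a + b) = r *\<^sub>R a + r *\<^sub>R b"
    by transfer (simp add: ae_eq_def distrib_left L2_add L2_scale)
  show "(r + s) *\<^sub>R a = r *\<^sub>R a + s *\<^sub>R a"
    by transfer (simp add: ae_eq_def ring_distribs L2_add L2_scale)
  show "r *\<^sub>R s *\<^sub>R a = (r * s) *\<^sub>R a"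
    by transfer (simp add: ae_eq_def mult.assoc L2_scale)
  show "1 *\<^sub>R a = a"
    by transfer (simp add: ae_eq_def)
qed

end

lift_definition cmul :: "complex \<Rightarrow> hl2 \<Rightarrow> hl2" is "\<lambda>a f x. a * f x"
  by (auto simp: ae_eq_def intro: L2_scale)

text \<open>The value \<open>0\<close> outside \<open>L2 halfline\<close> is a default that makes
  the map total.\<close>

lift_definition cls :: "(real \<Rightarrow> complex) \<Rightarrow> hl2" is
  "\<lambda>f. if f \<in> L2 halfline then f else (\<lambda>x. 0)"
  by (auto simp: ae_eq_def L2_zero)

lemma L2_inner_cong_AE:
  assumes [measurable]: "f \<in> borel_measurable M" "f' \<in> borel_measurable M"
    "g \<in> borel_measurable M" "g' \<in> borel_measurable M"
    and "AE x in M. f x = f' x" "AE x in M. g x = g' x"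
  shows "L2_inner M f g = L2_inner M f' g'"
  unfolding L2_inner_def by (rule integral_cong_AE) (use assms(5,6) in auto)

instantiation hl2 :: real_inner
begin

text \<open>The class \<open>real_inner\<close> requires a real value. Nothing is lost: the
  imaginary part is the real inner product with \<open>cmul \<i>\<close> of the second argument, see
  \<open>L2_inner_eq_inner\<close>.\<close>

lift_definition inner_hl2 :: "hl2 \<Rightarrow> hl2 \<Rightarrow> real" is "\<lambda>f g. Re (L2_inner halfline f g)"
proof -
  fix f f' g g' assume "ae_eq f f'" "ae_eq g g'"
  then have "L2_inner halfline f g = L2_inner halfline f' g'"
    by (intro L2_inner_cong_AE) (simp_all add: ae_eq_def L2_measurable)
  then show "Re (L2_inner halfline f g) = Re (L2_inner halfline f' g')" by simp
qed

definition norm_hl2 :: "hl2 \<Rightarrow> real" where "norm_hl2 x = sqrt (inner x x)"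
definition sgn_hl2 :: "hl2 \<Rightarrow> hl2" where "sgn_hl2 x = x /\<^sub>R norm x"
definition dist_hl2 :: "hl2 \<Rightarrow> hl2 \<Rightarrow> real" where "dist_hl2 x y = norm (x - y)"
definition uniformity_hl2 :: "(hl2 \<times> hl2) filter" where
  "uniformity_hl2 = (INF e\<in>{0 <..}. principal {(x, y). dist x y < e})"
definition open_hl2 :: "hl2 set \<Rightarrow> bool" where
  "open_hl2 U \<longleftrightarrow> (\<forall>x\<in>U. eventually (\<lambda>(x', y). x' = x \<longrightarrow> y \<in> U) uniformity)"

instance
proof
  fix x y z :: hl2 and r :: real
  show "inner x y = inner y x"
  proof transfer
    fix f g assume "ae_eq f f" "ae_eq g g"
    then have "L2_inner halfline g f = cnj (L2_inner halfline f g)"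
      unfolding L2_inner_def 
      using Bochner_Integration.integral_cnj[of halfline "\<lambda>x. f x * cnj (g x)"] by (simp add: mult.commute)
    then show "Re (L2_inner halfline f g) = Re (L2_inner halfline g f)" by simp
  qed
  show "inner (x + y) z = inner x z + inner y z"
    by transfer (auto simp: L2_inner_def ae_eq_def algebra_simps L2_inner_integrable)
  show "inner (r *\<^sub>R x) y = r * inner x y"
  proof transfer
    fix r f g assume "ae_eq f f" "ae_eq g g"
    have "L2_inner halfline (\<lambda>x. complex_of_real r * f x) g = of_real r * L2_inner halfline f g"
      unfolding L2_inner_def by (simp add: mult.assoc)
    then show "Re (L2_inner halfline (\<lambda>x. complex_of_real r * f x) g) = r * Re (L2_inner halfline f g)"
      by simp
  qed
  show "0 \<le> inner x x"
    by transfer (simp add: L2_inner_self)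
  show "inner x x = 0 \<longleftrightarrow> x = 0"
  proof transfer
    fix f assume *: "ae_eq f f"
    then have i: "integrable halfline (\<lambda>x. (cmod (f x))\<^sup>2)" by (simp add: ae_eq_def L2_integrable)
    have "(LINT x|halfline. (cmod (f x))\<^sup>2) = 0 \<longleftrightarrow> (AE x in halfline. (cmod (f x))\<^sup>2 = 0)"
      using i by (intro integral_nonneg_eq_0_iff_AE) auto
    then show "Re (L2_inner halfline f f) = 0 \<longleftrightarrow> ae_eq f (\<lambda>x. 0)"
      using * by (simp add: L2_inner_self ae_eq_def L2_zero)
  qed
qed (simp_all add: norm_hl2_def sgn_hl2_def dist_hl2_def uniformity_hl2_def open_hl2_def)

end

lemma rep_L2 [simp]: "rep_hl2 u \<in> L2 halfline"
  using Quotient_rep_reflp[OF Quotient_hl2, of u] by (simp add: ae_eq_def)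

lemma cls_rep [simp]: "cls (rep_hl2 u) = u"
  by (simp add: cls_def Quotient_abs_rep[OF Quotient_hl2])

lemma cls_abs: "f \<in> L2 halfline \<Longrightarrow> cls f = abs_hl2 f"
  by (simp add: cls_def)

lemma cls_eq_iff:
  assumes "f \<in> L2 halfline" "g \<in> L2 halfline"
  shows "cls f = cls g \<longleftrightarrow> (AE x in halfline. f x = g x)"
  using assms Quotient_rel[OF Quotient_hl2, of f g]
  by (auto simp: cls_abs ae_eq_def)

lemma rep_cls: "f \<in> L2 halfline \<Longrightarrow> AE x in halfline. rep_hl2 (cls f) x = f x"
  using cls_eq_iff[of "rep_hl2 (cls f)" f] by simp

lemma cls_add: "f \<in> L2 halfline \<Longrightarrow> g \<in> L2 halfline \<Longrightarrow> cls (\<lambda>x. f x + g x) = cls f + cls g"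
  by (simp add: cls_abs L2_add plus_hl2.abs_eq ae_eq_def)

lemma cls_diff: "f \<in> L2 halfline \<Longrightarrow> g \<in> L2 halfline \<Longrightarrow> cls (\<lambda>x. f x - g x) = cls f - cls g"
  by (simp add: cls_abs L2_diff minus_hl2.abs_eq ae_eq_def)

lemma cls_cmul: "f \<in> L2 halfline \<Longrightarrow> cls (\<lambda>x. a * f x) = cmul a (cls f)"
  by (simp add: cls_abs L2_scale cmul.abs_eq ae_eq_def)

lemma inner_cls:
  "f \<in> L2 halfline \<Longrightarrow> g \<in> L2 halfline \<Longrightarrow> inner (cls f) (cls g) = Re (L2_inner halfline f g)"
  by (simp add: cls_abs inner_hl2.abs_eq ae_eq_def)

lemma norm_cls: "f \<in> L2 halfline \<Longrightarrow> norm (cls f) = L2_norm halfline f"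
  by (simp add: norm_eq_sqrt_inner inner_cls L2_norm_def L2_inner_self)

lemma norm_cls_power2:
  "f \<in> L2 halfline \<Longrightarrow> (norm (cls f))\<^sup>2 = (LINT x|halfline. (cmod (f x))\<^sup>2)"
  by (simp add: norm_cls L2_norm_def)

lemma norm_cls_mono:
  assumes "f \<in> L2 halfline" "g \<in> L2 halfline" "AE x in halfline. cmod (f x) \<le> cmod (g x)"
  shows "norm (cls f) \<le> norm (cls g)"
  unfolding norm_cls[OF assms(1)] norm_cls[OF assms(2)] L2_norm_def
  by (intro real_sqrt_le_mono integral_mono_AE L2_integrable assms)
     (use assms(3) in \<open>auto intro: power_mono elim!: AE_mp\<close>)

lemma cmul_add: "cmul a (x + y) = cmul a x + cmul a y"
  by transfer (simp add: ae_eq_def distrib_left L2_add L2_scale)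

lemma cmul_add_left: "cmul (a + b) x = cmul a x + cmul b x"
  by transfer (simp add: ae_eq_def distrib_right L2_add L2_scale)

lemma cmul_cmul [simp]: "cmul a (cmul b x) = cmul (a * b) x"
  by transfer (simp add: ae_eq_def mult.assoc L2_scale)

lemma cmul_of_real [simp]: "cmul (of_real r) x = r *\<^sub>R x"
  by transfer (simp add: ae_eq_def L2_scale)

lemma cmul_one [simp]: "cmul 1 x = x"
  using cmul_of_real[of 1 x] by simp

lemma cmul_zero_left [simp]: "cmul 0 x = 0"
  using cmul_of_real[of 0 x] by simp

lemma cmul_scaleR: "cmul a (r *\<^sub>R x) = r *\<^sub>R cmul a x"
  by (simp add: mult.commute flip: cmul_of_real del: cmul_of_real)

lemma cmul_minus_left: "cmul (- a) x = - cmul a x"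
  using cmul_add_left[of "- a" a x] by (simp add: eq_neg_iff_add_eq_0)

lemma inner_cmul_left: "inner (cmul a x) y = inner x (cmul (cnj a) y)"
  by transfer (simp add: L2_inner_def mult_ac)

lemma norm_cmul [simp]: "norm (cmul a x) = cmod a * norm x"
proof -
  have "inner (cmul a x) (cmul a x) = inner x (cmul (of_real ((cmod a)\<^sup>2)) x)"
    unfolding complex_norm_square by (simp add: inner_cmul_left mult.commute)
  also have "\<dots> = (cmod a)\<^sup>2 * inner x x"
    unfolding cmul_of_real by simp
  finally show ?thesis by (simp add: norm_eq_sqrt_inner real_sqrt_mult)
qed

lemma bounded_linear_cmul: "bounded_linear (cmul a)"
  by (rule bounded_linear_intro[where K = "cmod a"]) (auto simp: cmul_add cmul_scaleR)

text \<open>Im z = Re (- \<i> z), and the factor - \<i> enters the conjugate-linear second slot as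
  \<i>.\<close>

lemma L2_inner_eq_inner:
  assumes "f \<in> L2 halfline" "g \<in> L2 halfline"
  shows "L2_inner halfline f g = Complex (inner (cls f) (cls g)) (inner (cls f) (cmul \<i> (cls g)))"
proof -
  have "Im (L2_inner halfline f g) = Re (- \<i> * L2_inner halfline f g)" by simp
  also have "- \<i> * L2_inner halfline f g = L2_inner halfline f (\<lambda>x. \<i> * g x)"
    unfolding L2_inner_def by (simp flip: integral_mult_right_zero add: mult_ac)
  finally show ?thesis
    using assms by (simp add: complex_eq_iff inner_cls L2_scale flip: cls_cmul)
qed

section \<open>Completeness and orthogonal projection\<close>

lemma summable_of_weighted_square:
  fixes d :: "nat \<Rightarrow> real"
  assumes "\<And>k. 0 \<le> d k" "summable (\<lambda>k. 2 ^ k * (d k)\<^sup>2)"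
  shows "summable d"
proof (rule summable_comparison_test')
  show "summable (\<lambda>k. 2 ^ k * (d k)\<^sup>2 + (1/2) ^ k)"
    using assms(2) by (intro summable_add summable_geometric) auto
  fix k :: nat
  \<comment> \<open>Dividing the square by 2^k gives 2 d_k \<le> 2^k d_k^2 + 2^-k, and the last term
    is summable.\<close>
  have "0 \<le> (2 ^ k * d k - 1)\<^sup>2 + 2 ^ k * d k * 0" by simp
  also have "\<dots> = 2 ^ k * (2 ^ k * (d k)\<^sup>2 + (1/2)^k - 2 * d k)"
    by (simp add: power2_eq_square algebra_simps power_one_over flip: power_mult_distrib)
  finally have "2 * d k \<le> 2 ^ k * (d k)\<^sup>2 + (1/2)^k"
    using zero_less_power[of "2::real" k] by (smt (verit) mult_neg_pos mult.commute)
  moreover have "d k \<le> 2 * d k" using assms(1)[of k] by simp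
  ultimately show "norm (d k) \<le> 2 ^ k * (d k)\<^sup>2 + (1/2) ^ k"
    using assms(1)[of k] by simp
qed

text \<open>The Riesz-Fischer argument. With weights 2^k the squared increments have integrals at
  most 2^k 4^-k = 2^-k, so their sum is finite almost everywhere and the representatives converge
  there. Fatou's lemma turns the pointwise limit into a limit in norm.\<close>

lemma hl2_fast_Cauchy_convergent:
  fixes u :: "nat \<Rightarrow> hl2"
  assumes "\<And>k. norm (u (Suc k) - u k) \<le> (1/2) ^ k"
  shows "convergent u"
proof -
  define f where "f k = rep_hl2 (u k)" for k
  have f[simp]: "f k \<in> L2 halfline" for k by (simp add: f_def)
  have u: "u k = cls (f k)" for k by (simp add: f_def)
  have [measurable]: "f k \<in> borel_measurable halfline" for k using L2_measurable[OF f] .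
  define D where "D k x = 2 ^ k * (cmod (f (Suc k) x - f k x))\<^sup>2" for k x
  have [measurable]: "D k \<in> borel_measurable halfline" for k unfolding D_def by measurable
  have "(\<integral>\<^sup>+x. ennreal (D k x) \<partial>halfline) \<le> ennreal ((1/2) ^ k)" for k
  proof -
    have i: "integrable halfline (D k)"
      unfolding D_def using L2_integrable[OF L2_diff[OF f f]] by simp
    have "(\<integral>\<^sup>+x. ennreal (D k x) \<partial>halfline) = ennreal (LINT x|halfline. D k x)"
      by (rule nn_integral_eq_integral[OF i]) (simp add: D_def)
    also have "(LINT x|halfline. D k x) = 2 ^ k * (norm (u (Suc k) - u k))\<^sup>2"
      unfolding D_def u by (simp add: norm_cls_power2 L2_diff flip: cls_diff)
    also have "\<dots> \<le> 2 ^ k * ((1/2) ^ k)\<^sup>2"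
      by (intro mult_left_mono power_mono assms) auto
    also have "\<dots> = (1/2) ^ k"
      by (simp add: power2_eq_square power_one_over)
    finally show ?thesis by (simp add: ennreal_leI)
  qed
  then have "(\<integral>\<^sup>+x. (\<Sum>k. ennreal (D k x)) \<partial>halfline) \<le> (\<Sum>k. ennreal ((1/2) ^ k))"
    by (subst nn_integral_suminf) (auto intro!: suminf_le)
  also have "\<dots> = ennreal (\<Sum>k. (1/2) ^ k)"
    by (intro suminf_ennreal2) (auto intro: summable_geometric)
  finally have "(\<integral>\<^sup>+x. (\<Sum>k. ennreal (D k x)) \<partial>halfline) \<noteq> \<infinity>"
    by (auto simp: top_unique)
  then have "AE x in halfline. (\<Sum>k. ennreal (D k x)) \<noteq> \<infinity>"
    by (intro nn_integral_PInf_AE) auto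
  then have conv: "AE x in halfline. convergent (\<lambda>k. f k x)"
  proof eventually_elim
    case (elim x)
    have "summable (\<lambda>k. D k x)"
      using elim by (intro summable_suminf_not_top) (auto simp: D_def)
    then have "summable (\<lambda>k. cmod (f (Suc k) x - f k x))"
      unfolding D_def by (rule summable_of_weighted_square[rotated]) simp
    then have "summable (\<lambda>k. f (Suc k) x - f k x)"
      by (rule summable_norm_cancel)
    then have "convergent (\<lambda>n. (\<Sum>k<n. f (Suc k) x - f k x) + f 0 x)"
      by (intro convergent_add convergent_const) (simp add: summable_iff_convergent)
    then show ?case
      by (simp add: sum_lessThan_telescope[of "\<lambda>k. f k x"])
  qed
  define F where "F x = lim (\<lambda>k. f k x)" for x
  have [measurable]: "F \<in> borel_measurable halfline" unfolding F_def by measurable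
  have lim: "AE x in halfline. (\<lambda>k. f k x) \<longlonglongrightarrow> F x"
    using conv by eventually_elim (simp add: F_def convergent_LIMSEQ_iff)
  have dist: "norm (u (k + m) - u k) \<le> 2 * (1/2) ^ k" for k m
  proof -
    have "norm (u (k + m) - u k) \<le> 2 * (1/2) ^ k - 2 * (1/2) ^ (k + m)"
    proof (induction m)
      case (Suc m)
      have "norm (u (k + Suc m) - u k) \<le> norm (u (Suc (k + m)) - u (k + m)) + norm (u (k + m) - u k)"
        using norm_triangle_ineq[of "u (Suc (k + m)) - u (k + m)" "u (k + m) - u k"] by simp
      also have "\<dots> \<le> (1/2) ^ (k + m) + (2 * (1/2) ^ k - 2 * (1/2) ^ (k + m))"
        using assms[of "k + m"] Suc by linarith
      finally show ?case by simp
    qed simp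
    moreover have "(0::real) \<le> 2 * (1/2) ^ (k + m)" by simp
    ultimately show ?thesis by linarith
  qed
  have nnF: "(\<integral>\<^sup>+x. ennreal ((cmod (F x - f k x))\<^sup>2) \<partial>halfline) \<le> ennreal ((2 * (1/2) ^ k)\<^sup>2)" for k
  proof -
    have "AE x in halfline. ennreal ((cmod (F x - f k x))\<^sup>2)
        = liminf (\<lambda>m. ennreal ((cmod (f (k + m) x - f k x))\<^sup>2))"
      using lim
    proof eventually_elim
      case (elim x)
      have "(\<lambda>m. f (k + m) x) \<longlonglongrightarrow> F x"
        using LIMSEQ_ignore_initial_segment[OF elim, of k] by (simp add: add.commute)
      then have "(\<lambda>m. ennreal ((cmod (f (k + m) x - f k x))\<^sup>2)) \<longlonglongrightarrow> ennreal ((cmod (F x - f k x))\<^sup>2)"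
        by (intro tendsto_intros)
      then show ?case by (rule lim_imp_Liminf[OF sequentially_bot, symmetric])
    qed
    then have "(\<integral>\<^sup>+x. ennreal ((cmod (F x - f k x))\<^sup>2) \<partial>halfline)
        = (\<integral>\<^sup>+x. liminf (\<lambda>m. ennreal ((cmod (f (k + m) x - f k x))\<^sup>2)) \<partial>halfline)"
      by (rule nn_integral_cong_AE)
    also have "\<dots> \<le> liminf (\<lambda>m. \<integral>\<^sup>+x. ennreal ((cmod (f (k + m) x - f k x))\<^sup>2) \<partial>halfline)"
      by (rule nn_integral_liminf) measurable
    also have "\<dots> \<le> liminf (\<lambda>m. ennreal ((2 * (1/2) ^ k)\<^sup>2))"
    proof (rule Liminf_mono, rule always_eventually, rule allI)
      fix m
      have "(\<integral>\<^sup>+x. ennreal ((cmod (f (k + m) x - f k x))\<^sup>2) \<partial>halfline)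
          = ennreal ((norm (u (k + m) - u k))\<^sup>2)"
        unfolding u by (subst nn_integral_eq_integral)
          (simp_all add: L2_integrable[OF L2_diff[OF f f]] norm_cls_power2 L2_diff flip: cls_diff)
      also have "\<dots> \<le> ennreal ((2 * (1/2) ^ k)\<^sup>2)"
        by (intro ennreal_leI power_mono dist) auto
      finally show "(\<integral>\<^sup>+x. ennreal ((cmod (f (k + m) x - f k x))\<^sup>2) \<partial>halfline) \<le> ennreal ((2 * (1/2) ^ k)\<^sup>2)" .
    qed
    finally show ?thesis by (simp add: Liminf_const)
  qed
  have FL: "(\<lambda>x. F x - f k x) \<in> L2 halfline" for k
  proof -
    have "(\<integral>\<^sup>+x. ennreal ((cmod (F x - f k x))\<^sup>2) \<partial>halfline) < \<infinity>"
      using nnF[of k] by (simp add: order_le_less_trans)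
    then have "integrable halfline (\<lambda>x. (cmod (F x - f k x))\<^sup>2)"
      by (intro integrableI_bounded) auto
    then show ?thesis by (simp add: L2_def)
  qed
  have F: "F \<in> L2 halfline"
    using L2_add[OF FL[of 0] f[of 0]] by simp
  have "norm (cls F - u k) \<le> 2 * (1/2) ^ k" for k
  proof -
    have "ennreal ((norm (cls F - u k))\<^sup>2) = (\<integral>\<^sup>+x. ennreal ((cmod (F x - f k x))\<^sup>2) \<partial>halfline)"
      unfolding u by (subst nn_integral_eq_integral)
        (simp_all add: L2_integrable[OF FL] norm_cls_power2 FL F flip: cls_diff)
    then have "(norm (cls F - u k))\<^sup>2 \<le> (2 * (1/2) ^ k)\<^sup>2"
      using nnF[of k] by (metis ennreal_le_iff zero_le_power2)
    then show ?thesis by (rule power2_le_imp_le) simp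
  qed
  moreover have "(\<lambda>k. 2 * (1/2::real) ^ k) \<longlonglongrightarrow> 0"
    by (auto intro!: tendsto_mult_right_zero LIMSEQ_realpow_zero)
  ultimately have "(\<lambda>k. cls F - u k) \<longlonglongrightarrow> 0"
    by (auto intro: Lim_null_comparison[of "\<lambda>k. cls F - u k" "\<lambda>k. 2 * (1/2) ^ k"])
  then have "(\<lambda>k. cls F - (cls F - u k)) \<longlonglongrightarrow> cls F - 0"
    by (intro tendsto_intros)
  then show ?thesis by (auto simp: convergent_def)
qed

instance hl2 :: complete_space
proof
  fix X :: "nat \<Rightarrow> hl2" assume X: "Cauchy X"
  have "\<exists>N. \<forall>m\<ge>N. \<forall>n\<ge>N. norm (X m - X n) < (1/2) ^ k" for k
    using CauchyD[OF X, of "(1/2)^k"] by simp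
  then obtain N where N: "\<And>k m n. m \<ge> N k \<Longrightarrow> n \<ge> N k \<Longrightarrow> norm (X m - X n) < (1/2) ^ k"
    by metis
  \<comment> \<open>The sum makes \<open>r k\<close> at least \<open>N k\<close>, and the summand
    \<open>k\<close> makes \<open>r\<close> strictly increasing.\<close>
  define r where "r k = k + (\<Sum>j\<le>k. N j)" for k
  have "strict_mono r" unfolding strict_mono_Suc_iff r_def by simp
  have "r k \<ge> N k" for k
    unfolding r_def using member_le_sum[of k "{..k}" N] by simp
  moreover have "r (Suc k) \<ge> r k" for k unfolding r_def by simp
  ultimately have "norm (X (r (Suc k)) - X (r k)) \<le> (1/2) ^ k" for k
    using N[of k "r (Suc k)" "r k"] order_trans less_imp_le by blast
  then have "convergent (X \<circ> r)"
    using hl2_fast_Cauchy_convergent[of "X \<circ> r"] by simp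
  then obtain l where "(X \<circ> r) \<longlonglongrightarrow> l" by (auto simp: convergent_def)
  then have "X \<longlonglongrightarrow> l"
    using Cauchy_converges_subseq[OF X \<open>strict_mono r\<close>] by blast
  then show "convergent X" by (auto simp: convergent_def)
qed

text \<open>The projection theorem in the form that the double orthogonal complement of M lies in M.
  By the parallelogram identity a minimising sequence for the distance from x to M is Cauchy; its
  limit p leaves x - p orthogonal to M, and the hypothesis for y = x - p then forces x = p. Density
  and membership in a closure are reduced below to a test against one orthogonal vector.\<close>

lemma mem_closed_subspace_if_orthogonal:
  fixes M :: "'a::{real_inner, complete_space} set"
  assumes M: "subspace M" "closed M"
    and x: "\<And>y. (\<And>m. m \<in> M \<Longrightarrow> inner m y = 0) \<Longrightarrow> inner x y = 0"
  shows "x \<in> M"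
proof -
  have ne: "M \<noteq> {}" using subspace_0[OF M(1)] by auto
  define d where "d = infdist x M"
  have d: "d \<le> norm (x - m)" if "m \<in> M" for m
    unfolding d_def using infdist_le[OF that, of x] by (simp add: dist_norm)
  have "0 \<le> d" unfolding d_def by (rule infdist_nonneg)
  have "\<exists>m\<in>M. norm (x - m) < d + inverse (real (Suc n))" for n
  proof (rule ccontr)
    assume "\<not> ?thesis"
    then have "\<And>m. m \<in> M \<Longrightarrow> d + inverse (real (Suc n)) \<le> dist x m"
      by (auto simp: dist_norm not_less)
    then have "d + inverse (real (Suc n)) \<le> infdist x M"
      unfolding infdist_notempty[OF ne] using ne by (intro cINF_greatest) auto
    then show False by (simp add: d_def)
  qed
  then obtain m where m: "\<And>n. m n \<in> M" "\<And>n. norm (x - m n) < d + inverse (real (Suc n))"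
    by metis
  have est: "(norm (m n - m k))\<^sup>2 \<le> (4 * d + 2) * (inverse (real (Suc n)) + inverse (real (Suc k)))"
    for n k
  proof -
    let ?e = "\<lambda>n. inverse (real (Suc n))"
    have e: "0 \<le> ?e j" "?e j \<le> 1" for j by (auto simp: inverse_le_1_iff)
    have sq: "(norm (x - m j))\<^sup>2 \<le> d\<^sup>2 + (2 * d + 1) * ?e j" for j
    proof -
      have "(norm (x - m j))\<^sup>2 \<le> (d + ?e j)\<^sup>2"
        using m(2)[of j] by (intro power_mono) auto
      also have "\<dots> = d\<^sup>2 + 2 * d * ?e j + ?e j * ?e j"
        by (simp add: power2_eq_square algebra_simps)
      also have "?e j * ?e j \<le> 1 * ?e j" using e by (intro mult_right_mono) auto
      finally show ?thesis by (simp add: algebra_simps)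
    qed
    have "(1/2) *\<^sub>R (m n + m k) \<in> M"
      using M(1) m(1) by (intro subspace_scale subspace_add)
    then have "d\<^sup>2 \<le> (norm (x - (1/2) *\<^sub>R (m n + m k)))\<^sup>2"
      using \<open>0 \<le> d\<close> by (intro power_mono d) auto
    moreover have "(norm (m n - m k))\<^sup>2 = 2 * (norm (x - m n))\<^sup>2 + 2 * (norm (x - m k))\<^sup>2
        - 4 * (norm (x - (1/2) *\<^sub>R (m n + m k)))\<^sup>2"
      by (simp add: power2_norm_eq_inner inner_simps inner_commute algebra_simps)
    ultimately show ?thesis using sq[of n] sq[of k] by (simp add: algebra_simps)
  qed
  have "Cauchy m"
  proof (rule CauchyI)
    fix e :: real assume "0 < e"
    then obtain N where N: "inverse (real (Suc N)) < e\<^sup>2 / (2 * (4 * d + 2))"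
      using reals_Archimedean[of "e\<^sup>2 / (2 * (4 * d + 2))"] \<open>0 \<le> d\<close>
      by (meson \<open>0 < e\<close> add_nonneg_pos divide_pos_pos mult_nonneg_nonneg mult_pos_pos
          zero_le_numeral zero_less_numeral zero_less_power)
    have "norm (m n - m k) < e" if "n \<ge> N" "k \<ge> N" for n k
    proof (rule power2_less_imp_less)
      have "inverse (real (Suc n)) \<le> inverse (real (Suc N))" "inverse (real (Suc k)) \<le> inverse (real (Suc N))"
        using that by (intro le_imp_inverse_le; simp)+
      then have "inverse (real (Suc n)) + inverse (real (Suc k)) \<le> 2 * inverse (real (Suc N))"
        by linarith
      then have "(norm (m n - m k))\<^sup>2 \<le> (4 * d + 2) * (2 * inverse (real (Suc N)))"
        using \<open>0 \<le> d\<close> by (intro order_trans[OF est] mult_left_mono) auto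
      also have "\<dots> < e\<^sup>2" using N \<open>0 \<le> d\<close> by (simp add: field_simps)
      finally show "(norm (m n - m k))\<^sup>2 < e\<^sup>2" .
    qed (use \<open>0 < e\<close> in simp)
    then show "\<exists>M. \<forall>n\<ge>M. \<forall>k\<ge>M. norm (m n - m k) < e" by blast
  qed
  then obtain p where p: "m \<longlonglongrightarrow> p" using Cauchy_convergent_iff convergent_def by blast
  then have "p \<in> M" using closed_sequentially[OF M(2)] m(1) by blast
  have "(\<lambda>n. norm (x - m n)) \<longlonglongrightarrow> norm (x - p)" using p by (intro tendsto_intros)
  moreover have "(\<lambda>n. d + inverse (real (Suc n))) \<longlonglongrightarrow> d + 0"
    by (intro tendsto_intros LIMSEQ_inverse_real_of_nat)
  ultimately have "norm (x - p) \<le> d"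
    using LIMSEQ_le[of "\<lambda>n. norm (x - m n)" _ "\<lambda>n. d + inverse (real (Suc n))"] m(2)
    by (force intro: less_imp_le)
  have orth: "inner q (x - p) = 0" if "q \<in> M" for q
  proof (rule ccontr)
    define a where "a = inner q (x - p)"
    assume "inner q (x - p) \<noteq> 0"
    then have "a \<noteq> 0" "q \<noteq> 0" by (auto simp: a_def)
    \<comment> \<open>The minimiser over t of the squared norm of x - p - t q.\<close>
    define t where "t = a / (norm q)\<^sup>2"
    have "p + t *\<^sub>R q \<in> M" using M(1) \<open>p \<in> M\<close> that by (intro subspace_add subspace_scale)
    then have "(norm (x - p))\<^sup>2 \<le> (norm (x - (p + t *\<^sub>R q)))\<^sup>2"
      using d \<open>norm (x - p) \<le> d\<close> order_trans by (intro power_mono) auto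
    also have "\<dots> = (norm (x - p))\<^sup>2 - 2 * t * a + t\<^sup>2 * (norm q)\<^sup>2"
      unfolding a_def power2_norm_eq_inner
      by (simp add: inner_simps inner_commute power2_eq_square algebra_simps)
    also have "t\<^sup>2 * (norm q)\<^sup>2 = t * a" using \<open>q \<noteq> 0\<close> by (simp add: t_def power2_eq_square)
    finally have "t * a \<le> 0" by (simp add: mult.commute)
    moreover have "t * a = a\<^sup>2 / (norm q)\<^sup>2" by (simp add: t_def power2_eq_square)
    moreover have "\<dots> > 0" using \<open>a \<noteq> 0\<close> \<open>q \<noteq> 0\<close> by simp
    ultimately show False by (simp add: mult.commute)
  qed
  then have "inner x (x - p) = 0" "inner p (x - p) = 0" using x \<open>p \<in> M\<close> by auto
  then have "inner (x - p) (x - p) = 0" by (simp add: inner_diff_left)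
  then show "x \<in> M" using \<open>p \<in> M\<close> by simp
qed

section \<open>Uniqueness of Gaussian moments\<close>

text \<open>A Lebesgue set differs from a Borel set by a null set, so the hypothesis extends to
  Lebesgue sets. The sets where K \<ge> 0 and where K \<le> 0 then give the two
  inequalities.\<close>

lemma AE_zero_of_set_integrals:
  fixes K :: "real \<Rightarrow> real"
  assumes K: "integrable lebesgue K"
    and zero: "\<And>A. A \<in> sets borel \<Longrightarrow> (LINT x|lebesgue. indicator A x * K x) = 0"
  shows "AE x in lebesgue. K x = 0"
proof -
  have [measurable]: "K \<in> borel_measurable lebesgue" using K by simp
  have zero': "(LINT x|lebesgue. indicator A x * K x) = 0" if A: "A \<in> sets lebesgue" for A
  proof -
    from A obtain S N N' where SN: "A = S \<union> N" "N \<subseteq> N'" "N' \<in> null_sets lborel" "S \<in> sets lborel"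
      by (auto elim: sets_completionE)
    have ne: "AE x in lebesgue. x \<notin> N'"
      using SN(3) by (intro AE_completion AE_not_in)
    have [measurable]: "S \<in> sets lebesgue" "A \<in> sets lebesgue"
      using SN(4) A by auto
    have "AE x in lebesgue. indicator A x * K x = indicator S x * K x"
      using ne by eventually_elim (use SN(1,2) in \<open>auto simp: indicator_def\<close>)
    then have "(LINT x|lebesgue. indicator A x * K x) = (LINT x|lebesgue. indicator S x * K x)"
      by (rule integral_cong_AE[rotated 2]) measurable
    then show ?thesis using zero SN(4) by simp
  qed
  have half: "AE x in lebesgue. J x \<le> 0" if J: "J = K \<or> J = (\<lambda>x. - K x)" for J
  proof -
    define A where "A = {x. 0 \<le> J x}"
    have [measurable]: "J \<in> borel_measurable lebesgue" using J by auto
    have "{x \<in> space lebesgue. 0 \<le> J x} \<in> sets lebesgue" by measurable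
    then have A[measurable]: "A \<in> sets lebesgue" by (simp add: A_def)
    have "integrable lebesgue J" using J K by auto
    then have i: "integrable lebesgue (\<lambda>x. indicator A x * J x)"
      using integrable_real_mult_indicator[OF A] by (simp add: mult.commute)
    have "(LINT x|lebesgue. indicator A x * J x) = 0"
      using J zero'[OF A] by auto
    moreover have "AE x in lebesgue. 0 \<le> indicator A x * J x"
      by (auto simp: A_def indicator_def)
    ultimately have "AE x in lebesgue. indicator A x * J x = 0"
      using integral_nonneg_eq_0_iff_AE[OF i] by simp
    then show ?thesis
      by eventually_elim (auto simp: A_def indicator_def split: if_splits)
  qed
  show ?thesis
    using half[of K] half[of "\<lambda>x. - K x"] by (auto elim: eventually_elim2)
qed

text \<open>Dynkin's theorem: the open rays generate the Borel sets and are stable under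
  intersection, while a vanishing integral passes to complements (by \<open>K0\<close>) and to
  countable disjoint unions.\<close>

lemma AE_zero_of_tail_integrals:
  fixes K :: "real \<Rightarrow> real"
  assumes K: "integrable lebesgue K" and K0: "(LINT x|lebesgue. K x) = 0"
    and tail: "\<And>r. (LINT x|lebesgue. indicator {r<..} x * K x) = 0"
  shows "AE x in lebesgue. K x = 0"
proof (rule AE_zero_of_set_integrals[OF K])
  have iK: "integrable lebesgue (\<lambda>x. indicator A x * K x)" if "A \<in> sets borel" for A
    using integrable_real_mult_indicator[of A, OF _ K] that by (simp add: mult.commute)
  fix A :: "real set" assume A: "A \<in> sets borel"
  have b: "sets borel = sigma_sets UNIV (range greaterThan :: real set set)"
    by (simp add: borel_Ioi)
  have stable: "Int_stable (range greaterThan :: real set set)"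
    unfolding Int_stable_def
  proof clarify
    fix a b :: real
    have "{a<..} \<inter> {b<..} = {max a b<..}" by auto
    then show "{a<..} \<inter> {b<..} \<in> range greaterThan" by auto
  qed
  have sub: "range greaterThan \<subseteq> Pow (UNIV :: real set)" by simp
  have A': "A \<in> sigma_sets UNIV (range greaterThan)" using A b by simp
  show "(LINT x|lebesgue. indicator A x * K x) = 0"
    using stable sub A'
  proof (induction rule: sigma_sets_induct_disjoint)
    case (basic B) then show ?case using tail by auto
  next
    case empty then show ?case by simp
  next
    case (compl B)
    have "B \<in> sets borel" using compl(1) b by simp
    then have "(LINT x|lebesgue. K x - indicator B x * K x) = 0"
      using K0 compl(2) iK K by simp
    moreover have "K x - indicator B x * K x = indicator (UNIV - B) x * K x" for x
      by (simp add: indicator_def)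
    ultimately show ?case by simp
  next
    case (union B)
    have Bs: "B i \<in> sets borel" for i using union(2) b by auto
    have U: "(\<Union>i. B i) \<in> sets borel" using Bs by auto
    have "(LINT x:(\<Union>i. B i)|lebesgue. K x) = (\<Sum>i. LINT x:B i|lebesgue. K x)"
      using union(1) Bs iK[OF U]
      by (intro lebesgue_integral_countable_add)
         (auto simp: disjoint_family_on_def set_integrable_def)
    then show ?case using union(3) by (simp add: set_lebesgue_integral_def)
  qed
qed

lemma halfline_integral:
  fixes f :: "real \<Rightarrow> 'b::{banach, second_countable_topology}"
  shows "(LINT x|halfline. f x) = (LINT x|lebesgue. indicator {0<..} x *\<^sub>R f x)"
  unfolding halfline_def by (rule integral_restrict_space) simp

lemma halfline_integrable:
  fixes f :: "real \<Rightarrow> 'b::{banach, second_countable_topology}"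
  shows "integrable halfline f \<longleftrightarrow> integrable lebesgue (\<lambda>x. indicator {0<..} x *\<^sub>R f x)"
  unfolding halfline_def by (rule integrable_restrict_space) simp

lemma AE_halfline: "(AE x in halfline. P x) \<longleftrightarrow> (AE x in lebesgue. 0 < x \<longrightarrow> P x)"
  unfolding halfline_def by (subst AE_restrict_space_iff) auto

lemma continuous_on_halfline_measurable:
  fixes f :: "real \<Rightarrow> 'b::euclidean_space"
  shows "continuous_on {0<..} f \<Longrightarrow> f \<in> borel_measurable halfline"
  unfolding halfline_def by (rule continuous_imp_measurable_on_sets_lebesgue) simp_all

text \<open>Weierstrass approximation: by \<open>mom\<close> the claim holds for polynomials, and a
  polynomial within e of h on {0..1}, where y takes its values, changes the integral by at most e
  times the integral of |G|.\<close>

lemma integral_against_continuous_zero: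
  fixes G :: "real \<Rightarrow> real" and y :: "real \<Rightarrow> real"
  assumes G: "integrable M G" and [measurable]: "y \<in> borel_measurable M"
    and y: "\<And>x. y x \<in> {0..1}"
    and mom: "\<And>n. (LINT x|M. G x * y x ^ n) = 0"
    and h: "continuous_on UNIV h"
  shows "(LINT x|M. G x * h (y x)) = 0"
proof -
  have [measurable]: "G \<in> borel_measurable M" "h \<in> borel_measurable borel"
    using G h by (auto intro: borel_measurable_continuous_onI)
  have iG: "integrable M (\<lambda>x. G x * f (y x))"
    if "continuous_on {0..1} f" and [measurable]: "f \<in> borel_measurable borel" for f :: "real \<Rightarrow> real"
  proof -
    have "bounded (f ` {0..1})"
      by (intro compact_imp_bounded compact_continuous_image that(1)) simp
    then obtain C where C: "\<And>t. t \<in> {0..1} \<Longrightarrow> \<bar>f t\<bar> \<le> C"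
      unfolding bounded_iff by (metis imageI real_norm_def)
    show ?thesis
      by (rule Bochner_Integration.integrable_bound[where f = "\<lambda>x. C * G x"])
         (use G C[OF y] in \<open>auto simp: abs_mult mult.commute[of "\<bar>C\<bar>"] intro!: AE_I2 mult_left_mono
            intro: order_trans[OF _ abs_ge_self]\<close>)
  qed
  have small: "\<bar>LINT x|M. G x * h (y x)\<bar> \<le> e * (LINT x|M. \<bar>G x\<bar>)" if e: "0 < e" for e
  proof -
    have "\<exists>p. real_polynomial_function p \<and> (\<forall>t\<in>{0..1}. \<bar>h t - p t\<bar> < e)"
      by (rule Stone_Weierstrass_real_polynomial_function[OF compact_Icc[of 0 1]
            continuous_on_subset[OF h subset_UNIV] e]) blast
    then obtain p where p: "real_polynomial_function p" "\<And>t. t \<in> {0..1} \<Longrightarrow> \<bar>h t - p t\<bar> < e"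
      by blast
    obtain a n where pa: "p = (\<lambda>t. \<Sum>i\<le>n. a i * t ^ i)"
      using p(1) by (auto simp: real_polynomial_function_iff_sum)
    have cp: "continuous_on UNIV p" unfolding pa by (intro continuous_intros)
    then have [measurable]: "p \<in> borel_measurable borel" by (rule borel_measurable_continuous_onI)
    have ipow: "integrable M (\<lambda>x. G x * y x ^ i)" for i
      by (rule iG) (auto intro!: continuous_intros)
    have "(LINT x|M. G x * p (y x)) = (LINT x|M. (\<Sum>i\<le>n. a i * (G x * y x ^ i)))"
      by (simp add: pa sum_distrib_left mult_ac)
    also have "\<dots> = (\<Sum>i\<le>n. a i * (LINT x|M. G x * y x ^ i))"
      using ipow by (subst Bochner_Integration.integral_sum) auto
    finally have p0: "(LINT x|M. G x * p (y x)) = 0" by (simp add: mom)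
    have ih: "integrable M (\<lambda>x. G x * h (y x))" "integrable M (\<lambda>x. G x * p (y x))"
      using h cp by (auto intro!: iG intro: continuous_on_subset)
    then have "(LINT x|M. G x * h (y x)) = (LINT x|M. G x * h (y x) - G x * p (y x))"
      by (simp add: p0)
    also have "\<bar>\<dots>\<bar> \<le> (LINT x|M. \<bar>G x * h (y x) - G x * p (y x)\<bar>)"
      by (rule integral_abs_bound)
    also have "\<dots> \<le> (LINT x|M. e * \<bar>G x\<bar>)"
    proof (rule integral_mono)
      fix x
      have "\<bar>h (y x) - p (y x)\<bar> * \<bar>G x\<bar> \<le> e * \<bar>G x\<bar>"
        using p(2)[OF y[of x]] by (intro mult_right_mono) auto
      then show "\<bar>G x * h (y x) - G x * p (y x)\<bar> \<le> e * \<bar>G x\<bar>"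
        by (simp add: abs_mult mult.commute flip: right_diff_distrib)
    qed (use ih G in auto)
    finally show ?thesis by simp
  qed
  have "\<bar>LINT x|M. G x * h (y x)\<bar> \<le> 0"
  proof (rule field_le_epsilon)
    fix e :: real assume e: "0 < e"
    define I where "I = (LINT x|M. \<bar>G x\<bar>)"
    have I: "0 \<le> I" unfolding I_def by simp
    from small[of "e / (I + 1)"] have "\<bar>LINT x|M. G x * h (y x)\<bar> \<le> e / (I + 1) * I"
      using divide_pos_pos[OF e, of "I + 1"] I unfolding I_def by linarith
    also have "\<dots> \<le> e" using e I by (simp add: field_simps)
    finally show "\<bar>LINT x|M. G x * h (y x)\<bar> \<le> 0 + e" by simp
  qed
  then show ?thesis by simp
qed

text \<open>The substitution y = exp (- x^2/2) turns Gaussian moments into power moments on the unit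
  interval. These determine the integrals over {y < s}, and since y decreases on the half-line these
  sets are rays in x.\<close>

lemma AE_zero_of_gaussian_moments_real:
  fixes F :: "real \<Rightarrow> real"
  assumes F: "\<And>n. integrable halfline (\<lambda>x. F x * exp (- (real (Suc n) * x\<^sup>2 / 2)))"
    and mom: "\<And>n. (LINT x|halfline. F x * exp (- (real (Suc n) * x\<^sup>2 / 2))) = 0"
  shows "AE x in halfline. F x = 0"
proof -
  define y where "y x = exp (- (x\<^sup>2 / 2))" for x :: real
  \<comment> \<open>\<open>F\<close> need not be integrable by itself, so one factor
    \<open>y\<close> stays in \<open>G\<close>; this is why the Gaussian exponents start at
    \<open>Suc n\<close> and the power moments at 0.\<close>
  define G where "G x = F x * y x" for x
  have ym[measurable]: "y \<in> borel_measurable halfline"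
    unfolding y_def by (intro continuous_on_halfline_measurable continuous_intros) simp
  have Gy: "G x * y x ^ n = F x * exp (- (real (Suc n) * x\<^sup>2 / 2))" for x n
    unfolding G_def y_def by (simp add: exp_of_nat_mult[symmetric] exp_add[symmetric] algebra_simps add_divide_distrib)
  have G: "integrable halfline G" using F[of 0] unfolding Gy[symmetric] by simp
  then have [measurable]: "G \<in> borel_measurable halfline" by simp
  have y: "y x \<in> {0..1}" for x by (auto simp: y_def)
  have cont: "(LINT x|halfline. G x * h (y x)) = 0" if "continuous_on UNIV h" for h
    by (rule integral_against_continuous_zero[OF G ym y _ that]) (unfold Gy, rule mom)
  have below: "(LINT x|halfline. G x * indicator {..<s} (y x)) = 0" for s
  proof -
    \<comment> \<open>Continuous ramps of slope k that converge pointwise to the indicator of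
      {..<s}.\<close>
    define h where "h k t = max 0 (min 1 (real k * (s - t)))" for k :: nat and t :: real
    have hc: "continuous_on UNIV (h k)" for k unfolding h_def by (intro continuous_intros)
    then have [measurable]: "h k \<in> borel_measurable borel" for k by (rule borel_measurable_continuous_onI)
    have hl: "(\<lambda>k. h k t) \<longlonglongrightarrow> indicator {..<s} t" for t
    proof (cases "t < s")
      case True
      obtain k0 :: nat where k0: "1 / (s - t) \<le> real k0" using real_arch_simple by blast
      have "h k t = 1" if "k \<ge> k0" for k
      proof -
        have "1 / (s - t) \<le> real k" using that k0 by linarith
        then show ?thesis unfolding h_def using True by (simp add: field_simps)
      qed
      then show ?thesis using True
        by (intro tendsto_eventually eventually_sequentiallyI[of k0]) simp
    next
      case False
      have "h k t = 0" for k
      proof -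
        have "real k * (s - t) \<le> 0" using False by (simp add: mult_nonneg_nonpos)
        then show ?thesis unfolding h_def by linarith
      qed
      then show ?thesis using False by simp
    qed
    have "(\<lambda>k. LINT x|halfline. G x * h k (y x)) \<longlonglongrightarrow> (LINT x|halfline. G x * indicator {..<s} (y x))"
    proof (rule integral_dominated_convergence[where w = "\<lambda>x. \<bar>G x\<bar>"])
      have "\<bar>h k t\<bar> \<le> 1" for k t unfolding h_def by auto
      then have "\<bar>G x\<bar> * \<bar>h k (y x)\<bar> \<le> \<bar>G x\<bar>" for k x
        by (intro mult_left_le) auto
      then show "AE x in halfline. norm (G x * h k (y x)) \<le> \<bar>G x\<bar>" for k
        by (simp add: abs_mult)
      show "AE x in halfline. (\<lambda>k. G x * h k (y x)) \<longlonglongrightarrow> G x * indicator {..<s} (y x)"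
        by (intro AE_I2 tendsto_mult_left hl)
    qed (use G in auto)
    then have "(\<lambda>k. 0) \<longlonglongrightarrow> (LINT x|halfline. G x * indicator {..<s} (y x))"
      by (simp only: cont[OF hc])
    then show ?thesis by (rule LIMSEQ_unique[OF _ tendsto_const])
  qed
  define K where "K x = indicator {0<..} x * G x" for x
  have iK: "integrable lebesgue K" using G unfolding K_def halfline_integrable by simp
  have tail: "(LINT x|lebesgue. indicator {r<..} x * K x) = 0" if "0 \<le> r" for r
  proof -
    have sq: "r\<^sup>2 < x\<^sup>2 \<longleftrightarrow> r < x" if "0 < x" for x
      using that \<open>0 \<le> r\<close> by (meson less_imp_le power2_less_imp_less power_strict_mono zero_less_numeral)
    have "y x < y r \<longleftrightarrow> r < x" if "0 < x" for x
      using sq[OF that] by (simp add: y_def)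
    then have "indicator {r<..} x * K x = indicator {0<..} x *\<^sub>R (G x * indicator {..<y r} (y x))" for x
      by (cases "0 < x") (simp_all add: K_def indicator_def)
    then show ?thesis using below[of "y r"] unfolding halfline_integral by simp
  qed
  have "(LINT x|lebesgue. K x) = 0"
  proof -
    have "K = (\<lambda>x. indicator {0<..} x * K x)" by (auto simp: K_def indicator_def)
    then show ?thesis using tail[of 0] by (metis order_refl)
  qed
  moreover have "(LINT x|lebesgue. indicator {r<..} x * K x) = 0" for r
  proof (cases "0 \<le> r")
    case False
    then have "(\<lambda>x. indicator {r<..} x * K x) = (\<lambda>x. indicator {0<..} x * K x)"
      by (auto simp: K_def indicator_def)
    then show ?thesis using tail[of 0] by (simp only: order_refl)
  qed (rule tail)
  ultimately have "AE x in lebesgue. K x = 0"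
    by (rule AE_zero_of_tail_integrals[OF iK])
  then show ?thesis
    unfolding AE_halfline by eventually_elim (auto simp: K_def G_def y_def)
qed

lemma AE_zero_of_gaussian_moments:
  fixes F :: "real \<Rightarrow> complex"
  assumes F: "\<And>n. integrable halfline (\<lambda>x. F x * of_real (exp (- (real (Suc n) * x\<^sup>2 / 2))))"
    and mom: "\<And>n. (LINT x|halfline. F x * of_real (exp (- (real (Suc n) * x\<^sup>2 / 2)))) = 0"
  shows "AE x in halfline. F x = 0"
proof -
  have "AE x in halfline. Re (F x) = 0"
  proof (rule AE_zero_of_gaussian_moments_real)
    fix n show "integrable halfline (\<lambda>x. Re (F x) * exp (- (real (Suc n) * x\<^sup>2 / 2)))"
      using integrable_Re[OF F[of n]] by simp
    show "(LINT x|halfline. Re (F x) * exp (- (real (Suc n) * x\<^sup>2 / 2))) = 0"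
      using integral_Re[OF F[of n]] mom[of n] by simp
  qed
  moreover have "AE x in halfline. Im (F x) = 0"
  proof (rule AE_zero_of_gaussian_moments_real)
    fix n show "integrable halfline (\<lambda>x. Im (F x) * exp (- (real (Suc n) * x\<^sup>2 / 2)))"
      using integrable_Im[OF F[of n]] by simp
    show "(LINT x|halfline. Im (F x) * exp (- (real (Suc n) * x\<^sup>2 / 2))) = 0"
      using integral_Im[OF F[of n]] mom[of n] by simp
  qed
  ultimately show ?thesis by eventually_elim (simp add: complex_eq_iff)
qed

section \<open>The Gaussian family\<close>

text \<open>A second order estimate is what is available in two places: for the curve of Gaussians
  in \<open>hl2\<close>, and at the endpoints of the cut-off functions.\<close>

lemma has_vector_derivativeI_quadratic:
  fixes f :: "real \<Rightarrow> 'a::real_normed_vector"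
  assumes "0 < \<delta>" and "\<And>h. \<bar>h\<bar> < \<delta> \<Longrightarrow> norm (f (s + h) - f s - h *\<^sub>R f') \<le> C * h\<^sup>2"
  shows "(f has_vector_derivative f') (at s)"
  unfolding has_vector_derivative_def has_derivative_at_alt
proof (intro conjI allI impI)
  show "bounded_linear (\<lambda>h. h *\<^sub>R f')" by (rule bounded_linear_scaleR_left)
  fix e :: real assume e: "0 < e"
  define d where "d = min \<delta> (e / (\<bar>C\<bar> + 1))"
  have "0 < d" using assms(1) e by (simp add: d_def)
  moreover have "norm (f y - f s - (y - s) *\<^sub>R f') \<le> e * norm (y - s)" if "norm (y - s) < d" for y
  proof -
    have "norm (f (s + (y - s)) - f s - (y - s) *\<^sub>R f') \<le> C * (y - s)\<^sup>2"
      using that by (intro assms(2)) (simp add: d_def)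
    also have "\<dots> \<le> (\<bar>C\<bar> + 1) * (y - s)\<^sup>2" by (intro mult_right_mono) auto
    also have "\<dots> = (\<bar>C\<bar> + 1) * \<bar>y - s\<bar> * \<bar>y - s\<bar>" by (simp add: power2_eq_square)
    also have "\<dots> \<le> e * \<bar>y - s\<bar>"
    proof (rule mult_right_mono)
      have "\<bar>y - s\<bar> \<le> e / (\<bar>C\<bar> + 1)" using that by (simp add: d_def)
      then have "(\<bar>C\<bar> + 1) * \<bar>y - s\<bar> \<le> (\<bar>C\<bar> + 1) * (e / (\<bar>C\<bar> + 1))" by (intro mult_left_mono) auto
      also have "\<dots> = e" by simp
      finally show "(\<bar>C\<bar> + 1) * \<bar>y - s\<bar> \<le> e" .
    qed simp
    finally show ?thesis by simp
  qed
  ultimately show "\<exists>d>0. \<forall>y. norm (y - s) < d \<longrightarrow> norm (f y - f s - (y - s) *\<^sub>R f') \<le> e * norm (y - s)"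
    by blast
qed

lemma exp_minus_L2: "(\<lambda>x. complex_of_real (exp (- x))) \<in> L2 halfline"
proof -
  have 1: "(\<lambda>x::real. exp (- 2 * x)) integrable_on {0..}"
    using integrable_on_exp_minus_to_infinity[of 2 0] by simp
  have "(\<lambda>x::real. exp (- 2 * x)) integrable_on {0<..}"
  proof (rule integrable_spike_set[OF 1])
    show "negligible {x \<in> {0..} - {0<..}. exp (- 2 * x) \<noteq> (0::real)}"
      by (rule negligible_subset[OF negligible_sing[of 0]]) auto
    show "negligible {x \<in> {0<..} - {0..}. exp (- 2 * x) \<noteq> (0::real)}"
      by (rule negligible_subset[OF negligible_empty]) auto
  qed
  then have "(\<lambda>x::real. exp (- 2 * x)) absolutely_integrable_on {0<..}"
    by (rule nonnegative_absolutely_integrable_1) simp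
  then have "integrable halfline (\<lambda>x. exp (- 2 * x))"
    unfolding halfline_def by (rule absolutely_integrable_imp_integrable) simp
  moreover have "(cmod (complex_of_real (exp (- x))))\<^sup>2 = exp (- 2 * x)" for x
    by (simp add: power2_eq_square flip: exp_add)
  moreover have "(\<lambda>x. complex_of_real (exp (- x))) \<in> borel_measurable halfline"
    by (intro continuous_on_halfline_measurable continuous_intros)
  ultimately show ?thesis by (simp add: L2_def)
qed

lemma powr_gaussian_bound:
  fixes a p :: real
  assumes "0 < a" "0 \<le> p"
  obtains C where "0 < C" "\<And>x. 0 < x \<Longrightarrow> x powr p * exp (- a * x\<^sup>2) \<le> C * exp (- x)"
proof -
  \<comment> \<open>With \<open>1 + x\<close> in place of \<open>x\<close> the function is
    continuous on the closed interval also for p = 0, where \<open>0 powr 0 = 0\<close> would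
    produce a jump.\<close>
  define g where "g x = (1 + x) powr p * exp (x - a * x\<^sup>2)" for x
  have "(g \<longlongrightarrow> 0) at_top"
    unfolding g_def using assms by real_asymp
  then have "\<forall>\<^sub>F x in at_top. g x < 1" by (rule order_tendstoD) simp
  then obtain R where R: "\<And>x. x \<ge> R \<Longrightarrow> g x < 1" by (auto simp: eventually_at_top_linorder)
  have "continuous_on {0..max R 0} g"
    unfolding g_def by (intro continuous_intros) auto
  then have "bounded (g ` {0..max R 0})"
    by (intro compact_imp_bounded compact_continuous_image) auto
  then obtain B where B: "\<And>x. x \<in> {0..max R 0} \<Longrightarrow> \<bar>g x\<bar> \<le> B"
    unfolding bounded_iff by (metis imageI real_norm_def)
  show ?thesis
  proof
    show "0 < max B 1" by simp
    fix x :: real assume x: "0 < x"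
    have "x powr p \<le> (1 + x) powr p" using x assms by (intro powr_mono2) auto
    then have "x powr p * exp (- a * x\<^sup>2) \<le> (1 + x) powr p * exp (- a * x\<^sup>2)"
      by (intro mult_right_mono) auto
    also have "\<dots> = g x * exp (- x)"
      by (simp add: g_def exp_diff exp_minus field_simps)
    also have "g x \<le> max B 1"
      using R[of x] B[of x] x by (cases "x \<ge> R") (auto simp: le_max_iff_disj)
    finally show "x powr p * exp (- a * x\<^sup>2) \<le> max B 1 * exp (- x)" by simp
  qed
qed

text \<open>\<open>x powr c\<close> is annihilated by L = d/dx - c/x. For c = \<nu> + 1/2 with \<nu>
  > 0 it is the regular one of the two solutions x^(1/2 + \<nu>), x^(1/2 - \<nu>) of S u = 0, the
  behaviour at 0 that the Friedrichs extension selects. The argument \<open>z\<close> is an inverse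
  squared width.\<close>

definition gauss :: "real \<Rightarrow> complex \<Rightarrow> real \<Rightarrow> complex" where
  "gauss c z x = of_real (x powr c) * exp (- z * of_real (x\<^sup>2) / 2)"

text \<open>The normalisation is such that \<open>- L\<^sup>* L\<close> acts as \<open>2 d/d\<zeta>\<close>, see \<open>Gam_friedrichs\<close>.\<close>

definition gam :: "real \<Rightarrow> complex \<Rightarrow> real \<Rightarrow> complex" where
  "gam c \<zeta> x = \<zeta> powr (- of_real (c + 1/2)) * gauss c (1 / \<zeta>) x"

text \<open>The logarithmic derivative of \<open>gam\<close> in the parameter \<zeta>.\<close>

definition dgam_factor :: "real \<Rightarrow> complex \<Rightarrow> real \<Rightarrow> complex" where
  "dgam_factor c \<zeta> x = of_real (x\<^sup>2) / (2 * \<zeta>\<^sup>2) - of_real (c + 1/2) / \<zeta>"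

definition dgam :: "real \<Rightarrow> complex \<Rightarrow> real \<Rightarrow> complex" where
  "dgam c \<zeta> x = dgam_factor c \<zeta> x * gam c \<zeta> x"

definition ddgam :: "real \<Rightarrow> complex \<Rightarrow> real \<Rightarrow> complex" where
  "ddgam c \<zeta> x = (of_real (c + 1/2) / \<zeta>\<^sup>2 - of_real (x\<^sup>2) / \<zeta> ^ 3) * gam c \<zeta> x
     + dgam_factor c \<zeta> x * dgam c \<zeta> x"

lemma norm_gauss: "cmod (gauss c z x) = x powr c * exp (- (Re z * x\<^sup>2 / 2))"
  by (simp add: gauss_def norm_mult del: of_real_power)

lemma continuous_on_gauss: "continuous_on {0<..} (gauss c z)"
  unfolding gauss_def by (intro continuous_intros) auto

lemma measurable_halfline_ident [measurable]: "(\<lambda>x. x) \<in> borel_measurable halfline"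
  by (intro continuous_on_halfline_measurable continuous_intros)

lemma gam_measurable [measurable]:
  "gauss c z \<in> borel_measurable halfline" "gam c \<zeta> \<in> borel_measurable halfline"
  "dgam c \<zeta> \<in> borel_measurable halfline"
proof -
  have [measurable]: "gauss c z \<in> borel_measurable halfline" for z
    by (intro continuous_on_halfline_measurable continuous_on_gauss)
  show "gauss c z \<in> borel_measurable halfline" "gam c \<zeta> \<in> borel_measurable halfline"
    "dgam c \<zeta> \<in> borel_measurable halfline"
    unfolding gam_def dgam_def dgam_factor_def by measurable
qed

lemma gauss_L2:
  assumes "0 < Re z" "0 \<le> c"
  shows "(\<lambda>x. of_real (x ^ m) * gauss c z x) \<in> L2 halfline"
proof -
  obtain C where C: "0 < C" "\<And>x. 0 < x \<Longrightarrow> x powr (real m + c) * exp (- (Re z / 2) * x\<^sup>2) \<le> C * exp (- x)"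
    using powr_gaussian_bound[of "Re z / 2" "real m + c"] assms by auto
  show ?thesis
  proof (rule L2_bound[OF exp_minus_L2])
    show "(\<lambda>x. of_real (x ^ m) * gauss c z x) \<in> borel_measurable halfline"
      by (intro continuous_on_halfline_measurable continuous_intros continuous_on_gauss)
    show "AE x in halfline. cmod (of_real (x ^ m) * gauss c z x) \<le> C * cmod (complex_of_real (exp (- x)))"
    proof (rule AE_I2)
      fix x assume "x \<in> space halfline"
      then have x: "0 < x" by (simp add: halfline_def)
      have "cmod (of_real (x ^ m) * gauss c z x) = x powr (real m + c) * exp (- (Re z / 2) * x\<^sup>2)"
        using x by (simp add: norm_mult norm_gauss powr_add powr_realpow norm_power del: of_real_power)
      then show "cmod (of_real (x ^ m) * gauss c z x) \<le> C * cmod (complex_of_real (exp (- x)))"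
        using C(2)[OF x] by simp
    qed
  qed
qed

text \<open>Re (1/\<zeta>) = Re \<zeta> / |\<zeta>|^2 is bounded below on the region, which gives a
  uniform Gaussian decay rate. The weight 1 + x^4 leaves room for two derivatives in \<zeta>, each
  of which costs a factor of order x^2. The constant |R| + 1 keeps the denominator positive for
  every R.\<close>

lemma gam_bound:
  assumes "0 < r" "0 \<le> c"
  obtains C where "0 < C"
    "\<And>\<zeta> x. r \<le> Re \<zeta> \<Longrightarrow> cmod \<zeta> \<le> R \<Longrightarrow> 0 < x \<Longrightarrow> (1 + x ^ 4) * cmod (gam c \<zeta> x) \<le> C * exp (- x)"
proof -
  define a where "a = r / (2 * (\<bar>R\<bar> + 1)\<^sup>2)"
  have a: "0 < a" using assms by (simp add: a_def)
  obtain C0 where C0: "0 < C0" "\<And>x. 0 < x \<Longrightarrow> x powr c * exp (- a * x\<^sup>2) \<le> C0 * exp (- x)"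
    using powr_gaussian_bound[OF a] assms by blast
  obtain C4 where C4: "0 < C4" "\<And>x. 0 < x \<Longrightarrow> x powr (4 + c) * exp (- a * x\<^sup>2) \<le> C4 * exp (- x)"
    using powr_gaussian_bound[OF a, of "4 + c"] assms by auto
  show ?thesis
  proof
    show "0 < r powr (- (c + 1/2)) * (C0 + C4)" using C0 C4 assms by simp
    fix \<zeta> :: complex and x :: real assume \<zeta>: "r \<le> Re \<zeta>" "cmod \<zeta> \<le> R" and x: "0 < x"
    have n: "r \<le> cmod \<zeta>" using \<zeta> complex_Re_le_cmod[of \<zeta>] by linarith
    have "cmod (\<zeta> powr (- of_real (c + 1/2))) = cmod \<zeta> powr (- (c + 1/2))"
      using norm_powr_real_powr'[of "- of_real (c + 1/2)" \<zeta>] by simp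
    also have "\<dots> \<le> r powr (- (c + 1/2))"
      using n assms by (intro powr_mono2') auto
    finally have 1: "cmod (\<zeta> powr (- of_real (c + 1/2))) \<le> r powr (- (c + 1/2))" .
    have "2 * a \<le> Re (1 / \<zeta>)"
    proof -
      have "(cmod \<zeta>)\<^sup>2 \<le> (\<bar>R\<bar> + 1)\<^sup>2" using \<zeta> by (intro power_mono) auto
      moreover have "0 < (cmod \<zeta>)\<^sup>2" using less_le_trans[OF assms(1) n] by (rule zero_less_power)
      ultimately have "r / (\<bar>R\<bar> + 1)\<^sup>2 \<le> Re \<zeta> / (cmod \<zeta>)\<^sup>2"
        using \<zeta> assms by (intro frac_le) auto
      then show ?thesis by (simp add: a_def Re_divide cmod_power2)
    qed
    then have "2 * a * (x\<^sup>2 / 2) \<le> Re (1 / \<zeta>) * (x\<^sup>2 / 2)" by (intro mult_right_mono) auto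
    then have "cmod (gauss c (1 / \<zeta>) x) \<le> x powr c * exp (- a * x\<^sup>2)"
      unfolding norm_gauss by (intro mult_left_mono) auto
    then have "(1 + x ^ 4) * cmod (gam c \<zeta> x) \<le> (1 + x ^ 4) * (r powr (- (c + 1/2)) * (x powr c * exp (- a * x\<^sup>2)))"
      using 1 unfolding gam_def norm_mult by (intro mult_left_mono mult_mono) auto
    also have "\<dots> = r powr (- (c + 1/2)) * (x powr c * exp (- a * x\<^sup>2) + x powr (4 + c) * exp (- a * x\<^sup>2))"
      using x powr_realpow[of x 4] by (simp add: powr_add algebra_simps)
    also have "\<dots> \<le> r powr (- (c + 1/2)) * (C0 * exp (- x) + C4 * exp (- x))"
      by (intro mult_left_mono add_mono C0(2) C4(2) x) auto
    finally show "(1 + x ^ 4) * cmod (gam c \<zeta> x) \<le> r powr (- (c + 1/2)) * (C0 + C4) * exp (- x)"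
      by (simp add: algebra_simps)
  qed
qed

lemma gam_has_field_derivative:
  assumes "0 < Re \<zeta>"
  shows "((\<lambda>\<zeta>. gam c \<zeta> x) has_field_derivative dgam c \<zeta> x) (at \<zeta> within S)"
proof -
  define q where "q = complex_of_real (x\<^sup>2)"
  define k where "k = complex_of_real (c + 1/2)"
  have z: "\<zeta> \<notin> \<real>\<^sub>\<le>\<^sub>0" "\<zeta> \<noteq> 0" using assms by (auto simp: complex_nonpos_Reals_iff)
  have 1: "((\<lambda>\<zeta>. \<zeta> powr (- k)) has_field_derivative (- k / \<zeta> * \<zeta> powr (- k))) (at \<zeta> within S)"
    using z by (auto intro!: derivative_eq_intros simp: powr_diff)
  have "((\<lambda>\<zeta>. - (1 / \<zeta>) * q / 2) has_field_derivative (q / (2 * \<zeta>\<^sup>2))) (at \<zeta> within S)"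
    using z by (auto intro!: derivative_eq_intros simp: power2_eq_square)
  then have 2: "((\<lambda>\<zeta>. exp (- (1 / \<zeta>) * q / 2)) has_field_derivative
      (exp (- (1 / \<zeta>) * q / 2) * (q / (2 * \<zeta>\<^sup>2)))) (at \<zeta> within S)"
    by (rule DERIV_chain2[OF DERIV_exp])
  from DERIV_mult[OF 1 DERIV_cmult[OF 2, of "of_real (x powr c)"]]
  show ?thesis
    unfolding gam_def gauss_def dgam_def dgam_factor_def q_def[symmetric] k_def[symmetric]
    by (rule DERIV_cong) (simp add: algebra_simps)
qed

lemma dgam_has_field_derivative:
  assumes "0 < Re \<zeta>"
  shows "((\<lambda>\<zeta>. dgam c \<zeta> x) has_field_derivative ddgam c \<zeta> x) (at \<zeta> within S)"
proof -
  define q where "q = complex_of_real (x\<^sup>2)"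
  define k where "k = complex_of_real (c + 1/2)"
  have z: "\<zeta> \<noteq> 0" using assms by auto
  have "((\<lambda>\<zeta>. (q / 2) * inverse \<zeta> ^ 2 - k * inverse \<zeta>) has_field_derivative
          (q / 2) * (2 * inverse \<zeta> * (- (inverse \<zeta> ^ 2))) - k * (- (inverse \<zeta> ^ 2))) (at \<zeta> within S)"
    using z by (auto intro!: derivative_eq_intros simp: power2_eq_square)
  moreover have "(q / 2) * (2 * inverse \<zeta> * (- (inverse \<zeta> ^ 2))) - k * (- (inverse \<zeta> ^ 2))
      = k * inverse \<zeta> ^ 2 - q * inverse \<zeta> ^ 3"
    by (simp add: power2_eq_square power3_eq_cube)
  moreover have "\<dots> = k / \<zeta>\<^sup>2 - q / \<zeta> ^ 3"
    by (simp only: divide_inverse power_inverse)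
  moreover have "(\<lambda>\<zeta>. (q / 2) * inverse \<zeta> ^ 2 - k * inverse \<zeta>) = (\<lambda>\<zeta>. dgam_factor c \<zeta> x)"
    unfolding dgam_factor_def q_def[symmetric] k_def[symmetric]
    by (simp only: divide_inverse power_inverse inverse_mult_distrib mult.assoc)
  ultimately have "((\<lambda>\<zeta>. dgam_factor c \<zeta> x) has_field_derivative
          (of_real (c + 1/2) / \<zeta>\<^sup>2 - of_real (x\<^sup>2) / \<zeta> ^ 3)) (at \<zeta> within S)"
    by (simp only: q_def k_def)
  from DERIV_mult[OF this gam_has_field_derivative[OF assms]]
  show ?thesis
    unfolding dgam_def[abs_def] ddgam_def by (simp add: dgam_def mult_ac)
qed

lemma halfline_AE_I:
  "(\<And>x. 0 < x \<Longrightarrow> P x) \<Longrightarrow> AE x in halfline. P x"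
  by (rule AE_I2) (simp add: halfline_def)

text \<open>On the ball one has Re \<zeta> \<ge> Re \<zeta>0 / 2 and |\<zeta>| \<le> 2 |\<zeta>0|,
  so that \<open>gam_bound\<close> applies. The common majorant exp (- x) is square-integrable and
  converts pointwise Taylor estimates into estimates in norm.\<close>

lemma gam_bounds:
  assumes "0 < Re \<zeta>0" "0 \<le> c"
  obtains C where "0 < C"
    "\<And>\<zeta> x. \<zeta> \<in> ball \<zeta>0 (Re \<zeta>0 / 2) \<Longrightarrow> 0 < x \<Longrightarrow> cmod (gam c \<zeta> x) \<le> C * exp (- x)"
    "\<And>\<zeta> x. \<zeta> \<in> ball \<zeta>0 (Re \<zeta>0 / 2) \<Longrightarrow> 0 < x \<Longrightarrow> cmod (dgam c \<zeta> x) \<le> C * exp (- x)"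
    "\<And>\<zeta> x. \<zeta> \<in> ball \<zeta>0 (Re \<zeta>0 / 2) \<Longrightarrow> 0 < x \<Longrightarrow> cmod (ddgam c \<zeta> x) \<le> C * exp (- x)"
    "\<And>\<zeta>. \<zeta> \<in> ball \<zeta>0 (Re \<zeta>0 / 2) \<Longrightarrow> 0 < Re \<zeta>"
proof -
  define r where "r = Re \<zeta>0 / 2"
  have r: "0 < r" using assms by (simp add: r_def)
  obtain C where C: "0 < C" "\<And>\<zeta> x. r \<le> Re \<zeta> \<Longrightarrow> cmod \<zeta> \<le> 2 * cmod \<zeta>0 \<Longrightarrow> 0 < x
      \<Longrightarrow> (1 + x ^ 4) * cmod (gam c \<zeta> x) \<le> C * exp (- x)"
    using gam_bound[OF r assms(2)] by blast
  define k where "k = c + 1/2"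
  have k: "0 < k" using assms by (simp add: k_def)
  define D where "D = 1 / (2 * r\<^sup>2) + k / r"
  have D: "0 \<le> D" using r k by (simp add: D_def)
  define E where "E = k / r\<^sup>2 + 1 / r ^ 3 + (2 * (1 / (2 * r\<^sup>2))\<^sup>2 + 2 * (k / r)\<^sup>2)"
  have E: "0 \<le> E" using r k by (simp add: E_def)
  have reg: "r \<le> Re \<zeta>" "cmod \<zeta> \<le> 2 * cmod \<zeta>0" "r \<le> cmod \<zeta>"
    if "\<zeta> \<in> ball \<zeta>0 (Re \<zeta>0 / 2)" for \<zeta>
  proof -
    have n: "cmod (\<zeta>0 - \<zeta>) < Re \<zeta>0 / 2" using that by (simp add: dist_norm)
    show "r \<le> Re \<zeta>" using n abs_Re_le_cmod[of "\<zeta>0 - \<zeta>"] by (simp add: r_def)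
    then show "r \<le> cmod \<zeta>" using complex_Re_le_cmod[of \<zeta>] by linarith
    have "cmod \<zeta> \<le> cmod (\<zeta>0 - \<zeta>) + cmod \<zeta>0" by (metis norm_minus_commute norm_triangle_sub add.commute)
    then show "cmod \<zeta> \<le> 2 * cmod \<zeta>0" using n complex_Re_le_cmod[of \<zeta>0] norm_ge_zero[of \<zeta>0] by linarith
  qed
  have fac: "cmod (dgam_factor c \<zeta> x) \<le> x\<^sup>2 * (1 / (2 * r\<^sup>2)) + k / r" if \<zeta>: "r \<le> cmod \<zeta>" for \<zeta> x
  proof -
    have p: "0 < cmod \<zeta>" using r \<zeta> by linarith
    have "cmod (dgam_factor c \<zeta> x) \<le> cmod (of_real (x\<^sup>2) / (2 * \<zeta>\<^sup>2)) + cmod (of_real k / \<zeta>)"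
      unfolding dgam_factor_def k_def by (rule norm_triangle_ineq4)
    also have "cmod (of_real (x\<^sup>2) / (2 * \<zeta>\<^sup>2)) = x\<^sup>2 * (1 / (2 * (cmod \<zeta>)\<^sup>2))"
      by (simp add: norm_divide norm_mult norm_power)
    also have "\<dots> \<le> x\<^sup>2 * (1 / (2 * r\<^sup>2))"
      using p r \<zeta> by (intro mult_left_mono divide_left_mono power_mono) auto
    also have "cmod (of_real k / \<zeta>) = k / cmod \<zeta>" using k by (simp add: norm_divide)
    also have "\<dots> \<le> k / r" using p r k \<zeta> by (intro divide_left_mono) auto
    finally show ?thesis by simp
  qed
  have x2: "x\<^sup>2 \<le> 1 + x ^ 4" for x :: real
  proof -
    have "0 \<le> (x\<^sup>2 - 1)\<^sup>2 + x\<^sup>2" by simp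
    then show ?thesis by (simp add: power2_eq_square power4_eq_xxxx algebra_simps)
  qed
  have x1: "1 \<le> 1 + x ^ 4" for x :: real by simp
  show ?thesis
  proof
    show "0 < C + D * C + E * C" using C(1) D E by (simp add: add_pos_nonneg)
    fix \<zeta> and x :: real
    assume "\<zeta> \<in> ball \<zeta>0 (Re \<zeta>0 / 2)"
    note rg = reg[OF this]
    show "0 < Re \<zeta>" using rg r by linarith
    assume x: "0 < x"
    let ?g = "(1 + x ^ 4) * cmod (gam c \<zeta> x)"
    have g: "?g \<le> C * exp (- x)" by (rule C(2)[OF rg(1,2) x])
    have nn: "0 \<le> ?g" by simp
    have le: "A * cmod (gam c \<zeta> x) \<le> (C + D * C + E * C) * exp (- x)"
      if "A \<le> F * (1 + x ^ 4)" "0 \<le> F" "F \<le> 1 + D + E" for A F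
    proof -
      have "A * cmod (gam c \<zeta> x) \<le> F * ?g"
        using mult_right_mono[OF that(1), of "cmod (gam c \<zeta> x)"] by (simp add: mult.assoc)
      also have "\<dots> \<le> (1 + D + E) * (C * exp (- x))"
        by (rule mult_mono[OF that(3) g _ nn]) (use D E in auto)
      finally show ?thesis by (simp add: algebra_simps)
    qed
    show "cmod (gam c \<zeta> x) \<le> (C + D * C + E * C) * exp (- x)"
      using le[of 1 1] D E by simp
    have "x\<^sup>2 * (1 / (2 * r\<^sup>2)) + k / r \<le> (1 + x ^ 4) * (1 / (2 * r\<^sup>2)) + (1 + x ^ 4) * (k / r)"
      using r k x2[of x] mult_right_mono[OF x1, of "k / r" x] by (intro add_mono mult_right_mono) auto
    then have fD: "x\<^sup>2 * (1 / (2 * r\<^sup>2)) + k / r \<le> D * (1 + x ^ 4)"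
      by (simp add: D_def algebra_simps)
    have "cmod (dgam_factor c \<zeta> x) \<le> D * (1 + x ^ 4)" using fac[OF rg(3), of x] fD by linarith
    from le[OF this] show "cmod (dgam c \<zeta> x) \<le> (C + D * C + E * C) * exp (- x)"
      using D E by (simp add: dgam_def norm_mult)
    have "cmod (of_real k / \<zeta>\<^sup>2 - of_real (x\<^sup>2) / \<zeta> ^ 3) \<le> cmod (of_real k / \<zeta>\<^sup>2) + cmod (of_real (x\<^sup>2) / \<zeta> ^ 3)"
      by (rule norm_triangle_ineq4)
    also have "\<dots> = k / (cmod \<zeta>)\<^sup>2 + x\<^sup>2 / (cmod \<zeta>) ^ 3"
      using k by (simp add: norm_divide norm_power)
    also have "\<dots> \<le> k / r\<^sup>2 + x\<^sup>2 / r ^ 3"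
      using k r rg(3) less_le_trans[OF r rg(3)]
      by (intro add_mono divide_left_mono power_mono mult_pos_pos zero_less_power) auto
    also have "\<dots> \<le> (1 + x ^ 4) * (k / r\<^sup>2) + (1 + x ^ 4) * (1 / r ^ 3)"
      using r k x2[of x] mult_right_mono[OF x1, of "k / r\<^sup>2" x] mult_right_mono[OF x2, of "1 / r ^ 3" x]
      by (intro add_mono) auto
    finally have A1: "cmod (of_real k / \<zeta>\<^sup>2 - of_real (x\<^sup>2) / \<zeta> ^ 3) \<le> (k / r\<^sup>2 + 1 / r ^ 3) * (1 + x ^ 4)"
      by (simp add: algebra_simps)
    have "(cmod (dgam_factor c \<zeta> x))\<^sup>2 \<le> (x\<^sup>2 * (1 / (2 * r\<^sup>2)) + k / r)\<^sup>2"
      using fac[OF rg(3)] by (intro power_mono) auto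
    also have "\<dots> \<le> 2 * (x\<^sup>2 * (1 / (2 * r\<^sup>2)))\<^sup>2 + 2 * (k / r)\<^sup>2"
      using zero_le_power2[of "x\<^sup>2 * (1 / (2 * r\<^sup>2)) - k / r"] by (simp add: power2_sum power2_diff)
    also have "\<dots> = x ^ 4 * (2 * (1 / (2 * r\<^sup>2))\<^sup>2) + 1 * (2 * (k / r)\<^sup>2)"
      unfolding power_mult_distrib power_mult[symmetric] by simp
    also have "\<dots> \<le> (1 + x ^ 4) * (2 * (1 / (2 * r\<^sup>2))\<^sup>2) + (1 + x ^ 4) * (2 * (k / r)\<^sup>2)"
      using x1 by (intro add_mono mult_right_mono) auto
    finally have A2: "(cmod (dgam_factor c \<zeta> x))\<^sup>2 \<le> (2 * (1 / (2 * r\<^sup>2))\<^sup>2 + 2 * (k / r)\<^sup>2) * (1 + x ^ 4)"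
      by (simp only: distrib_left mult.commute)
    have "ddgam c \<zeta> x = (of_real k / \<zeta>\<^sup>2 - of_real (x\<^sup>2) / \<zeta> ^ 3 + (dgam_factor c \<zeta> x)\<^sup>2) * gam c \<zeta> x"
      unfolding ddgam_def dgam_def k_def by (simp add: power2_eq_square distrib_right mult.assoc)
    then have "cmod (ddgam c \<zeta> x) \<le> (cmod (of_real k / \<zeta>\<^sup>2 - of_real (x\<^sup>2) / \<zeta> ^ 3) + (cmod (dgam_factor c \<zeta> x))\<^sup>2) * cmod (gam c \<zeta> x)"
      using norm_triangle_ineq[of "of_real k / \<zeta>\<^sup>2 - of_real (x\<^sup>2) / \<zeta> ^ 3" "(dgam_factor c \<zeta> x)\<^sup>2"]
      unfolding norm_power[symmetric] by (simp only: norm_mult mult_right_mono norm_ge_zero)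
    also have "\<dots> \<le> (C + D * C + E * C) * exp (- x)"
    proof (rule le[of _ E])
      show "cmod (of_real k / \<zeta>\<^sup>2 - of_real (x\<^sup>2) / \<zeta> ^ 3) + (cmod (dgam_factor c \<zeta> x))\<^sup>2 \<le> E * (1 + x ^ 4)"
        using add_mono[OF A1 A2] unfolding E_def distrib_right by linarith
    qed (use D E in auto)
    finally show "cmod (ddgam c \<zeta> x) \<le> (C + D * C + E * C) * exp (- x)" .
  qed
qed

lemma L2_of_exp_bound:
  assumes "f \<in> borel_measurable halfline" "\<And>x. 0 < x \<Longrightarrow> cmod (f x) \<le> C * exp (- x)"
  shows "f \<in> L2 halfline"
  by (rule L2_bound[OF exp_minus_L2 assms(1)]) (use assms(2) in \<open>auto intro!: halfline_AE_I\<close>)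

lemma gam_L2:
  assumes "0 < Re \<zeta>" "0 \<le> c"
  shows "gam c \<zeta> \<in> L2 halfline" "dgam c \<zeta> \<in> L2 halfline"
proof -
  obtain C where C: "\<And>x. 0 < x \<Longrightarrow> cmod (gam c \<zeta> x) \<le> C * exp (- x)"
    "\<And>x. 0 < x \<Longrightarrow> cmod (dgam c \<zeta> x) \<le> C * exp (- x)"
    using gam_bounds[OF assms] assms by (metis centre_in_ball half_gt_zero)
  show "gam c \<zeta> \<in> L2 halfline" "dgam c \<zeta> \<in> L2 halfline"
    by (auto intro!: L2_of_exp_bound C)
qed

section \<open>The Gaussians as a differentiable family of vectors\<close>

definition Gam :: "real \<Rightarrow> complex \<Rightarrow> hl2" where "Gam c \<zeta> = cls (gam c \<zeta>)"
definition dGam :: "real \<Rightarrow> complex \<Rightarrow> hl2" where "dGam c \<zeta> = cls (dgam c \<zeta>)"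

lemma gam_Taylor:
  assumes "convex S" "\<And>\<zeta>. \<zeta> \<in> S \<Longrightarrow> 0 < Re \<zeta>" "\<And>\<zeta>. \<zeta> \<in> S \<Longrightarrow> cmod (ddgam c \<zeta> x) \<le> B"
    and "w \<in> S" "z \<in> S"
  shows "cmod (gam c z x - gam c w x - (z - w) * dgam c w x) \<le> B * (cmod (z - w))\<^sup>2"
proof -
  define f where "f i \<zeta> = (if i = 0 then gam c \<zeta> x else if i = 1 then dgam c \<zeta> x else ddgam c \<zeta> x)"
    for i :: nat and \<zeta>
  have f012: "f 0 = (\<lambda>\<zeta>. gam c \<zeta> x)" "f 1 = (\<lambda>\<zeta>. dgam c \<zeta> x)" "f (Suc 1) = (\<lambda>\<zeta>. ddgam c \<zeta> x)"
    by (auto simp: f_def)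
  have "cmod (f 0 z - (\<Sum>i\<le>1. f i w * (z - w) ^ i / fact i)) \<le> B * cmod (z - w) ^ Suc 1 / fact 1"
  proof (rule complex_Taylor[OF assms(1)])
    fix i \<zeta> assume "\<zeta> \<in> S" "i \<le> (1::nat)"
    then consider "i = 0" | "i = 1" by linarith
    then show "(f i has_field_derivative f (Suc i) \<zeta>) (at \<zeta> within S)"
      using gam_has_field_derivative[OF assms(2)[OF \<open>\<zeta> \<in> S\<close>], of c x]
        dgam_has_field_derivative[OF assms(2)[OF \<open>\<zeta> \<in> S\<close>], of c x] f012
      by cases simp_all
  qed (use assms in \<open>simp_all add: f_def\<close>)
  then show ?thesis by (simp add: f_def algebra_simps power2_eq_square)
qed

text \<open>The pointwise remainder is at most C exp (- x) |h|^2 by the bound on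
  \<open>ddgam\<close>, and exp (- x) has finite norm.\<close>

lemma Gam_Taylor:
  assumes "0 < Re \<zeta>" "0 \<le> c"
  obtains C where "\<And>h. cmod h < Re \<zeta> / 2 \<Longrightarrow>
    norm (Gam c (\<zeta> + h) - Gam c \<zeta> - cmul h (dGam c \<zeta>)) \<le> C * (cmod h)\<^sup>2"
proof -
  obtain C where C: "0 < C"
    "\<And>z x. z \<in> ball \<zeta> (Re \<zeta> / 2) \<Longrightarrow> 0 < x \<Longrightarrow> cmod (ddgam c z x) \<le> C * exp (- x)"
    "\<And>z. z \<in> ball \<zeta> (Re \<zeta> / 2) \<Longrightarrow> 0 < Re z"
    using gam_bounds[OF assms] by metis
  define e where "e x = complex_of_real (exp (- x))" for x :: real
  have e: "e \<in> L2 halfline" unfolding e_def by (rule exp_minus_L2)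
  have "norm (Gam c (\<zeta> + h) - Gam c \<zeta> - cmul h (dGam c \<zeta>)) \<le> (C * norm (cls e)) * (cmod h)\<^sup>2"
    if h: "cmod h < Re \<zeta> / 2" for h
  proof -
    have in_ball: "\<zeta> \<in> ball \<zeta> (Re \<zeta> / 2)" "\<zeta> + h \<in> ball \<zeta> (Re \<zeta> / 2)"
      using assms h by (auto simp: dist_norm)
    note L = gam_L2[OF assms] gam_L2(1)[OF C(3)[OF in_ball(2)] assms(2)]
    have L2: "(\<lambda>x. gam c (\<zeta> + h) x - gam c \<zeta> x - h * dgam c \<zeta> x) \<in> L2 halfline"
      by (intro L2_diff L2_scale L)
    have "Gam c (\<zeta> + h) - Gam c \<zeta> - cmul h (dGam c \<zeta>)
        = cls (\<lambda>x. gam c (\<zeta> + h) x - gam c \<zeta> x - h * dgam c \<zeta> x)"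
      unfolding Gam_def dGam_def using L by (simp add: cls_diff cls_cmul L2_diff L2_scale)
    also have "norm \<dots> \<le> norm (cls (\<lambda>x. of_real (C * (cmod h)\<^sup>2) * e x))"
    proof (rule norm_cls_mono[OF L2 L2_scale[OF e] halfline_AE_I])
      fix x :: real assume x: "0 < x"
      have "cmod (gam c (\<zeta> + h) x - gam c \<zeta> x - (\<zeta> + h - \<zeta>) * dgam c \<zeta> x)
          \<le> (C * exp (- x)) * (cmod (\<zeta> + h - \<zeta>))\<^sup>2"
        by (rule gam_Taylor[of "ball \<zeta> (Re \<zeta> / 2)"]) (use C x in_ball in auto)
      then show "cmod (gam c (\<zeta> + h) x - gam c \<zeta> x - h * dgam c \<zeta> x)
          \<le> cmod (of_real (C * (cmod h)\<^sup>2) * e x)"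
        using C(1) unfolding e_def norm_mult norm_of_real by (simp add: mult_ac)
    qed
    also have "\<dots> = (C * norm (cls e)) * (cmod h)\<^sup>2"
      unfolding cls_cmul[OF e] norm_cmul norm_of_real using C(1) by simp
    finally show ?thesis .
  qed
  then show ?thesis using that by blast
qed

text \<open>The complex direction d is left free: real d gives the heat flow, d = 2 \<i> the
  Schroedinger flow.\<close>

lemma Gam_has_vector_derivative:
  assumes "0 < Re (\<zeta> + of_real s * d)" "0 \<le> c"
  shows "((\<lambda>s. Gam c (\<zeta> + of_real s * d)) has_vector_derivative
      cmul d (dGam c (\<zeta> + of_real s * d))) (at s)"
proof -
  define \<omega> where "\<omega> = \<zeta> + of_real s * d"
  obtain C where C: "\<And>h. cmod h < Re \<omega> / 2 \<Longrightarrow>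
    norm (Gam c (\<omega> + h) - Gam c \<omega> - cmul h (dGam c \<omega>)) \<le> C * (cmod h)\<^sup>2"
    using Gam_Taylor[of \<omega> c] assms by (auto simp: \<omega>_def)
  show ?thesis
  proof (rule has_vector_derivativeI_quadratic[where \<delta> = "Re \<omega> / 2 / (cmod d + 1)" and C = "C * (cmod d)\<^sup>2"])
    show "0 < Re \<omega> / 2 / (cmod d + 1)"
      using assms by (simp add: \<omega>_def add_nonneg_pos)
    fix h :: real assume "\<bar>h\<bar> < Re \<omega> / 2 / (cmod d + 1)"
    then have "\<bar>h\<bar> * (cmod d + 1) < Re \<omega> / 2"
      by (subst (asm) less_divide_eq) (auto simp: add_nonneg_pos split: if_splits)
    then have "cmod (of_real h * d) < Re \<omega> / 2"
      by (simp add: norm_mult algebra_simps)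
    have "cmul (of_real h * d) v = h *\<^sub>R cmul d v" for v
      by (simp flip: cmul_cmul)
    with C[OF \<open>cmod (of_real h * d) < Re \<omega> / 2\<close>] show "norm (Gam c (\<zeta> + of_real (s + h) * d) - Gam c (\<zeta> + of_real s * d)
        - h *\<^sub>R cmul d (dGam c (\<zeta> + of_real s * d))) \<le> C * (cmod d)\<^sup>2 * h\<^sup>2"
      by (simp add: \<omega>_def algebra_simps norm_mult power_mult_distrib)
  qed
qed

lemma gauss_orthogonal_AE_zero:
  fixes Z :: "real \<Rightarrow> complex"
  assumes "\<And>n. integrable halfline (\<lambda>x. Z x * gauss c (of_nat (Suc n)) x)"
    and "\<And>n. (LINT x|halfline. Z x * gauss c (of_nat (Suc n)) x) = 0"
  shows "AE x in halfline. Z x = 0"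
proof -
  have gr: "gauss c (of_nat (Suc n)) x = of_real (x powr c) * of_real (exp (- (real (Suc n) * x\<^sup>2 / 2)))" for x n
  proof -
    have "- of_nat (Suc n) * complex_of_real (x\<^sup>2) / 2 = of_real (- (real (Suc n) * x\<^sup>2 / 2))"
      by (simp add: algebra_simps)
    then show ?thesis unfolding gauss_def exp_of_real[symmetric] by (simp only:)
  qed
  have g: "Z x * gauss c (of_nat (Suc n)) x
      = (Z x * of_real (x powr c)) * of_real (exp (- (real (Suc n) * x\<^sup>2 / 2)))" for x n
    unfolding gr by (simp only: mult.assoc)
  have "AE x in halfline. Z x * of_real (x powr c) = 0"
    by (rule AE_zero_of_gaussian_moments) (use assms in \<open>simp_all only: g\<close>)
  moreover have "AE x in halfline. x powr c \<noteq> 0" by (rule halfline_AE_I) simp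
  ultimately show ?thesis by eventually_elim simp
qed

lemma gam_real_eq: "gam c (1 / of_nat (Suc n)) x = (1 / of_nat (Suc n)) powr (- of_real (c + 1/2)) * gauss c (of_nat (Suc n)) x"
  unfolding gam_def by simp

text \<open>At \<zeta> = 1/(n+1) the function is a multiple of the real Gaussian with z = n + 1, and
  these moments determine a function. The scalar \<open>a\<close> upgrades orthogonality for the
  real inner product to complex orthogonality.\<close>

lemma Gam_orthogonal_zero:
  assumes c: "0 \<le> c" and "\<And>\<zeta> a. 0 < Re \<zeta> \<Longrightarrow> inner (cmul a (Gam c \<zeta>)) y = 0"
  shows "y = 0"
proof -
  define f where "f = rep_hl2 y"
  have f: "f \<in> L2 halfline" "cls f = y" by (simp_all add: f_def)
  have g: "gauss c (of_nat (Suc n)) \<in> L2 halfline" for n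
    using gauss_L2[of "of_nat (Suc n)" c 0] c by simp
  have cnjg: "cnj (gauss c (of_nat (Suc n)) x) = gauss c (of_nat (Suc n)) x" for n x
    unfolding gauss_def by (simp add: exp_cnj)
  have "AE x in halfline. f x = 0"
  proof (rule gauss_orthogonal_AE_zero)
    fix n
    let ?p = "(1 / of_nat (Suc n)) powr (- of_real (c + 1/2)) :: complex"
    have p: "?p \<noteq> 0" by (simp del: of_nat_Suc)
    have Re: "0 < Re (1 / of_nat (Suc n))" by (simp add: Re_divide_of_nat del: of_nat_Suc)
    have gg: "cls (gauss c (of_nat (Suc n))) = cmul (1 / ?p) (Gam c (1 / of_nat (Suc n)))"
      unfolding Gam_def using gam_L2(1)[OF Re c] p
      by (simp add: gam_real_eq[abs_def] cls_cmul[symmetric] del: of_nat_Suc)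
    have "L2_inner halfline f (gauss c (of_nat (Suc n))) = 0"
      unfolding L2_inner_eq_inner[OF f(1) g] f(2) gg
      using assms(2)[OF Re] by (simp add: inner_commute[of y] complex_eq_iff)
    then show "(LINT x|halfline. f x * gauss c (of_nat (Suc n)) x) = 0"
      unfolding L2_inner_def cnjg .
    show "integrable halfline (\<lambda>x. f x * gauss c (of_nat (Suc n)) x)"
      using L2_inner_integrable[OF f(1) g] unfolding cnjg .
  qed
  then show ?thesis
    using cls_eq_iff[OF f(1) L2_zero] f(2) by (simp add: cls_abs L2_zero zero_hl2_def)
qed

section \<open>Green's formula\<close>

lemma halfline_integral_derivative_zero:
  fixes F F' :: "real \<Rightarrow> complex"
  assumes "0 < a" "a \<le> b"
    and F: "\<And>x. 0 < x \<Longrightarrow> (F has_vector_derivative F' x) (at x)"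
    and supp: "\<And>x. 0 < x \<Longrightarrow> x \<notin> {a..b} \<Longrightarrow> F x = 0"
    and cont: "continuous_on {0<..} F'"
  shows "(LINT x|halfline. F' x) = 0"
proof -
  \<comment> \<open>\<open>supp\<close> gives F = 0 outside {a..b}, so the interval is enlarged a
    little to have F vanish at both of its ends.\<close>
  define a' b' where "a' = a / 2" and "b' = b + 1"
  have ab: "0 < a'" "a' < a" "b < b'" "a' \<le> b'" using assms(1,2) by (auto simp: a'_def b'_def)
  have F'0: "F' x = 0" if "0 < x" "x \<notin> {a'..b'}" for x
  proof -
    have "((\<lambda>_. 0) has_vector_derivative F' x) (at x)"
    proof (rule has_vector_derivative_transform_within_open[OF F])
      show "open ({0<..<a} \<union> {b<..})" by auto
      show "x \<in> {0<..<a} \<union> {b<..}" using that ab by auto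
      show "F y = 0" if "y \<in> {0<..<a} \<union> {b<..}" for y
        using that assms(1,2) by (intro supp) auto
    qed (use that in simp)
    then show ?thesis using vector_derivative_unique_at[OF _ has_vector_derivative_const] by blast
  qed
  have c: "continuous_on {a'..b'} F'" by (rule continuous_on_subset[OF cont]) (use ab in auto)
  have hi: "(F' has_integral (F b' - F a')) {a'..b'}"
    by (rule fundamental_theorem_of_calculus)
       (use ab in \<open>auto intro!: has_vector_derivative_at_within[OF F]\<close>)
  have "F b' = 0" "F a' = 0" using ab by (auto intro!: supp)
  with hi have hi0: "(F' has_integral 0) {a'..b'}" by simp
  have ai: "F' absolutely_integrable_on {a'..b'}"
    using absolutely_integrable_continuous[of a' b' F'] c by simp
  have ind: "indicator {0<..} x *\<^sub>R F' x = indicator {a'..b'} x *\<^sub>R F' x" for x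
    using F'0[of x] ab by (auto simp: indicator_def)
  have "(LINT x|halfline. F' x) = (LINT x:{a'..b'}|lebesgue. F' x)"
    unfolding halfline_integral ind set_lebesgue_integral_def ..
  also have "\<dots> = integral {a'..b'} F'" by (rule set_lebesgue_integral_eq_integral(2)[OF ai])
  also have "\<dots> = 0" using hi0 by (rule integral_unique)
  finally show "(LINT x|halfline. F' x) = 0" .
qed

lemma halfline_integrable_continuous_compact_support:
  fixes f :: "real \<Rightarrow> complex"
  assumes "0 < a" and f: "continuous_on {0<..} f" "\<And>x. 0 < x \<Longrightarrow> x \<notin> {a..b} \<Longrightarrow> f x = 0"
  shows "integrable halfline f"
proof -
  have ai: "f absolutely_integrable_on {a..b}"
    using absolutely_integrable_continuous[of a b f] continuous_on_subset[OF f(1), of "{a..b}"] assms(1)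
    by (simp add: subset_eq)
  have "indicator {0<..} x *\<^sub>R f x = indicator {a..b} x *\<^sub>R f x" for x
    using f(2)[of x] assms(1) by (auto simp: indicator_def)
  then have "(\<lambda>x. indicator {0<..} x *\<^sub>R f x) = (\<lambda>x. indicator {a..b} x *\<^sub>R f x)" ..
  then show ?thesis using ai unfolding halfline_integrable set_integrable_def by (simp only:)
qed

lemma L2_continuous_compact_support:
  fixes f :: "real \<Rightarrow> complex"
  assumes "0 < a" and f: "continuous_on {0<..} f" "\<And>x. 0 < x \<Longrightarrow> x \<notin> {a..b} \<Longrightarrow> f x = 0"
  shows "f \<in> L2 halfline"
proof -
  have "integrable halfline (\<lambda>x. complex_of_real ((cmod (f x))\<^sup>2))"
    by (rule halfline_integrable_continuous_compact_support[OF assms(1)])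
       (use f in \<open>auto intro!: continuous_intros\<close>)
  then have "integrable halfline (\<lambda>x. (cmod (f x))\<^sup>2)"
    unfolding complex_of_real_integrable_eq .
  then show ?thesis
    using continuous_on_halfline_measurable[OF f(1)] by (simp add: L2_def)
qed

text \<open>The derivatives \<open>u'\<close>, \<open>u''\<close> are passed as separate arguments. For \<open>c = \<nu> + 1/2\<close> the potential
  \<open>(\<nu>\<^sup>2 - 1/4) / x\<^sup>2\<close> is \<open>(c\<^sup>2 - c) / x\<^sup>2\<close>, and \<open>S = L\<^sup>* L\<close>.\<close>

definition L_op :: "real \<Rightarrow> (real \<Rightarrow> complex) \<Rightarrow> (real \<Rightarrow> complex) \<Rightarrow> real \<Rightarrow> complex" where
  "L_op c u u' x = u' x - of_real (c / x) * u x"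

definition S_op :: "real \<Rightarrow> (real \<Rightarrow> complex) \<Rightarrow> (real \<Rightarrow> complex) \<Rightarrow> real \<Rightarrow> complex" where
  "S_op c u u'' x = - u'' x + of_real ((c\<^sup>2 - c) * (1 / x\<^sup>2)) * u x"

definition C2_on_halfline :: "(real \<Rightarrow> complex) \<Rightarrow> (real \<Rightarrow> complex) \<Rightarrow> (real \<Rightarrow> complex) \<Rightarrow> bool" where
  "C2_on_halfline u u' u'' \<longleftrightarrow>
     (\<forall>x>0. (u has_vector_derivative u' x) (at x)) \<and>
     (\<forall>x>0. (u' has_vector_derivative u'' x) (at x)) \<and> continuous_on {0<..} u''"

lemma C2_continuous:
  assumes "C2_on_halfline u u' u''"
  shows "continuous_on {0<..} u" "continuous_on {0<..} u'" "continuous_on {0<..} u''"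
  using assms unfolding C2_on_halfline_def
  by (auto intro!: continuous_at_imp_continuous_on has_vector_derivative_continuous)

lemma C2_support:
  assumes u: "C2_on_halfline u u' u''" and supp: "\<And>x. 0 < x \<Longrightarrow> x \<notin> {a..b} \<Longrightarrow> u x = 0"
    and x: "0 < x" "x \<notin> {a..b}"
  shows "u' x = 0" "u'' x = 0"
proof -
  have U: "open ({0<..} - {a..b})" by (auto intro: open_Diff)
  have z: "v' y = 0" if "\<And>y. 0 < y \<Longrightarrow> (v has_vector_derivative v' y) (at y)"
    and "\<And>y. 0 < y \<Longrightarrow> y \<notin> {a..b} \<Longrightarrow> v y = 0" and "0 < y" "y \<notin> {a..b}"
    for v v' :: "real \<Rightarrow> complex" and y
  proof -
    have "((\<lambda>_. 0) has_vector_derivative v' y) (at y)"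
      by (rule has_vector_derivative_transform_within_open[OF that(1) U]) (use that in auto)
    then show ?thesis using vector_derivative_unique_at[OF _ has_vector_derivative_const] by blast
  qed
  have u'0: "u' y = 0" if "0 < y" "y \<notin> {a..b}" for y
    by (rule z[of u u']) (use u supp that in \<open>auto simp: C2_on_halfline_def\<close>)
  show "u' x = 0" using u'0 x by blast
  show "u'' x = 0"
    by (rule z[of u' u'']) (use u u'0 x in \<open>auto simp: C2_on_halfline_def\<close>)
qed

lemma L_op_continuous: "C2_on_halfline u u' u'' \<Longrightarrow> continuous_on {0<..} (L_op c u u')"
  unfolding L_op_def[abs_def] by (intro continuous_intros C2_continuous) auto

lemma S_op_continuous: "C2_on_halfline u u' u'' \<Longrightarrow> continuous_on {0<..} (S_op c u u'')"
  unfolding S_op_def[abs_def] by (intro continuous_intros C2_continuous) auto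

text \<open>The integrand L u cnj (L v) - S u cnj v is the derivative of L u cnj v, because (c/x)^2
  - c/x^2 = (c^2 - c)/x^2. The support condition is a disjunction so that one of the two functions
  may be a Gaussian.\<close>

lemma green:
  assumes u: "C2_on_halfline u u' u''" and v: "C2_on_halfline v v' v''" and "0 < a" "a \<le> b"
    and supp: "(\<forall>x>0. x \<notin> {a..b} \<longrightarrow> u x = 0) \<or> (\<forall>x>0. x \<notin> {a..b} \<longrightarrow> v x = 0)"
  shows "L2_inner halfline (L_op c u u') (L_op c v v') = L2_inner halfline (S_op c u u'') v"
proof -
  define F where "F x = L_op c u u' x * cnj (v x)" for x
  define F' where "F' x = (u'' x - of_real (c / x) * u' x + of_real (c / x\<^sup>2) * u x) * cnj (v x)
      + L_op c u u' x * cnj (v' x)" for x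
  have supp': "u x = 0 \<and> u' x = 0 \<and> u'' x = 0 \<or> v x = 0 \<and> v' x = 0"
    if "0 < x" "x \<notin> {a..b}" for x
    using supp C2_support[OF u] C2_support[OF v] that by metis
  have *: "(LINT x|halfline. F' x) = 0"
  proof (rule halfline_integral_derivative_zero[OF assms(3,4), of F F'])
    fix x :: real assume x: "0 < x"
    have du: "(u has_vector_derivative u' x) (at x)" "(u' has_vector_derivative u'' x) (at x)"
      and dv: "(v has_vector_derivative v' x) (at x)"
      using u v x by (auto simp: C2_on_halfline_def)
    have dc: "((\<lambda>x. complex_of_real (c / x)) has_vector_derivative of_real (- c / x\<^sup>2)) (at x)"
      by (rule has_vector_derivative_of_real)
         (use x in \<open>auto intro!: derivative_eq_intros simp: power2_eq_square\<close>)
    have dL: "((\<lambda>x. L_op c u u' x) has_vector_derivative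
        (u'' x - (of_real (c / x) * u' x + of_real (- c / x\<^sup>2) * u x))) (at x)"
      unfolding L_op_def
      by (intro has_vector_derivative_diff du has_vector_derivative_mult dc)
    have dcv: "((\<lambda>x. cnj (v x)) has_vector_derivative cnj (v' x)) (at x)"
      using dv by (rule has_vector_derivative_cnj)
    show "(F has_vector_derivative F' x) (at x)"
      unfolding F_def[abs_def] F'_def
      using has_vector_derivative_mult[OF dL dcv] by (simp add: algebra_simps)
  next
    fix x assume "0 < x" "x \<notin> {a..b}"
    then show "F x = 0" using supp'[of x] by (auto simp: F_def L_op_def)
  next
    show "continuous_on {0<..} F'"
      unfolding F'_def[abs_def]
      by (intro continuous_intros C2_continuous[OF u] C2_continuous[OF v] L_op_continuous[OF u]) auto
  qed
  have i1: "integrable halfline (\<lambda>x. L_op c u u' x * cnj (L_op c v v' x))"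
  proof (rule halfline_integrable_continuous_compact_support[OF assms(3)])
    show "continuous_on {0<..} (\<lambda>x. L_op c u u' x * cnj (L_op c v v' x))"
      by (intro continuous_intros L_op_continuous[OF u] L_op_continuous[OF v])
    fix x assume "0 < x" "x \<notin> {a..b}"
    then show "L_op c u u' x * cnj (L_op c v v' x) = 0" using supp'[of x] by (auto simp: L_op_def)
  qed
  have i2: "integrable halfline (\<lambda>x. S_op c u u'' x * cnj (v x))"
  proof (rule halfline_integrable_continuous_compact_support[OF assms(3)])
    show "continuous_on {0<..} (\<lambda>x. S_op c u u'' x * cnj (v x))"
      by (intro continuous_intros S_op_continuous[OF u] C2_continuous[OF v])
    fix x assume "0 < x" "x \<notin> {a..b}"
    then show "S_op c u u'' x * cnj (v x) = 0" using supp'[of x] by (auto simp: S_op_def)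
  qed
  have "L2_inner halfline (L_op c u u') (L_op c v v') - L2_inner halfline (S_op c u u'') v
      = (LINT x|halfline. L_op c u u' x * cnj (L_op c v v' x) - S_op c u u'' x * cnj (v x))"
    unfolding L2_inner_def using i1 i2 by simp
  also have "\<dots> = (LINT x|halfline. F' x)"
  proof (rule Bochner_Integration.integral_cong[OF refl])
    fix x assume "x \<in> space halfline"
    then have x: "x \<noteq> 0" by (simp add: halfline_def)
    define k where "k = complex_of_real (c / x)"
    define l where "l = complex_of_real (c / x\<^sup>2)"
    have kl: "complex_of_real ((c\<^sup>2 - c) * (1 / x\<^sup>2)) = k * k - l"
      using x by (simp add: k_def l_def field_simps power2_eq_square)
    have k: "cnj k = k" by (simp add: k_def)
    show "L_op c u u' x * cnj (L_op c v v' x) - S_op c u u'' x * cnj (v x) = F' x"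
      unfolding L_op_def S_op_def F'_def kl k_def[symmetric] l_def[symmetric]
      by (simp add: k algebra_simps)
  qed
  also have "\<dots> = 0" by (rule *)
  finally show ?thesis by simp
qed

lemma L2_inner_commute: "L2_inner M g f = cnj (L2_inner M f g)"
  unfolding L2_inner_def
  using Bochner_Integration.integral_cnj[of M "\<lambda>x. f x * cnj (g x)"] by (simp add: mult.commute)

lemma green_symmetric:
  assumes u: "C2_on_halfline u u' u''" and v: "C2_on_halfline v v' v''" and "0 < a" "a \<le> b"
    and supp: "(\<forall>x>0. x \<notin> {a..b} \<longrightarrow> u x = 0) \<or> (\<forall>x>0. x \<notin> {a..b} \<longrightarrow> v x = 0)"
  shows "L2_inner halfline (S_op c u u'') v = L2_inner halfline u (S_op c v v'')"
  using green[OF assms, of c] green[OF v u assms(3,4), of c] supp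
  by (metis L2_inner_commute complex_cnj_cnj)

section \<open>Smooth cut-off functions\<close>

text \<open>The class of the functions \<open>r exp (phase)\<close> with \<open>r\<close> in the following algebra is closed under
  differentiation, and the phase makes them vanish to all orders at \<open>a\<close> and \<open>b\<close>.\<close>

inductive_set ratfun :: "real \<Rightarrow> real \<Rightarrow> (real \<Rightarrow> complex) set" for a b :: real where
  const: "(\<lambda>x. k) \<in> ratfun a b"
| ident: "(\<lambda>x. of_real x) \<in> ratfun a b"
| inv_ident: "(\<lambda>x. of_real (1 / x)) \<in> ratfun a b"
| inv_left: "(\<lambda>x. of_real (1 / (x - a))) \<in> ratfun a b"
| inv_right: "(\<lambda>x. of_real (1 / (b - x))) \<in> ratfun a b"
| add: "r \<in> ratfun a b \<Longrightarrow> s \<in> ratfun a b \<Longrightarrow> (\<lambda>x. r x + s x) \<in> ratfun a b"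
| mult: "r \<in> ratfun a b \<Longrightarrow> s \<in> ratfun a b \<Longrightarrow> (\<lambda>x. r x * s x) \<in> ratfun a b"

lemma ratfun_derivative:
  assumes "0 < a" "r \<in> ratfun a b"
  obtains r' where "r' \<in> ratfun a b"
    "\<And>x. x \<in> {a<..<b} \<Longrightarrow> (r has_vector_derivative r' x) (at x)"
proof -
  have "\<exists>r'\<in>ratfun a b. \<forall>x\<in>{a<..<b}. (r has_vector_derivative r' x) (at x)"
    using assms(2)
  proof induction
    case (const k)
    show ?case by (intro bexI[of _ "\<lambda>x. 0"] ballI has_vector_derivative_const ratfun.const)
  next
    case ident
    show ?case
    proof (intro bexI[of _ "\<lambda>x. 1"] ballI ratfun.const)
      fix x
      show "((\<lambda>x. complex_of_real x) has_vector_derivative 1) (at x)"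
        using has_vector_derivative_of_real[OF DERIV_ident] by simp
    qed
  next
    case inv_ident
    show ?case
    proof (intro bexI[of _ "\<lambda>x. (- 1) * (of_real (1 / x) * of_real (1 / x))"] ballI ratfun.intros)
      fix x assume "x \<in> {a<..<b}"
      then have "((\<lambda>x. 1 / x) has_field_derivative - (1 / x * (1 / x))) (at x)"
        using assms(1) by (auto intro!: derivative_eq_intros simp: power2_eq_square)
      from has_vector_derivative_of_real[OF this]
      show "((\<lambda>x. complex_of_real (1 / x)) has_vector_derivative
          (- 1) * (of_real (1 / x) * of_real (1 / x))) (at x)"
        by (simp only: of_real_minus of_real_mult mult_minus1)
    qed
  next
    case inv_left
    show ?case
    proof (intro bexI[of _ "\<lambda>x. (- 1) * (of_real (1 / (x - a)) * of_real (1 / (x - a)))"] ballI ratfun.intros)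
      fix x assume "x \<in> {a<..<b}"
      then have "((\<lambda>x. 1 / (x - a)) has_field_derivative - (1 / (x - a) * (1 / (x - a)))) (at x)"
        by (auto intro!: derivative_eq_intros simp: power2_eq_square)
      from has_vector_derivative_of_real[OF this]
      show "((\<lambda>x. complex_of_real (1 / (x - a))) has_vector_derivative
          (- 1) * (of_real (1 / (x - a)) * of_real (1 / (x - a)))) (at x)"
        by (simp only: of_real_minus of_real_mult mult_minus1)
    qed
  next
    case inv_right
    show ?case
    proof (intro bexI[of _ "\<lambda>x. of_real (1 / (b - x)) * of_real (1 / (b - x))"] ballI ratfun.intros)
      fix x assume "x \<in> {a<..<b}"
      then have "((\<lambda>x. 1 / (b - x)) has_field_derivative 1 / (b - x) * (1 / (b - x))) (at x)"
        by (auto intro!: derivative_eq_intros simp: power2_eq_square)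
      from has_vector_derivative_of_real[OF this]
      show "((\<lambda>x. complex_of_real (1 / (b - x))) has_vector_derivative
          of_real (1 / (b - x)) * of_real (1 / (b - x))) (at x)"
        by (simp only: of_real_mult)
    qed
  next
    case (add r s)
    then obtain r' s' where rs: "r' \<in> ratfun a b" "s' \<in> ratfun a b"
      "\<And>x. x \<in> {a<..<b} \<Longrightarrow> (r has_vector_derivative r' x) (at x)"
      "\<And>x. x \<in> {a<..<b} \<Longrightarrow> (s has_vector_derivative s' x) (at x)" by blast
    show ?case
      by (intro bexI[of _ "\<lambda>x. r' x + s' x"] ballI ratfun.add rs has_vector_derivative_add)
  next
    case (mult r s)
    then obtain r' s' where rs: "r' \<in> ratfun a b" "s' \<in> ratfun a b"
      "\<And>x. x \<in> {a<..<b} \<Longrightarrow> (r has_vector_derivative r' x) (at x)"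
      "\<And>x. x \<in> {a<..<b} \<Longrightarrow> (s has_vector_derivative s' x) (at x)" by blast
    show ?case
      by (intro bexI[of _ "\<lambda>x. r x * s' x + r' x * s x"] ballI ratfun.add ratfun.mult rs mult.hyps
          has_vector_derivative_mult)
  qed
  then show ?thesis using that by blast
qed

text \<open>The base of the power dominates 1 and the modulus of every non-constant generator on the
  interval. Being at least 1, its powers are comparable, so bounds survive sums and
  products.\<close>

lemma ratfun_bound:
  assumes ab: "0 < a" "a < b" and r: "r \<in> ratfun a b"
  obtains C N where "0 \<le> C"
    "\<And>x. x \<in> {a<..<b} \<Longrightarrow> cmod (r x) \<le> C * (1 / (x - a) + 1 / (b - x) + (1 + b + 1 / a)) ^ N"
proof -
  define m where "m x = 1 / (x - a) + 1 / (b - x) + (1 + b + 1 / a)" for x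
  have m: "1 \<le> m x" "x \<le> m x" "1 / x \<le> m x" "1 / (x - a) \<le> m x" "1 / (b - x) \<le> m x"
    if "x \<in> {a<..<b}" for x
  proof -
    have p: "0 \<le> 1 / (x - a)" "0 \<le> 1 / (b - x)" "0 \<le> 1 / a" "1 / x \<le> 1 / a"
      using that ab by (auto intro!: divide_left_mono)
    have q: "a < x" "x < b" using that by auto
    show "1 \<le> m x" "x \<le> m x" "1 / x \<le> m x" "1 / (x - a) \<le> m x" "1 / (b - x) \<le> m x"
      using p q ab unfolding m_def by linarith+
  qed
  have "\<exists>C\<ge>0. \<exists>N. \<forall>x\<in>{a<..<b}. cmod (r x) \<le> C * m x ^ N"
    using r
  proof induction
    case (const k)
    show ?case by (intro exI[of _ "cmod k"] conjI exI[of _ 0]) auto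
  next
    case ident
    show ?case by (intro exI[of _ 1] conjI exI[of _ 1]) (use m(2) ab in auto)
  next
    case inv_ident
    show ?case by (intro exI[of _ 1] conjI exI[of _ 1]) (use m(3) ab in \<open>auto simp: norm_divide\<close>)
  next
    case inv_left
    have "cmod (of_real (1 / (x - a))) \<le> 1 * m x ^ 1" if "x \<in> {a<..<b}" for x
      unfolding norm_of_real using m(4)[OF that] that by simp
    then show ?case by (intro exI[of _ 1] conjI exI[of _ 1] ballI) auto
  next
    case inv_right
    have "cmod (of_real (1 / (b - x))) \<le> 1 * m x ^ 1" if "x \<in> {a<..<b}" for x
      unfolding norm_of_real using m(5)[OF that] that by simp
    then show ?case by (intro exI[of _ 1] conjI exI[of _ 1] ballI) auto
  next
    case (add r s)
    then obtain C N D P where C: "0 \<le> C" "\<And>x. x \<in> {a<..<b} \<Longrightarrow> cmod (r x) \<le> C * m x ^ N"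
      and D: "0 \<le> D" "\<And>x. x \<in> {a<..<b} \<Longrightarrow> cmod (s x) \<le> D * m x ^ P" by metis
    have "cmod (r x + s x) \<le> (C + D) * m x ^ (N + P)" if x: "x \<in> {a<..<b}" for x
    proof -
      have "C * m x ^ N \<le> C * m x ^ (N + P)" "D * m x ^ P \<le> D * m x ^ (N + P)"
        using m(1)[OF x] C D by (auto intro!: mult_left_mono power_increasing)
      then show ?thesis
        using C(2)[OF x] D(2)[OF x] norm_triangle_ineq[of "r x" "s x"] by (simp add: distrib_right)
    qed
    then show ?case using C D by (intro exI[of _ "C + D"] conjI exI[of _ "N + P"]) auto
  next
    case (mult r s)
    then obtain C N D P where C: "0 \<le> C" "\<And>x. x \<in> {a<..<b} \<Longrightarrow> cmod (r x) \<le> C * m x ^ N"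
      and D: "0 \<le> D" "\<And>x. x \<in> {a<..<b} \<Longrightarrow> cmod (s x) \<le> D * m x ^ P" by metis
    have "cmod (r x * s x) \<le> (C * D) * m x ^ (N + P)" if x: "x \<in> {a<..<b}" for x
    proof -
      have "cmod (r x) * cmod (s x) \<le> (C * m x ^ N) * (D * m x ^ P)"
        using C D m(1)[OF x] x by (intro mult_mono) auto
      then show ?thesis by (simp add: norm_mult power_add mult_ac)
    qed
    then show ?case using C D by (intro exI[of _ "C * D"] conjI exI[of _ "N + P"]) auto
  qed
  then show ?thesis using that unfolding m_def by blast
qed

text \<open>The inequality (1 + y/n)^n \<le> exp y at y = \<alpha> m, rearranged.\<close>

lemma power_exp_bound:
  fixes \<alpha> m :: real
  assumes "0 < \<alpha>" "0 \<le> m" "0 < n"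
  shows "m ^ n * exp (- (\<alpha> * m)) \<le> (real n / \<alpha>) ^ n"
proof -
  have "(\<alpha> * m / real n) ^ n \<le> (1 + \<alpha> * m / real n) ^ n"
    using assms by (intro power_mono) auto
  also have "\<dots> \<le> exp (\<alpha> * m)"
    using assms mult_nonneg_nonneg[of \<alpha> m]
    by (intro exp_ge_one_plus_x_over_n_power_n) linarith+
  finally have "(\<alpha> * m / real n) ^ n * (real n / \<alpha>) ^ n \<le> exp (\<alpha> * m) * (real n / \<alpha>) ^ n"
    using assms by (intro mult_right_mono) auto
  moreover have "(\<alpha> * m / real n) ^ n * (real n / \<alpha>) ^ n = m ^ n"
    using assms by (simp flip: power_mult_distrib)
  ultimately show ?thesis
    by (simp add: exp_minus field_simps)
qed

text \<open>The exponential of this phase is x powr c exp (- z x^2/2) times the cut-off exp (- a/(x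
  - a) - 1/(b - x)), so a cut-off Gaussian is itself a \<open>cut_fun\<close> and hence a test
  function. The numerator a in the left singular term makes the cut-off near a depend on x/a alone,
  which matters as a tends to 0.\<close>

definition cut_phase :: "real \<Rightarrow> real \<Rightarrow> real \<Rightarrow> complex \<Rightarrow> real \<Rightarrow> complex" where
  "cut_phase a b c z x = of_real (c * ln x - a * (1 / (x - a)) - 1 / (b - x)) - z * of_real (x\<^sup>2) / 2"

definition cut_fun :: "real \<Rightarrow> real \<Rightarrow> real \<Rightarrow> complex \<Rightarrow> (real \<Rightarrow> complex) \<Rightarrow> real \<Rightarrow> complex" where
  "cut_fun a b c z r x = (if x \<in> {a<..<b} then r x * exp (cut_phase a b c z x) else 0)"

definition cut_phase' :: "real \<Rightarrow> real \<Rightarrow> real \<Rightarrow> complex \<Rightarrow> real \<Rightarrow> complex" where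
  "cut_phase' a b c z x = of_real c * of_real (1 / x)
     + of_real a * (of_real (1 / (x - a)) * of_real (1 / (x - a)))
     + (- 1) * (of_real (1 / (b - x)) * of_real (1 / (b - x))) + (- z) * of_real x"

lemma cut_phase'_ratfun: "cut_phase' a b c z \<in> ratfun a b"
  unfolding cut_phase'_def[abs_def] by (intro ratfun.intros)

lemma cut_phase_derivative:
  assumes "0 < a" "x \<in> {a<..<b}"
  shows "(cut_phase a b c z has_vector_derivative cut_phase' a b c z x) (at x)"
proof -
  have 1: "((\<lambda>x. c * ln x - a * (1 / (x - a)) - 1 / (b - x)) has_field_derivative
      (c * (1 / x) + a * (1 / (x - a) * (1 / (x - a))) - 1 / (b - x) * (1 / (b - x)))) (at x)"
    using assms by (auto intro!: derivative_eq_intros simp: power2_eq_square)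
  have 2: "((\<lambda>x. x\<^sup>2) has_field_derivative 2 * x) (at x)"
    by (auto intro!: derivative_eq_intros)
  have "((\<lambda>x. of_real (c * ln x - a * (1 / (x - a)) - 1 / (b - x)) - (z / 2) * complex_of_real (x\<^sup>2))
      has_vector_derivative
      (of_real (c * (1 / x) + a * (1 / (x - a) * (1 / (x - a))) - 1 / (b - x) * (1 / (b - x)))
        - (z / 2) * of_real (2 * x))) (at x)"
    by (intro has_vector_derivative_diff has_vector_derivative_of_real[OF 1]
        has_vector_derivative_mult_right has_vector_derivative_of_real[OF 2])
  then show ?thesis
    unfolding cut_phase_def[abs_def] cut_phase'_def by (simp add: algebra_simps)
qed

text \<open>The exponential exp (- \<alpha> m) beats every power of m, in particular m^(N+2); what
  remains is 1/m^2, and m dominates both 1/(x - a) and 1/(b - x).\<close>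

lemma cut_fun_bound:
  assumes ab: "0 < a" "a < b" and r: "r \<in> ratfun a b"
  obtains D where "\<And>x. cmod (cut_fun a b c z r x) \<le> D * (x - a)\<^sup>2"
    "\<And>x. cmod (cut_fun a b c z r x) \<le> D * (x - b)\<^sup>2"
proof -
  define m where "m x = 1 / (x - a) + 1 / (b - x) + (1 + b + 1 / a)" for x
  obtain C N where C: "0 \<le> C" "\<And>x. x \<in> {a<..<b} \<Longrightarrow> cmod (r x) \<le> C * m x ^ N"
    using ratfun_bound[OF ab r] unfolding m_def by blast
  \<comment> \<open>The singular terms of the phase have coefficients a and 1, so their sum is at
    most - \<alpha> m up to a constant; \<open>B\<close> is the exponential of that constant and of
    bounds for the remaining terms.\<close>
  define \<alpha> where "\<alpha> = min a 1"
  have \<alpha>: "0 < \<alpha>" "\<alpha> \<le> a" "\<alpha> \<le> 1" using ab by (auto simp: \<alpha>_def)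
  define B where "B = exp (\<bar>c\<bar> * (b + 1 / a) + \<bar>Re z\<bar> * b\<^sup>2 / 2 + \<alpha> * (1 + b + 1 / a))"
  define D where "D = C * B * (real (N + 2) / \<alpha>) ^ (N + 2)"
  have D: "0 \<le> D" using C \<alpha> by (simp add: D_def B_def)
  have main: "cmod (cut_fun a b c z r x) \<le> D / (m x)\<^sup>2 \<and> 1 / (x - a) \<le> m x \<and> 1 / (b - x) \<le> m x"
    if x: "x \<in> {a<..<b}" for x
  proof -
    have p: "0 < 1 / (x - a)" "0 < 1 / (b - x)" "0 < 1 / a" using x ab by auto
    have m: "0 < m x" using p ab unfolding m_def by linarith
    have "ln x \<le> b + 1 / a" using ln_le_minus_one[of x] x ab p(3)
      unfolding greaterThanLessThan_iff by linarith
    moreover have "- ln x \<le> b + 1 / a"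
    proof -
      have "- ln x = ln (1 / x)" using x ab by (simp add: ln_div)
      also have "\<dots> \<le> 1 / x" using ln_le_minus_one[of "1 / x"] x ab by auto
      also have "\<dots> \<le> 1 / a" using x ab by (intro divide_left_mono) auto
      finally show ?thesis using ab by linarith
    qed
    ultimately have "\<bar>c * ln x\<bar> \<le> \<bar>c\<bar> * (b + 1 / a)"
      unfolding abs_mult by (intro mult_left_mono) auto
    moreover have "\<bar>Re z * x\<^sup>2 / 2\<bar> \<le> \<bar>Re z\<bar> * b\<^sup>2 / 2"
      using x ab by (auto simp: abs_mult intro!: divide_right_mono mult_left_mono power_mono)
    moreover have "\<alpha> * (1 / (x - a)) \<le> a * (1 / (x - a))" "\<alpha> * (1 / (b - x)) \<le> 1 * (1 / (b - x))"
      using p \<alpha> by (intro mult_right_mono; linarith)+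
    moreover have "Re (cut_phase a b c z x) = c * ln x - a * (1 / (x - a)) - 1 / (b - x) - Re z * x\<^sup>2 / 2"
      by (simp add: cut_phase_def del: of_real_power)
    ultimately have "Re (cut_phase a b c z x)
        \<le> (\<bar>c\<bar> * (b + 1 / a) + \<bar>Re z\<bar> * b\<^sup>2 / 2 + \<alpha> * (1 + b + 1 / a)) - \<alpha> * m x"
      unfolding m_def distrib_left by linarith
    then have e: "cmod (exp (cut_phase a b c z x)) \<le> B * exp (- (\<alpha> * m x))"
      unfolding B_def norm_exp_eq_Re exp_add[symmetric] by simp
    have "cmod (cut_fun a b c z r x) = cmod (r x) * cmod (exp (cut_phase a b c z x))"
      using x by (simp add: cut_fun_def norm_mult)
    also have "\<dots> \<le> (C * m x ^ N) * (B * exp (- (\<alpha> * m x)))"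
      using C m by (intro mult_mono e C(2)[OF x]) auto
    also have "\<dots> = C * B * (m x ^ (N + 2) * exp (- (\<alpha> * m x))) / (m x)\<^sup>2"
      using m unfolding power_add by (simp add: power2_eq_square)
    also have "\<dots> \<le> D / (m x)\<^sup>2"
      unfolding D_def using C m \<alpha>
      by (intro divide_right_mono mult_left_mono power_exp_bound) (auto simp: B_def)
    finally show ?thesis using p ab unfolding m_def by auto
  qed
  have small: "D / (m x)\<^sup>2 \<le> D * y\<^sup>2" if "0 < y" "1 / y \<le> m x" for x y
  proof -
    have "(1 / y)\<^sup>2 \<le> (m x)\<^sup>2" using that by (intro power_mono) auto
    then have "D / (m x)\<^sup>2 \<le> D / (1 / y)\<^sup>2"
      using that D by (intro divide_left_mono) (auto simp: zero_less_mult_iff intro!: mult_pos_pos less_le_trans[of _ "(1/y)\<^sup>2"])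
    then show ?thesis using that by (simp add: power_divide)
  qed
  show ?thesis
  proof
    show "cmod (cut_fun a b c z r x) \<le> D * (x - a)\<^sup>2" for x
    proof (cases "x \<in> {a<..<b}")
      case True
      then show ?thesis using main[OF True] small[of "x - a" x] by auto
    qed (use D in \<open>auto simp: cut_fun_def\<close>)
    show "cmod (cut_fun a b c z r x) \<le> D * (x - b)\<^sup>2" for x
    proof (cases "x \<in> {a<..<b}")
      case True
      then show ?thesis using main[OF True] small[of "b - x" x] by (auto simp: power2_commute)
    qed (use D in \<open>auto simp: cut_fun_def\<close>)
  qed
qed

text \<open>Inside the interval this is the product rule. At the endpoints the quadratic bound makes
  the derivative 0, so the derivative is again of the form \<open>cut_fun\<close> on the whole line
  and differentiation can be iterated.\<close>

lemma cut_fun_derivative: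
  assumes ab: "0 < a" "a < b" and r: "r \<in> ratfun a b"
  obtains r' where "r' \<in> ratfun a b"
    "\<And>x. (cut_fun a b c z r has_vector_derivative cut_fun a b c z r' x) (at x)"
proof -
  obtain r1 where r1: "r1 \<in> ratfun a b" "\<And>x. x \<in> {a<..<b} \<Longrightarrow> (r has_vector_derivative r1 x) (at x)"
    using ratfun_derivative[OF ab(1) r] by blast
  define r' where "r' x = r x * cut_phase' a b c z x + r1 x" for x
  have r': "r' \<in> ratfun a b"
    unfolding r'_def[abs_def] by (intro ratfun.add ratfun.mult r r1 cut_phase'_ratfun)
  obtain D where D: "\<And>x. cmod (cut_fun a b c z r x) \<le> D * (x - a)\<^sup>2"
    "\<And>x. cmod (cut_fun a b c z r x) \<le> D * (x - b)\<^sup>2"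
    using cut_fun_bound[OF ab r] by blast
  have "(cut_fun a b c z r has_vector_derivative cut_fun a b c z r' x) (at x)" for x
  proof -
    consider "x \<in> {a<..<b}" | "x \<in> {..<a} \<union> {b<..}" | "x = a" | "x = b"
      by (metis UnCI greaterThanLessThan_iff greaterThan_iff lessThan_iff linorder_neqE_linordered_idom)
    then show ?thesis
    proof cases
      case 1
      have "((\<lambda>x. exp (cut_phase a b c z x)) has_vector_derivative
          (cut_phase' a b c z x * exp (cut_phase a b c z x))) (at x)"
        using field_vector_diff_chain_at[OF cut_phase_derivative[OF ab(1) 1] DERIV_exp]
        by (simp add: o_def)
      from has_vector_derivative_mult[OF r1(2)[OF 1] this]
      have "((\<lambda>x. r x * exp (cut_phase a b c z x)) has_vector_derivative
          (r' x * exp (cut_phase a b c z x))) (at x)"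
        by (simp add: r'_def algebra_simps)
      then have "((\<lambda>x. r x * exp (cut_phase a b c z x)) has_vector_derivative cut_fun a b c z r' x) (at x)"
        using 1 by (simp add: cut_fun_def)
      then show ?thesis
        by (rule has_vector_derivative_transform_within_open[of _ _ _ "{a<..<b}"])
           (use 1 in \<open>auto simp: cut_fun_def\<close>)
    next
      case 2
      have "((\<lambda>x. 0) has_vector_derivative (0::complex)) (at x)" by (rule has_vector_derivative_const)
      then have "(cut_fun a b c z r has_vector_derivative 0) (at x)"
        by (rule has_vector_derivative_transform_within_open[of _ _ _ "{..<a} \<union> {b<..}"])
           (use 2 in \<open>auto simp: cut_fun_def\<close>)
      then show ?thesis using 2 by (auto simp: cut_fun_def)
    next
      case 3
      have "(cut_fun a b c z r has_vector_derivative 0) (at a)"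
        by (rule has_vector_derivativeI_quadratic[where \<delta> = 1 and C = D])
           (use D(1)[of "a + _"] D(1)[of a] in auto)
      then show ?thesis using 3 by (simp add: cut_fun_def)
    next
      case 4
      have "(cut_fun a b c z r has_vector_derivative 0) (at b)"
        by (rule has_vector_derivativeI_quadratic[where \<delta> = 1 and C = D])
           (use D(2)[of "b + _"] D(2)[of b] in auto)
      then show ?thesis using 4 by (simp add: cut_fun_def)
    qed
  qed
  with r' show ?thesis using that by blast
qed

lemma cut_fun_test_function:
  assumes ab: "0 < a" "a < b" and r: "r \<in> ratfun a b"
  shows "cut_fun a b c z r \<in> test_functions"
proof -
  have "\<exists>s\<in>ratfun a b. (vderiv ^^ n) (cut_fun a b c z r) = cut_fun a b c z s" for n
  proof (induction n)
    case 0 then show ?case using r by auto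
  next
    case (Suc n)
    then obtain s where s: "s \<in> ratfun a b" "(vderiv ^^ n) (cut_fun a b c z r) = cut_fun a b c z s"
      by blast
    obtain s' where s': "s' \<in> ratfun a b"
      "\<And>x. (cut_fun a b c z s has_vector_derivative cut_fun a b c z s' x) (at x)"
      using cut_fun_derivative[OF ab s(1)] by blast
    have "vderiv (cut_fun a b c z s) = cut_fun a b c z s'"
      unfolding vderiv_def using vector_derivative_at[OF s'(2)] by auto
    then show ?case using s s' by auto
  qed
  moreover have "cut_fun a b c z s differentiable (at x)" if "s \<in> ratfun a b" for s x
    using cut_fun_derivative[OF ab that] by (metis differentiableI_vector)
  ultimately have "\<forall>n x. (vderiv ^^ n) (cut_fun a b c z r) differentiable (at x)" by metis
  moreover have "closure {x. cut_fun a b c z r x \<noteq> 0} \<subseteq> {a..b}"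
    by (rule closure_minimal) (auto simp: cut_fun_def)
  ultimately show ?thesis
    unfolding test_functions_def using ab
    by (auto intro: compact_closure[THEN iffD2] bounded_subset)
       (metis bounded_closed_interval bounded_subset closure_subset compact_closure order_trans)
qed

section \<open>The Friedrichs extension\<close>

lemma test_function_derivatives:
  assumes "\<phi> \<in> test_functions"
  shows "((vderiv ^^ n) \<phi> has_vector_derivative (vderiv ^^ Suc n) \<phi> x) (at x)"
proof -
  have "(vderiv ^^ n) \<phi> differentiable (at x)" using assms by (simp add: test_functions_def)
  then show ?thesis by (simp add: vderiv_def vector_derivative_works)
qed

lemma test_function_C2:
  assumes "\<phi> \<in> test_functions"
  shows "C2_on_halfline \<phi> (vderiv \<phi>) (vderiv (vderiv \<phi>))"
  unfolding C2_on_halfline_def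
proof (intro conjI allI impI)
  fix x :: real
  show "(\<phi> has_vector_derivative vderiv \<phi> x) (at x)"
    using test_function_derivatives[OF assms, of 0] by simp
  show "(vderiv \<phi> has_vector_derivative vderiv (vderiv \<phi>) x) (at x)"
    using test_function_derivatives[OF assms, of 1] by simp
  show "continuous_on {0<..} (vderiv (vderiv \<phi>))"
    using test_function_derivatives[OF assms, of 2]
    by (auto intro!: continuous_at_imp_continuous_on has_vector_derivative_continuous simp: numeral_2_eq_2)
qed

lemma test_function_support:
  assumes "\<phi> \<in> test_functions"
  obtains a b where "0 < a" "a \<le> b" "\<And>x. x \<notin> {a..b} \<Longrightarrow> \<phi> x = 0"
proof -
  define K where "K = closure {x. \<phi> x \<noteq> 0}"
  have K: "compact K" "K \<subseteq> {0<..}" using assms by (auto simp: test_functions_def K_def)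
  show ?thesis
  proof (cases "K = {}")
    case True
    then have "\<phi> x = 0" for x using closure_subset[of "{x. \<phi> x \<noteq> 0}"] by (auto simp: K_def)
    then show ?thesis using that[of 1 1] by auto
  next
    case False
    obtain a where a: "a \<in> K" "\<And>x. x \<in> K \<Longrightarrow> a \<le> x" using compact_attains_inf[OF K(1) False] by blast
    obtain b where b: "b \<in> K" "\<And>x. x \<in> K \<Longrightarrow> x \<le> b" using compact_attains_sup[OF K(1) False] by blast
    show ?thesis
    proof (rule that)
      show "0 < a" "a \<le> b" using a b K by auto
      fix x assume "x \<notin> {a..b}"
      then have "x \<notin> K" using a b by auto
      then show "\<phi> x = 0" using closure_subset[of "{x. \<phi> x \<noteq> 0}"] by (auto simp: K_def)
    qed
  qed
qed

lemma test_function_lincomb: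
  assumes \<phi>: "\<phi> \<in> test_functions" and \<psi>: "\<psi> \<in> test_functions"
  shows "(\<lambda>x. \<phi> x + k * \<psi> x) \<in> test_functions"
    and "vderiv (\<lambda>x. \<phi> x + k * \<psi> x) = (\<lambda>x. vderiv \<phi> x + k * vderiv \<psi> x)"
    and "vderiv (vderiv (\<lambda>x. \<phi> x + k * \<psi> x)) = (\<lambda>x. vderiv (vderiv \<phi>) x + k * vderiv (vderiv \<psi>) x)"
proof -
  let ?f = "\<lambda>x. \<phi> x + k * \<psi> x"
  have d: "((\<lambda>x. (vderiv ^^ n) \<phi> x + k * (vderiv ^^ n) \<psi> x) has_vector_derivative
      ((vderiv ^^ Suc n) \<phi> x + k * (vderiv ^^ Suc n) \<psi> x)) (at x)" for n x
    by (intro has_vector_derivative_add has_vector_derivative_mult_right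
        test_function_derivatives \<phi> \<psi>)
  have eq: "(vderiv ^^ n) ?f = (\<lambda>x. (vderiv ^^ n) \<phi> x + k * (vderiv ^^ n) \<psi> x)" for n
  proof (induction n)
    case (Suc n)
    have "(vderiv ^^ Suc n) ?f = vderiv (\<lambda>x. (vderiv ^^ n) \<phi> x + k * (vderiv ^^ n) \<psi> x)"
      using Suc by simp
    also have "\<dots> = (\<lambda>x. (vderiv ^^ Suc n) \<phi> x + k * (vderiv ^^ Suc n) \<psi> x)"
      using vector_derivative_at[OF d[of n]] by (auto simp: vderiv_def)
    finally show ?case .
  qed simp
  show "vderiv ?f = (\<lambda>x. vderiv \<phi> x + k * vderiv \<psi> x)" using eq[of 1] by simp
  show "vderiv (vderiv ?f) = (\<lambda>x. vderiv (vderiv \<phi>) x + k * vderiv (vderiv \<psi>) x)"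
    using eq[of 2] by (simp add: numeral_2_eq_2)
  have "(vderiv ^^ n) ?f differentiable (at x)" for n x
    unfolding eq using d by (rule differentiableI_vector)
  moreover have sub: "closure {x. ?f x \<noteq> 0} \<subseteq> closure {x. \<phi> x \<noteq> 0} \<union> closure {x. \<psi> x \<noteq> 0}"
    unfolding closure_Un[symmetric] by (intro closure_mono) auto
  moreover have "compact (closure {x. \<phi> x \<noteq> 0} \<union> closure {x. \<psi> x \<noteq> 0})"
    using \<phi> \<psi> by (intro compact_Un) (auto simp: test_functions_def)
  then have "compact (closure {x. ?f x \<noteq> 0})"
    using sub by (metis Int_absorb1 closed_closure compact_Int_closed)
  moreover have "closure {x. \<phi> x \<noteq> 0} \<union> closure {x. \<psi> x \<noteq> 0} \<subseteq> {0<..}"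
    using \<phi> \<psi> by (auto simp: test_functions_def)
  ultimately show "?f \<in> test_functions"
    unfolding test_functions_def by blast
qed

lemma zero_test_function: "(\<lambda>x. 0) \<in> test_functions"
  using test_function_lincomb(1)[of "cut_fun 1 2 0 0 (\<lambda>x. 0)" "cut_fun 1 2 0 0 (\<lambda>x. 0)" "-1"]
    cut_fun_test_function[of 1 2 "\<lambda>x. 0"] ratfun.const by simp

lemma test_function_scale:
  assumes \<phi>: "\<phi> \<in> test_functions"
  shows "(\<lambda>x. k * \<phi> x) \<in> test_functions"
    and "vderiv (\<lambda>x. k * \<phi> x) = (\<lambda>x. k * vderiv \<phi> x)"
    and "vderiv (vderiv (\<lambda>x. k * \<phi> x)) = (\<lambda>x. k * vderiv (vderiv \<phi>) x)"
proof -
  have 0: "vderiv (\<lambda>x. 0) = (\<lambda>x. 0)" by (simp add: vderiv_def)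
  show "(\<lambda>x. k * \<phi> x) \<in> test_functions"
    and "vderiv (\<lambda>x. k * \<phi> x) = (\<lambda>x. k * vderiv \<phi> x)"
    and "vderiv (vderiv (\<lambda>x. k * \<phi> x)) = (\<lambda>x. k * vderiv (vderiv \<phi>) x)"
    using test_function_lincomb[OF zero_test_function \<phi>, of k] by (simp_all add: 0)
qed

abbreviation "Lt c \<phi> \<equiv> L_op c \<phi> (vderiv \<phi>)"
abbreviation "St c \<phi> \<equiv> S_op c \<phi> (vderiv (vderiv \<phi>))"

lemma Lt_lincomb:
  assumes "\<phi> \<in> test_functions" "\<psi> \<in> test_functions"
  shows "Lt c (\<lambda>x. \<phi> x + k * \<psi> x) = (\<lambda>x. Lt c \<phi> x + k * Lt c \<psi> x)"
    "St c (\<lambda>x. \<phi> x + k * \<psi> x) = (\<lambda>x. St c \<phi> x + k * St c \<psi> x)"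
  using test_function_lincomb[OF assms, of k]
  by (auto simp: L_op_def S_op_def algebra_simps fun_eq_iff
      simp del: of_real_mult of_real_divide of_real_diff of_real_power)

lemma Lt_scale:
  assumes "\<phi> \<in> test_functions"
  shows "Lt c (\<lambda>x. k * \<phi> x) = (\<lambda>x. k * Lt c \<phi> x)" "St c (\<lambda>x. k * \<phi> x) = (\<lambda>x. k * St c \<phi> x)"
  using test_function_scale[OF assms, of k]
  by (auto simp: L_op_def S_op_def algebra_simps fun_eq_iff
      simp del: of_real_mult of_real_divide of_real_diff of_real_power)

lemma L2_of_C2_compact_support:
  assumes u: "C2_on_halfline u u' u''" and "0 < a" and supp: "\<And>x. 0 < x \<Longrightarrow> x \<notin> {a..b} \<Longrightarrow> u x = 0"
  shows "u \<in> L2 halfline" "L_op c u u' \<in> L2 halfline" "S_op c u u'' \<in> L2 halfline"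
  by (rule L2_continuous_compact_support[OF assms(2), of _ b];
      use C2_continuous[OF u] L_op_continuous[OF u] S_op_continuous[OF u] supp C2_support[OF u supp]
      in \<open>auto simp: L_op_def S_op_def\<close>)+

lemma test_function_L2:
  assumes "\<phi> \<in> test_functions"
  shows "\<phi> \<in> L2 halfline" "Lt c \<phi> \<in> L2 halfline" "St c \<phi> \<in> L2 halfline"
proof -
  obtain a b where ab: "0 < a" "a \<le> b" "\<And>x. x \<notin> {a..b} \<Longrightarrow> \<phi> x = 0"
    using test_function_support[OF assms] by blast
  show "\<phi> \<in> L2 halfline" "Lt c \<phi> \<in> L2 halfline" "St c \<phi> \<in> L2 halfline"
    using L2_of_C2_compact_support[OF test_function_C2[OF assms] ab(1), of b] ab(3) by blast+
qed

lemma test_function_green: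
  assumes \<phi>: "\<phi> \<in> test_functions" and u: "C2_on_halfline u u' u''"
  shows "L2_inner halfline (L_op c u u') (Lt c \<phi>) = L2_inner halfline (S_op c u u'') \<phi>"
    "L2_inner halfline u (St c \<phi>) = L2_inner halfline (S_op c u u'') \<phi>"
    "L2_inner halfline (Lt c \<phi>) (L_op c u u') = L2_inner halfline (St c \<phi>) u"
proof -
  obtain a b where ab: "0 < a" "a \<le> b" "\<And>x. x \<notin> {a..b} \<Longrightarrow> \<phi> x = 0"
    using test_function_support[OF \<phi>] by blast
  then show "L2_inner halfline (L_op c u u') (Lt c \<phi>) = L2_inner halfline (S_op c u u'') \<phi>"
    "L2_inner halfline u (St c \<phi>) = L2_inner halfline (S_op c u u'') \<phi>"
    "L2_inner halfline (Lt c \<phi>) (L_op c u u') = L2_inner halfline (St c \<phi>) u"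
    using green[OF u test_function_C2[OF \<phi>] ab(1,2), of c]
      green_symmetric[OF u test_function_C2[OF \<phi>] ab(1,2), of c]
      green[OF test_function_C2[OF \<phi>] u ab(1,2), of c] by auto
qed

section \<open>The closed form and its operator\<close>

definition test_graph :: "real \<Rightarrow> (hl2 \<times> hl2) set" where
  "test_graph c = {(cls \<phi>, cls (Lt c \<phi>)) | \<phi>. \<phi> \<in> test_functions}"

text \<open>The graph of the closure of L from test functions. As the form equals the squared norm
  of L \<phi>, the first components are the form domain, and the second components evaluate the
  form.\<close>

definition form_graph :: "real \<Rightarrow> (hl2 \<times> hl2) set" where
  "form_graph c = closure (test_graph c)"

text \<open>The composition of the closed operator with its adjoint: u in the form domain with form
  (u, p) = <g, p> for every p in the form domain. \<open>H_op_iff\<close> identifies it with the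
  adjoint restricted to the form domain.\<close>

definition friedrichs :: "real \<Rightarrow> (hl2 \<times> hl2) set" where
  "friedrichs c = {(u, g). \<exists>s. (u, s) \<in> form_graph c \<and> (\<forall>(p, q)\<in>form_graph c. inner s q = inner g p)}"

lemma subspace_closure_real_normed:
  fixes S :: "'a::real_normed_vector set"
  assumes "subspace S"
  shows "subspace (closure S)"
proof (rule subspaceI)
  show "0 \<in> closure S" using subspace_0[OF assms] closure_subset by blast
  fix x y assume "x \<in> closure S" "y \<in> closure S"
  then obtain f g where "\<And>n. f n \<in> S" "f \<longlonglongrightarrow> x" "\<And>n. g n \<in> S" "g \<longlonglongrightarrow> y"
    unfolding closure_sequential by blast
  then show "x + y \<in> closure S"
    unfolding closure_sequential
    by (intro exI[of _ "\<lambda>n. f n + g n"]) (auto intro: tendsto_add subspace_add[OF assms])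
next
  fix c and x assume "x \<in> closure S"
  then obtain f where "\<And>n. f n \<in> S" "f \<longlonglongrightarrow> x" unfolding closure_sequential by blast
  then show "c *\<^sub>R x \<in> closure S"
    unfolding closure_sequential
    by (intro exI[of _ "\<lambda>n. c *\<^sub>R f n"]) (auto intro: tendsto_scaleR subspace_scale[OF assms])
qed

lemma test_graph_subspace: "subspace (test_graph c)"
proof (rule subspaceI)
  have "(cls (\<lambda>x. 0), cls (Lt c (\<lambda>x. 0))) \<in> test_graph c"
    unfolding test_graph_def using zero_test_function by blast
  moreover have "Lt c (\<lambda>x. 0) = (\<lambda>x. 0)" by (auto simp: L_op_def vderiv_def)
  moreover have "cls (\<lambda>x. 0) = 0" by (simp add: cls_abs L2_zero zero_hl2_def)
  ultimately show "0 \<in> test_graph c" by (simp add: zero_prod_def)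
next
  fix x y assume "x \<in> test_graph c" "y \<in> test_graph c"
  then obtain \<phi> \<psi> where "\<phi> \<in> test_functions" "\<psi> \<in> test_functions"
    and xy: "x = (cls \<phi>, cls (Lt c \<phi>))" "y = (cls \<psi>, cls (Lt c \<psi>))"
    unfolding test_graph_def by blast
  note t = \<open>\<phi> \<in> test_functions\<close> \<open>\<psi> \<in> test_functions\<close>
  have "x + y = (cls (\<lambda>x. \<phi> x + 1 * \<psi> x), cls (Lt c (\<lambda>x. \<phi> x + 1 * \<psi> x)))"
    unfolding xy Lt_lincomb[OF t] by (simp add: cls_add test_function_L2 t)
  then show "x + y \<in> test_graph c"
    unfolding test_graph_def using test_function_lincomb(1)[OF t, of 1] by blast
next
  fix r :: real and x assume "x \<in> test_graph c"
  then obtain \<phi> where t: "\<phi> \<in> test_functions" and x: "x = (cls \<phi>, cls (Lt c \<phi>))"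
    unfolding test_graph_def by blast
  have "r *\<^sub>R x = (cls (\<lambda>x. of_real r * \<phi> x), cls (Lt c (\<lambda>x. of_real r * \<phi> x)))"
    unfolding x Lt_scale[OF t] by (simp add: cls_cmul test_function_L2 t)
  then show "r *\<^sub>R x \<in> test_graph c"
    unfolding test_graph_def using test_function_scale(1)[OF t, of "of_real r"] by blast
qed

lemma form_graph_subspace: "subspace (form_graph c)" and form_graph_closed: "closed (form_graph c)"
  unfolding form_graph_def
  by (simp_all add: subspace_closure_real_normed test_graph_subspace)

text \<open>Both sides are continuous in (p, q), so the identity passes from the test functions to
  the closure.\<close>

lemma form_graph_induct:
  assumes "(p, q) \<in> form_graph c"
    and "\<And>\<phi>. \<phi> \<in> test_functions \<Longrightarrow> inner s (cls (Lt c \<phi>)) = inner g (cls \<phi>)"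
  shows "inner s q = inner g p"
proof -
  have "form_graph c \<subseteq> {x. inner s (snd x) = inner g (fst x)}"
    unfolding form_graph_def
  proof (rule closure_minimal)
    show "test_graph c \<subseteq> {x. inner s (snd x) = inner g (fst x)}"
      using assms(2) by (auto simp: test_graph_def)
    show "closed {x. inner s (snd x) = inner g (fst x)}"
      by (intro closed_Collect_eq continuous_intros)
  qed
  then show ?thesis using assms(1) by auto
qed

lemma form_graph_green:
  assumes "(u, s) \<in> form_graph c" "\<phi> \<in> test_functions"
  shows "inner s (cls (Lt c \<phi>)) = inner u (cls (St c \<phi>))"
proof -
  have "inner (cls (Lt c \<phi>)) s = inner (cls (St c \<phi>)) u"
  proof (rule form_graph_induct[OF assms(1)])
    fix \<psi> assume "\<psi> \<in> test_functions"
    then show "inner (cls (Lt c \<phi>)) (cls (Lt c \<psi>)) = inner (cls (St c \<phi>)) (cls \<psi>)"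
      using test_function_green(3)[OF assms(2) test_function_C2, of \<psi> c] assms(2)
      by (simp add: inner_cls test_function_L2)
  qed
  then show ?thesis by (simp add: inner_commute)
qed

lemma min_operator_eq:
  assumes "c = \<nu> + 1/2"
  shows "min_operator \<nu> = {(\<phi>, St c \<phi>) | \<phi>. \<phi> \<in> test_functions}"
proof -
  have "\<nu>\<^sup>2 - 1/4 = c\<^sup>2 - c" unfolding assms by (simp add: power2_eq_square algebra_simps)
  then show ?thesis unfolding min_operator_def S_op_def[abs_def] by simp
qed

text \<open>Green's formula for the difference \<eta> of the two functions. By it, Cauchy for the
  form means that L \<phi>_n is Cauchy in norm.\<close>

lemma norm_Lt_diff:
  assumes t: "\<phi> \<in> test_functions" "\<psi> \<in> test_functions"
  shows "cmod (L2_inner halfline (\<lambda>x. St c \<phi> x - St c \<psi> x) (\<lambda>x. \<phi> x - \<psi> x))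
    = (norm (cls (Lt c \<phi>) - cls (Lt c \<psi>)))\<^sup>2"
proof -
  define \<eta> where "\<eta> x = \<phi> x + (-1) * \<psi> x" for x
 have \<eta>_eq: "(\<lambda>x. \<phi> x - \<psi> x) = \<eta>" by (auto simp: \<eta>_def)
  have \<eta>: "\<eta> \<in> test_functions" unfolding \<eta>_def by (rule test_function_lincomb[OF t])
  have St: "(\<lambda>x. St c \<phi> x - St c \<psi> x) = St c \<eta>" and Lt: "(\<lambda>x. Lt c \<phi> x - Lt c \<psi> x) = Lt c \<eta>"
    unfolding \<eta>_def[abs_def] Lt_lincomb[OF t] by simp_all
  have "cls (Lt c \<phi>) - cls (Lt c \<psi>) = cls (Lt c \<eta>)"
    unfolding Lt[symmetric] using t by (simp add: cls_diff test_function_L2)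
  then have "(norm (cls (Lt c \<phi>) - cls (Lt c \<psi>)))\<^sup>2 = (LINT x|halfline. (cmod (Lt c \<eta> x))\<^sup>2)"
    by (simp add: norm_cls_power2 test_function_L2 \<eta>)
  also have "\<dots> = cmod (L2_inner halfline (Lt c \<eta>) (Lt c \<eta>))"
    by (simp add: L2_inner_self)
  also have "\<dots> = cmod (L2_inner halfline (St c \<eta>) \<eta>)"
    by (simp add: test_function_green(3)[OF \<eta> test_function_C2[OF \<eta>]])
  finally show ?thesis unfolding St \<eta>_eq by simp
qed

lemma form_domain_iff:
  assumes c: "c = \<nu> + 1/2" and f: "f \<in> L2 halfline"
  shows "f \<in> form_domain halfline (min_operator \<nu>) \<longleftrightarrow> (\<exists>s. (cls f, s) \<in> form_graph c)"
proof
  assume "f \<in> form_domain halfline (min_operator \<nu>)"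
  then obtain \<phi> h where \<phi>h: "\<And>n. (\<phi> n, h n) \<in> min_operator \<nu>"
    and lim: "(\<lambda>n. L2_norm halfline (\<lambda>x. \<phi> n x - f x)) \<longlonglongrightarrow> 0"
    and cau: "\<And>\<epsilon>. 0 < \<epsilon> \<Longrightarrow> \<exists>N. \<forall>m\<ge>N. \<forall>n\<ge>N.
           cmod (L2_inner halfline (\<lambda>x. h m x - h n x) (\<lambda>x. \<phi> m x - \<phi> n x)) < \<epsilon>"
    unfolding form_domain_def by blast
  have t: "\<phi> n \<in> test_functions" and h: "h n = St c (\<phi> n)" for n
    using \<phi>h[of n] unfolding min_operator_eq[OF c] by auto
  have "Cauchy (\<lambda>n. cls (Lt c (\<phi> n)))"
  proof (rule CauchyI)
    fix e :: real assume "0 < e"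
    then obtain N where N: "\<And>m n. m \<ge> N \<Longrightarrow> n \<ge> N \<Longrightarrow>
        (norm (cls (Lt c (\<phi> m)) - cls (Lt c (\<phi> n))))\<^sup>2 < e\<^sup>2"
      using cau[of "e\<^sup>2"] unfolding h norm_Lt_diff[OF t t] by auto
    then have "norm (cls (Lt c (\<phi> m)) - cls (Lt c (\<phi> n))) < e" if "m \<ge> N" "n \<ge> N" for m n
      using that \<open>0 < e\<close> by (meson less_imp_le power2_less_imp_less)
    then show "\<exists>M. \<forall>m\<ge>M. \<forall>n\<ge>M. norm (cls (Lt c (\<phi> m)) - cls (Lt c (\<phi> n))) < e" by blast
  qed
  then obtain s where s: "(\<lambda>n. cls (Lt c (\<phi> n))) \<longlonglongrightarrow> s"
    using Cauchy_convergent_iff convergent_def by blast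
  have "(\<lambda>n. norm (cls (\<phi> n) - cls f)) \<longlonglongrightarrow> 0"
    using lim by (simp add: norm_cls L2_diff f test_function_L2 t flip: cls_diff)
  then have "(\<lambda>n. cls (\<phi> n)) \<longlonglongrightarrow> cls f"
    using LIM_zero_iff tendsto_norm_zero_iff by blast
  then have "(\<lambda>n. (cls (\<phi> n), cls (Lt c (\<phi> n)))) \<longlonglongrightarrow> (cls f, s)" using s by (rule tendsto_Pair)
  moreover have "(cls (\<phi> n), cls (Lt c (\<phi> n))) \<in> test_graph c" for n
    using t by (auto simp: test_graph_def)
  ultimately show "\<exists>s. (cls f, s) \<in> form_graph c"
    unfolding form_graph_def closure_sequential by (intro exI[of _ s] exI conjI allI)
next
  assume "\<exists>s. (cls f, s) \<in> form_graph c"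
  then obtain s X where X: "\<And>n. X n \<in> test_graph c" and lim: "X \<longlonglongrightarrow> (cls f, s)"
    unfolding form_graph_def closure_sequential by blast
  have "\<forall>n. \<exists>\<phi>. \<phi> \<in> test_functions \<and> X n = (cls \<phi>, cls (Lt c \<phi>))"
    using X unfolding test_graph_def by blast
  then obtain \<phi> where t: "\<And>n. \<phi> n \<in> test_functions" and X\<phi>: "X = (\<lambda>n. (cls (\<phi> n), cls (Lt c (\<phi> n))))"
    by metis
  have l1: "(\<lambda>n. cls (\<phi> n)) \<longlonglongrightarrow> cls f" and l2: "(\<lambda>n. cls (Lt c (\<phi> n))) \<longlonglongrightarrow> s"
    using tendsto_fst[OF lim] tendsto_snd[OF lim] by (simp_all add: X\<phi>)
  have "(\<lambda>n. L2_norm halfline (\<lambda>x. \<phi> n x - f x)) \<longlonglongrightarrow> 0"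
    using tendsto_norm_zero[OF LIM_zero[OF l1]]
    by (simp add: norm_cls L2_diff f test_function_L2 t flip: cls_diff)
  moreover have "\<exists>N. \<forall>m\<ge>N. \<forall>n\<ge>N. cmod (L2_inner halfline
      (\<lambda>x. St c (\<phi> m) x - St c (\<phi> n) x) (\<lambda>x. \<phi> m x - \<phi> n x)) < \<epsilon>" if e: "0 < \<epsilon>" for \<epsilon>
  proof -
    obtain N where N: "\<And>m n. m \<ge> N \<Longrightarrow> n \<ge> N \<Longrightarrow> norm (cls (Lt c (\<phi> m)) - cls (Lt c (\<phi> n))) < sqrt \<epsilon>"
      using CauchyD[OF LIMSEQ_imp_Cauchy[OF l2], of "sqrt \<epsilon>"] e by auto
    then have "(norm (cls (Lt c (\<phi> m)) - cls (Lt c (\<phi> n))))\<^sup>2 < \<epsilon>" if "m \<ge> N" "n \<ge> N" for m n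
      using N[OF that] real_sqrt_less_iff[of "(norm (cls (Lt c (\<phi> m)) - cls (Lt c (\<phi> n))))\<^sup>2" \<epsilon>]
      by simp
    then show ?thesis unfolding norm_Lt_diff[OF t t] by blast
  qed
  moreover have "(\<phi> n, St c (\<phi> n)) \<in> min_operator \<nu>" for n
    unfolding min_operator_eq[OF c] using t by blast
  ultimately show "f \<in> form_domain halfline (min_operator \<nu>)"
    unfolding form_domain_def using f by (intro CollectI conjI exI[of _ \<phi>] exI[of _ "\<lambda>n. St c (\<phi> n)"]) auto
qed

text \<open>Green's formula gives <s, L \<phi>> = <f, S \<phi>> for (f, s) in the closed graph, so
  the adjoint relation on test functions is the form relation on test functions, which extends to
  the form domain by continuity. In the converse direction \<phi> and \<i> \<phi> together yield the
  complex identity.\<close>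

lemma H_op_iff:
  assumes c: "c = \<nu> + 1/2" and f: "f \<in> L2 halfline" and g: "g \<in> L2 halfline"
  shows "(f, g) \<in> H_op \<nu> \<longleftrightarrow> (cls f, cls g) \<in> friedrichs c"
proof -
  have "(f, g) \<in> H_op \<nu> \<longleftrightarrow> (\<exists>s. (cls f, s) \<in> form_graph c) \<and>
      (\<forall>\<phi>\<in>test_functions. L2_inner halfline f (St c \<phi>) = L2_inner halfline g \<phi>)"
    unfolding H_op_def friedrichs_extension_def adjoint_graph_def
    using f g form_domain_iff[OF c f] by (auto simp: min_operator_eq[OF c])
  also have "\<dots> \<longleftrightarrow> (cls f, cls g) \<in> friedrichs c"
  proof
    assume *: "(\<exists>s. (cls f, s) \<in> form_graph c) \<and>
      (\<forall>\<phi>\<in>test_functions. L2_inner halfline f (St c \<phi>) = L2_inner halfline g \<phi>)"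
    then obtain s where s: "(cls f, s) \<in> form_graph c" by blast
    have "inner s q = inner (cls g) p" if "(p, q) \<in> form_graph c" for p q
    proof (rule form_graph_induct[OF that])
      fix \<phi> assume t: "\<phi> \<in> test_functions"
      show "inner s (cls (Lt c \<phi>)) = inner (cls g) (cls \<phi>)"
        using form_graph_green[OF s t] * t by (simp add: inner_cls f g test_function_L2)
    qed
    then show "(cls f, cls g) \<in> friedrichs c" unfolding friedrichs_def using s by blast
  next
    assume "(cls f, cls g) \<in> friedrichs c"
    then obtain s where s: "(cls f, s) \<in> form_graph c"
      and sg: "\<And>p q. (p, q) \<in> form_graph c \<Longrightarrow> inner s q = inner (cls g) p"
      unfolding friedrichs_def by blast
    have re: "inner (cls f) (cls (St c \<phi>)) = inner (cls g) (cls \<phi>)" if t: "\<phi> \<in> test_functions" for \<phi>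
    proof -
      have "(cls \<phi>, cls (Lt c \<phi>)) \<in> form_graph c"
        unfolding form_graph_def using closure_subset t by (fastforce simp: test_graph_def)
      then show ?thesis using form_graph_green[OF s t] sg by simp
    qed
    have "L2_inner halfline f (St c \<phi>) = L2_inner halfline g \<phi>" if t: "\<phi> \<in> test_functions" for \<phi>
      using re[OF t] re[OF test_function_scale(1)[OF t], of \<i>]
      by (simp add: L2_inner_eq_inner f g test_function_L2 t Lt_scale cls_cmul)
    then show "(\<exists>s. (cls f, s) \<in> form_graph c) \<and>
      (\<forall>\<phi>\<in>test_functions. L2_inner halfline f (St c \<phi>) = L2_inner halfline g \<phi>)"
      using s by blast
  qed
  finally show ?thesis .
qed

section \<open>Gaussians belong to the operator domain\<close>

definition gauss' :: "real \<Rightarrow> complex \<Rightarrow> real \<Rightarrow> complex" where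
  "gauss' c z x = (of_real (c / x) - z * of_real x) * gauss c z x"

definition gauss'' :: "real \<Rightarrow> complex \<Rightarrow> real \<Rightarrow> complex" where
  "gauss'' c z x = (of_real (- c / x\<^sup>2) - z + (of_real (c / x) - z * of_real x)\<^sup>2) * gauss c z x"

lemma gauss_C2: "C2_on_halfline (gauss c z) (gauss' c z) (gauss'' c z)"
proof -
  have d1: "(gauss c z has_vector_derivative gauss' c z x) (at x)" if x: "0 < x" for x
  proof -
    have "((\<lambda>x. x powr c) has_field_derivative (c / x) * x powr c) (at x)"
      using x by (auto intro!: derivative_eq_intros simp: powr_diff)
    note a = has_vector_derivative_of_real[OF this, unfolded of_real_mult]
    have "((\<lambda>x. x\<^sup>2) has_field_derivative 2 * x) (at x)" by (auto intro!: derivative_eq_intros)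
    then have "((\<lambda>x. (- z / 2) * complex_of_real (x\<^sup>2)) has_vector_derivative (- z / 2) * of_real (2 * x)) (at x)"
      by (intro has_vector_derivative_mult_right has_vector_derivative_of_real)
    then have b: "((\<lambda>x. - z * complex_of_real (x\<^sup>2) / 2) has_vector_derivative - z * of_real x) (at x)"
      by simp
    have "((\<lambda>x. exp (- z * complex_of_real (x\<^sup>2) / 2)) has_vector_derivative
        (- z * of_real x) * exp (- z * complex_of_real (x\<^sup>2) / 2)) (at x)"
      using field_vector_diff_chain_at[OF b DERIV_exp] by (simp add: o_def)
    from has_vector_derivative_mult[OF a this] show ?thesis
      unfolding gauss_def[abs_def] gauss'_def
      by (simp add: gauss_def algebra_simps del: of_real_divide of_real_power of_real_mult)
  qed
  have d2: "(gauss' c z has_vector_derivative gauss'' c z x) (at x)" if x: "0 < x" for x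
  proof -
    have "((\<lambda>x. c / x) has_field_derivative - c / x\<^sup>2) (at x)"
      using x by (auto intro!: derivative_eq_intros simp: power2_eq_square)
    then have 1: "((\<lambda>x. complex_of_real (c / x)) has_vector_derivative of_real (- c / x\<^sup>2)) (at x)"
      by (rule has_vector_derivative_of_real)
    have 2: "((\<lambda>x. z * complex_of_real x) has_vector_derivative z) (at x)"
      using has_vector_derivative_mult_right[OF has_vector_derivative_of_real[OF DERIV_ident]] by simp
    have e: "p * (p * g) + q * g = (q + p\<^sup>2) * g" for p q g :: complex
      by (simp add: power2_eq_square algebra_simps)
    from has_vector_derivative_mult[OF has_vector_derivative_diff[OF 1 2] d1[OF x]] show ?thesis
      unfolding gauss'_def[abs_def] gauss''_def gauss'_def e .
  qed
  have "continuous_on {0<..} (gauss'' c z)"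
    unfolding gauss''_def[abs_def] by (intro continuous_intros continuous_on_gauss) auto
  then show ?thesis using d1 d2 by (simp add: C2_on_halfline_def)
qed

lemma C2_scale:
  assumes "C2_on_halfline u u' u''"
  shows "C2_on_halfline (\<lambda>x. k * u x) (\<lambda>x. k * u' x) (\<lambda>x. k * u'' x)"
  using assms unfolding C2_on_halfline_def
  by (auto intro!: has_vector_derivative_mult_right continuous_intros)

lemma L_op_gauss:
  assumes "0 < x"
  shows "L_op c (\<lambda>x. k * gauss c z x) (\<lambda>x. k * gauss' c z x) x = - z * of_real x * (k * gauss c z x)"
  by (simp add: L_op_def gauss'_def algebra_simps)

lemma S_op_gauss:
  assumes "0 < x"
  shows "S_op c (\<lambda>x. k * gauss c z x) (\<lambda>x. k * gauss'' c z x) x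
    = (z * of_real (1 + 2 * c) - z\<^sup>2 * of_real (x\<^sup>2)) * (k * gauss c z x)"
proof -
  define w where "w = complex_of_real (1 / x)"
  have 1: "complex_of_real (c / x) = of_real c * w" "complex_of_real (- c / x\<^sup>2) = - of_real c * (w * w)"
    "complex_of_real ((c\<^sup>2 - c) * (1 / x\<^sup>2)) = (of_real c * of_real c - of_real c) * (w * w)"
    by (simp_all add: w_def power2_eq_square field_simps)
  have xw: "w * of_real x = 1" using assms by (simp add: w_def)
  have "- (- of_real c * (w * w) - z + (of_real c * w - z * of_real x)\<^sup>2)
      + (of_real c * of_real c - of_real c) * (w * w)
      = z + 2 * of_real c * z * (w * of_real x) - z\<^sup>2 * of_real (x\<^sup>2)"
    by (simp add: power2_eq_square algebra_simps)
  also have "\<dots> = z * of_real (1 + 2 * c) - z\<^sup>2 * of_real (x\<^sup>2)"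
    unfolding xw by (simp add: algebra_simps)
  finally have eq: "- (- of_real c * (w * w) - z + (of_real c * w - z * of_real x)\<^sup>2)
      + (of_real c * of_real c - of_real c) * (w * w) = z * of_real (1 + 2 * c) - z\<^sup>2 * of_real (x\<^sup>2)" .
  show ?thesis
    unfolding S_op_def gauss''_def 1 eq[symmetric] by (simp add: algebra_simps)
qed

text \<open>The cut-off factor contained in \<open>cut_fun\<close>. Its left part depends on x/a, so
  its derivative there is at most 10 a/x^2 with a constant that does not depend on a, see
  \<open>chi_left_bound\<close>.\<close>

definition chi :: "real \<Rightarrow> real \<Rightarrow> real \<Rightarrow> real" where
  "chi a b x = (if x \<in> {a<..<b} then exp (- (a / (x - a)) - 1 / (b - x)) else 0)"

lemma cut_fun_const:
  assumes "0 < a" "0 < x"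
  shows "cut_fun a b c z (\<lambda>_. k) x = of_real (chi a b x) * (k * gauss c z x)"
proof (cases "x \<in> {a<..<b}")
  case True
  have "exp (cut_phase a b c z x)
      = exp (of_real (- (a / (x - a)) - 1 / (b - x)) + of_real (c * ln x) + (- z * of_real (x\<^sup>2) / 2))"
    unfolding cut_phase_def by (simp add: algebra_simps)
  also have "\<dots> = of_real (exp (- (a / (x - a)) - 1 / (b - x))) * of_real (exp (c * ln x)) * exp (- z * of_real (x\<^sup>2) / 2)"
    unfolding exp_add exp_of_real ..
  also have "exp (c * ln x) = x powr c" using assms by (simp add: powr_def)
  finally show ?thesis using True by (simp add: cut_fun_def chi_def gauss_def mult_ac)
qed (auto simp: cut_fun_def chi_def)

text \<open>The Leibniz rule for the cut-off times a Gaussian. The first term is the cut-off of L G;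
  the other two come from differentiating the cut-off at its left and right end and have to
  disappear as a tends to 0 and b to infinity.\<close>

lemma Lt_cut_fun:
  assumes ab: "0 < a" "a < b" and x: "0 < x"
  shows "Lt c (cut_fun a b c z (\<lambda>_. k)) x =
    of_real (chi a b x) * (- z * of_real x * (k * gauss c z x))
    + of_real (chi a b x * (a / (x - a)\<^sup>2)) * (k * gauss c z x)
    - of_real (chi a b x * (1 / (b - x)\<^sup>2)) * (k * gauss c z x)"
proof (cases "x \<in> {a<..<b}")
  case True
  have e: "(A - B - z * y) * (p * g) = p * (- z * y * g) + p * A * g - p * B * g"
    for A B y p g :: complex
    by (simp add: algebra_simps)
  have d0: "((\<lambda>x. exp (cut_phase a b c z x)) has_vector_derivative
      (cut_phase' a b c z x * exp (cut_phase a b c z x))) (at x)"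
    using field_vector_diff_chain_at[OF cut_phase_derivative[OF ab(1) True] DERIV_exp]
    by (simp add: o_def)
  have "((\<lambda>x. k * exp (cut_phase a b c z x)) has_vector_derivative
      k * (cut_phase' a b c z x * exp (cut_phase a b c z x))) (at x)"
    by (intro has_vector_derivative_mult_right d0)
  then have "(cut_fun a b c z (\<lambda>_. k) has_vector_derivative
      k * (cut_phase' a b c z x * exp (cut_phase a b c z x))) (at x)"
    by (rule has_vector_derivative_transform_within_open[of _ _ _ "{a<..<b}"])
       (use True in \<open>auto simp: cut_fun_def\<close>)
  then have "vderiv (cut_fun a b c z (\<lambda>_. k)) x = cut_phase' a b c z x * cut_fun a b c z (\<lambda>_. k) x"
    using True by (simp add: vderiv_def vector_derivative_at cut_fun_def)
  then have "Lt c (cut_fun a b c z (\<lambda>_. k)) x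
      = (cut_phase' a b c z x - of_real (c / x)) * cut_fun a b c z (\<lambda>_. k) x"
    by (simp add: L_op_def algebra_simps)
  also have "cut_phase' a b c z x - of_real (c / x)
      = of_real (a / (x - a)\<^sup>2) - of_real (1 / (b - x)\<^sup>2) - z * of_real x"
    by (simp add: cut_phase'_def power2_eq_square)
  finally show ?thesis
    unfolding cut_fun_const[OF ab(1) x] of_real_mult e .
next
  case False
  obtain r' where r': "\<And>x. (cut_fun a b c z (\<lambda>_. k) has_vector_derivative cut_fun a b c z r' x) (at x)"
    using cut_fun_derivative[OF ab ratfun.const[of k a b], of c z] by blast
  then have "vderiv (cut_fun a b c z (\<lambda>_. k)) x = cut_fun a b c z r' x"
    by (simp add: vderiv_def vector_derivative_at)
  then show ?thesis using False by (auto simp: L_op_def cut_fun_def chi_def)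
qed

lemma L2_multiplier:
  assumes f: "f \<in> L2 halfline" and [measurable]: "m \<in> borel_measurable halfline"
    and "\<And>x. 0 < x \<Longrightarrow> \<bar>m x\<bar> \<le> K"
  shows "(\<lambda>x. of_real (m x) * f x) \<in> L2 halfline"
proof (rule L2_bound[OF f])
  have [measurable]: "f \<in> borel_measurable halfline" using f by (rule L2_measurable)
  show "(\<lambda>x. of_real (m x) * f x) \<in> borel_measurable halfline" by measurable
  show "AE x in halfline. cmod (of_real (m x) * f x) \<le> K * cmod (f x)"
    by (rule halfline_AE_I) (simp add: norm_mult assms(3) mult_right_mono)
qed

lemma L2_multiplier_tendsto_zero:
  assumes f: "f \<in> L2 halfline" and [measurable]: "\<And>n. m n \<in> borel_measurable halfline"
    and bound: "\<And>n x. 0 < x \<Longrightarrow> \<bar>m n x\<bar> \<le> K"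
    and lim: "\<And>x. 0 < x \<Longrightarrow> (\<lambda>n. m n x) \<longlonglongrightarrow> 0"
  shows "(\<lambda>n. cls (\<lambda>x. of_real (m n x) * f x)) \<longlonglongrightarrow> 0"
proof -
  have [measurable]: "f \<in> borel_measurable halfline" using f by (rule L2_measurable)
  have L: "(\<lambda>x. of_real (m n x) * f x) \<in> L2 halfline" for n
    by (rule L2_multiplier[OF f]) (use bound in auto)
  have "(\<lambda>n. LINT x|halfline. (cmod (of_real (m n x) * f x))\<^sup>2) \<longlonglongrightarrow> (LINT x|halfline. 0)"
  proof (rule integral_dominated_convergence[where w = "\<lambda>x. K\<^sup>2 * (cmod (f x))\<^sup>2"])
    show "integrable halfline (\<lambda>x. K\<^sup>2 * (cmod (f x))\<^sup>2)" using L2_integrable[OF f] by simp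
    show "AE x in halfline. (\<lambda>n. (cmod (of_real (m n x) * f x))\<^sup>2) \<longlonglongrightarrow> 0"
    proof (rule halfline_AE_I)
      fix x :: real assume "0 < x"
      then have "(\<lambda>n. of_real (m n x) * f x) \<longlonglongrightarrow> of_real 0 * f x"
        by (intro tendsto_mult tendsto_of_real lim tendsto_const)
      then have "(\<lambda>n. (cmod (of_real (m n x) * f x))\<^sup>2) \<longlonglongrightarrow> (cmod (of_real 0 * f x))\<^sup>2"
        by (intro tendsto_power tendsto_norm)
      then show "(\<lambda>n. (cmod (of_real (m n x) * f x))\<^sup>2) \<longlonglongrightarrow> 0" by simp
    qed
    show "AE x in halfline. norm ((cmod (of_real (m n x) * f x))\<^sup>2) \<le> K\<^sup>2 * (cmod (f x))\<^sup>2" for n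
    proof (rule halfline_AE_I)
      fix x :: real assume "0 < x"
      then have "(\<bar>m n x\<bar> * cmod (f x))\<^sup>2 \<le> (K * cmod (f x))\<^sup>2"
        by (intro power_mono mult_right_mono bound) auto
      then show "norm ((cmod (of_real (m n x) * f x))\<^sup>2) \<le> K\<^sup>2 * (cmod (f x))\<^sup>2"
        by (simp add: norm_mult power_mult_distrib)
    qed
  qed measurable
  then have "(\<lambda>n. (norm (cls (\<lambda>x. of_real (m n x) * f x)))\<^sup>2) \<longlonglongrightarrow> 0"
    by (simp add: norm_cls_power2[OF L])
  from tendsto_real_sqrt[OF this] show ?thesis
    by (simp add: tendsto_norm_zero_iff)
qed

text \<open>The factor sqrt a normalises 1/x on {a..}. These unit vectors are the majorants of the
  left cut-off error in \<open>chi_left_weak_limit\<close>.\<close>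

lemma inverse_tail_L2:
  assumes a: "0 < a"
  defines "v \<equiv> \<lambda>x. complex_of_real (if a \<le> x then sqrt a / x else 0)"
  shows "v \<in> L2 halfline" "norm (cls v) = 1"
proof -
  have "((\<lambda>x. 1 / x ^ 2) has_integral 1 / (real (2 - 1) * a ^ (2 - 1))) {a..}"
    by (rule has_integral_inverse_power_to_inf) (use a in auto)
  then have "((\<lambda>x. a * (1 / x ^ 2)) has_integral a * (1 / a)) {a..}"
    by (intro has_integral_mult_right) simp
  then have hi: "((\<lambda>x. a / x\<^sup>2) has_integral 1) {a..}" using a by simp
  then have ai: "(\<lambda>x. a / x\<^sup>2) absolutely_integrable_on {a..}"
    using a by (intro nonnegative_absolutely_integrable_1) (auto simp: has_integral_integrable)
  have eq: "(cmod (v x))\<^sup>2 = (if a \<le> x then a / x\<^sup>2 else 0)" for x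
    using a by (simp add: v_def norm_divide power_divide)
  have ind: "indicator {0<..} x *\<^sub>R (cmod (v x))\<^sup>2 = indicator {a..} x *\<^sub>R (a / x\<^sup>2)" for x
    unfolding eq using a by (auto simp: indicator_def)
  have i: "integrable halfline (\<lambda>x. (cmod (v x))\<^sup>2)"
    using ai unfolding halfline_integrable ind set_integrable_def .
  have [measurable]: "v \<in> borel_measurable halfline" unfolding v_def by measurable
  show v: "v \<in> L2 halfline" using i by (simp add: L2_def)
  have "(norm (cls v))\<^sup>2 = (LINT x:{a..}|lebesgue. a / x\<^sup>2)"
    unfolding norm_cls_power2[OF v] halfline_integral ind set_lebesgue_integral_def ..
  also have "\<dots> = 1"
    using set_lebesgue_integral_eq_integral(2)[OF ai] integral_unique[OF hi] by simp
  finally show "norm (cls v) = 1" by (simp add: power2_eq_1_iff) (smt (verit) norm_ge_zero)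
qed

lemma chi_nonneg: "0 \<le> chi a b x"
  by (simp add: chi_def)

lemma chi_le_one:
  assumes "0 < a"
  shows "chi a b x \<le> 1"
proof (cases "x \<in> {a<..<b}")
  case True
  then have "0 \<le> a / (x - a)" "0 \<le> 1 / (b - x)" using assms by auto
  then have "- (a / (x - a)) - 1 / (b - x) \<le> 0" by linarith
  then show ?thesis using True by (simp add: chi_def)
qed (auto simp: chi_def)

lemma chi_measurable [measurable]: "chi a b \<in> borel_measurable halfline"
  unfolding chi_def by measurable

text \<open>y^2 exp (- y) \<le> 4 at y = 1/(b - x), by \<open>power_exp_bound\<close> with n =
  2.\<close>

lemma chi_right_bound:
  assumes "0 < a"
  shows "chi a b x * (1 / (b - x)\<^sup>2) \<le> 4"
proof (cases "x \<in> {a<..<b}")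
  case True
  have "chi a b x \<le> exp (- (1 * (1 / (b - x))))"
    using True assms by (simp add: chi_def)
  then have "chi a b x * (1 / (b - x)\<^sup>2) \<le> exp (- (1 * (1 / (b - x)))) * (1 / (b - x)\<^sup>2)"
    by (intro mult_right_mono) auto
  also have "\<dots> = (1 / (b - x)) ^ 2 * exp (- (1 * (1 / (b - x))))" by (simp add: power_divide)
  also have "\<dots> \<le> (real 2 / 1) ^ 2" using True by (intro power_exp_bound) auto
  finally show ?thesis by simp
qed (auto simp: chi_def)

text \<open>With r = a/(x - a) one has x/(x - a) = 1 + r, hence a/(x - a)^2 = (1 + r)^2 a/x^2. The
  constant 10 comes from exp (- r) (1 + r)^2 \<le> 2 exp (- r) + 2 r^2 exp (- r) \<le> 2 + 2 times
  4.\<close>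

lemma chi_left_bound:
  assumes "0 < a" "0 < x"
  shows "chi a b x * (a / (x - a)\<^sup>2) \<le> (if a \<le> x then 10 * (a / x\<^sup>2) else 0)"
proof (cases "x \<in> {a<..<b}")
  case True
  define r where "r = a / (x - a)"
  have r: "0 < r" using True assms by (simp add: r_def)
  have "chi a b x \<le> exp (- r)" using True by (simp add: chi_def r_def)
  then have "chi a b x * (a / (x - a)\<^sup>2) \<le> exp (- r) * (a / (x - a)\<^sup>2)"
    using assms by (intro mult_right_mono) auto
  also have "exp (- r) * (a / (x - a)\<^sup>2) = exp (- r) * ((1 + r)\<^sup>2 * (a / x\<^sup>2))"
  proof -
    have "1 + r = x / (x - a)" using True by (simp add: r_def field_simps)
    then show ?thesis using True assms by (simp add: power_divide)
  qed
  also have "exp (- r) * ((1 + r)\<^sup>2 * (a / x\<^sup>2)) \<le> 10 * (a / x\<^sup>2)"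
  proof -
    have "(1 + r)\<^sup>2 \<le> 2 + 2 * r ^ 2"
      using zero_le_power2[of "1 - r"] by (simp add: power2_sum power2_diff)
    then have "exp (- r) * (1 + r)\<^sup>2 \<le> exp (- r) * (2 + 2 * r ^ 2)" by (intro mult_left_mono) auto
    also have "\<dots> = 2 * exp (- r) + 2 * (r ^ 2 * exp (- (1 * r)))" by (simp add: algebra_simps)
    also have "\<dots> \<le> 2 * 1 + 2 * (real 2 / 1) ^ 2"
      using r by (intro add_mono mult_left_mono power_exp_bound) auto
    finally have "exp (- r) * (1 + r)\<^sup>2 \<le> 10" by simp
    then have "exp (- r) * (1 + r)\<^sup>2 * (a / x\<^sup>2) \<le> 10 * (a / x\<^sup>2)"
      using assms by (intro mult_right_mono) auto
    then show ?thesis by (simp add: mult.assoc)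
  qed
  finally show ?thesis using True by simp
qed (use assms in \<open>auto simp: chi_def\<close>)

text \<open>The condition c \<ge> 1/2 reflects \<nu> \<ge> 0. The rate sqrt x is critical: the norm
  of a/x^2 times sqrt x on {a..} is the same for all a.\<close>

lemma gauss_sqrt_bound:
  assumes "1/2 \<le> c" "0 < Re z"
  obtains K where "0 < K" "\<And>x. 0 < x \<Longrightarrow> cmod (k * gauss c z x) \<le> K * sqrt x"
proof -
  obtain C where C: "0 < C" "\<And>x. 0 < x \<Longrightarrow> x powr (c - 1/2) * exp (- (Re z / 2) * x\<^sup>2) \<le> C * exp (- x)"
    using powr_gaussian_bound[of "Re z / 2" "c - 1/2"] assms by auto
  have "cmod (k * gauss c z x) \<le> ((cmod k + 1) * C) * sqrt x" if x: "0 < x" for x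
  proof -
    have "x powr c = sqrt x * x powr (c - 1/2)"
      using x by (simp add: powr_half_sqrt[symmetric] flip: powr_add)
    then have "cmod (gauss c z x) = sqrt x * (x powr (c - 1/2) * exp (- (Re z / 2) * x\<^sup>2))"
      by (simp add: norm_gauss)
    also have "\<dots> \<le> sqrt x * (C * 1)"
    proof (intro mult_left_mono order_trans[OF C(2)[OF x]])
      show "exp (- x) \<le> 1" using x by simp
    qed (use C x in auto)
    finally have "cmod k * cmod (gauss c z x) \<le> (cmod k + 1) * (sqrt x * (C * 1))"
      using C x by (intro mult_mono) auto
    then show ?thesis by (simp add: norm_mult mult_ac)
  qed
  then show ?thesis using C that[of "(cmod k + 1) * C"] by (simp add: add_nonneg_pos)
qed

lemma cls_cong:
  assumes "f \<in> L2 halfline" "g \<in> borel_measurable halfline" "\<And>x. 0 < x \<Longrightarrow> f x = g x"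
  shows "cls f = cls g" "g \<in> L2 halfline"
proof -
  have ae: "AE x in halfline. f x = g x" using assms(3) by (intro halfline_AE_I)
  show "g \<in> L2 halfline"
    by (rule L2_bound[OF assms(1,2), of 1]) (use assms(3) in \<open>auto intro!: halfline_AE_I\<close>)
  then show "cls f = cls g" using ae cls_eq_iff[OF assms(1)] by simp
qed

text \<open>For \<open>c = 1/2\<close> these functions are bounded in \<open>L\<^sup>2\<close> but do not tend to zero strongly. Weak convergence
  follows from the Cauchy-Schwarz inequality with the weight \<open>a/x\<close> on \<open>{a..}\<close>.\<close>

lemma chi_left_weak_limit:
  assumes c: "1/2 \<le> c" and z: "0 < Re z" and a: "\<And>n. 0 < a n" "a \<longlonglongrightarrow> 0"
    and L: "\<And>n. (\<lambda>x. of_real (chi (a n) (b n) x * (a n / (x - a n)\<^sup>2)) * (k * gauss c z x)) \<in> L2 halfline"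
  shows "(\<lambda>n. inner (cls (\<lambda>x. of_real (chi (a n) (b n) x * (a n / (x - a n)\<^sup>2)) * (k * gauss c z x))) q)
    \<longlonglongrightarrow> 0"
proof -
  define A where "A n x = chi (a n) (b n) x * (a n / (x - a n)\<^sup>2)" for n x
  define G where "G x = k * gauss c z x" for x
  define w where "w n x = (if a n \<le> x then sqrt (a n / x) else 0)" for n x
  define f where "f = rep_hl2 q"
  have f: "f \<in> L2 halfline" "cls f = q" by (simp_all add: f_def)
  have [measurable]: "w n \<in> borel_measurable halfline" for n unfolding w_def by measurable
  have [measurable]: "A n \<in> borel_measurable halfline" for n unfolding A_def by measurable
  have [measurable]: "G \<in> borel_measurable halfline" unfolding G_def by measurable
  have AL: "(\<lambda>x. of_real (A n x) * G x) \<in> L2 halfline" for n using L by (simp add: A_def G_def)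
  have A0: "0 \<le> A n x" for n x using chi_nonneg a(1)[of n] by (simp add: A_def less_imp_le)
  have Ab: "A n x \<le> (if a n \<le> x then 10 * (a n / x\<^sup>2) else 0)" if "0 < x" for n x
    unfolding A_def by (rule chi_left_bound[OF a(1) that])
  have w1: "\<bar>w n x\<bar> \<le> 1" if "0 < x" for n x
    using that a(1)[of n] by (auto simp: w_def)
  have w0: "(\<lambda>n. w n x) \<longlonglongrightarrow> 0" if "0 < x" for x
  proof -
    have "(\<lambda>n. sqrt (a n / x)) \<longlonglongrightarrow> sqrt (0 / x)" using that a(2) by (intro tendsto_intros) auto
    moreover have "\<forall>\<^sub>F n in sequentially. norm (w n x) \<le> sqrt (a n / x)"
      using that a(1) by (auto simp: w_def less_imp_le)
    ultimately show ?thesis using Lim_null_comparison[of "\<lambda>n. w n x" "\<lambda>n. sqrt (a n / x)" sequentially] by simp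
  qed
  have wq: "(\<lambda>n. cls (\<lambda>x. of_real (w n x) * f x)) \<longlonglongrightarrow> 0"
    by (rule L2_multiplier_tendsto_zero[OF f(1), of w 1]) (use w1 w0 in auto)
  have wL: "(\<lambda>x. of_real (w n x) * f x) \<in> L2 halfline" for n
    by (rule L2_multiplier[OF f(1)]) (use w1 in auto)
  obtain K where K: "0 < K" "\<And>x. 0 < x \<Longrightarrow> cmod (G x) \<le> K * sqrt x"
    using gauss_sqrt_bound[OF c z] unfolding G_def by blast
  define v where "v n x = complex_of_real (if a n \<le> x then sqrt (a n) / x else 0)" for n x
  have v: "v n \<in> L2 halfline" "norm (cls (v n)) = 1" for n
    using inverse_tail_L2[OF a(1)] by (simp_all add: v_def[abs_def])
  \<comment> \<open>The weight is moved from the error term to q. The quotient is at most 10 K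
    (a/x^2) sqrt x / sqrt (a/x) = 10 K sqrt a / x, a multiple of the unit vector \<open>v n\<close>,
    while \<open>w n\<close> times q tends to zero by dominated convergence. Where the weight is 0
    the error vanishes too, and division by zero gives the right value 0.\<close>
  define h where "h n x = of_real (A n x / w n x) * G x" for n x
  have hb: "cmod (h n x) \<le> cmod (of_real (10 * K) * v n x)" if x: "0 < x" for n x
  proof (cases "a n \<le> x")
    case True
    have wpos: "0 < w n x" using True x a(1)[of n] by (simp add: w_def)
    have "cmod (h n x) = A n x / w n x * cmod (G x)"
      using A0[of n x] wpos by (simp add: h_def norm_mult norm_divide)
    also have "\<dots> \<le> 10 * (a n / x\<^sup>2) / w n x * (K * sqrt x)"
      using Ab[OF x, of n] A0[of n x] wpos True x a(1)[of n] by (intro mult_mono divide_right_mono K(2)) auto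
    also have "\<dots> = 10 * K * (sqrt (a n) / x)"
    proof -
      have s: "sqrt (a n) * sqrt (a n) = a n" "sqrt x * sqrt x = x" "0 < sqrt (a n)" "0 < sqrt x"
        using a(1)[of n] x by auto
      have "10 * (a n / x\<^sup>2) / w n x * (K * sqrt x)
        = 10 * ((sqrt (a n) * sqrt (a n)) / x\<^sup>2) / (sqrt (a n) / sqrt x) * (K * sqrt x)"
        using True s by (simp add: w_def real_sqrt_divide)
      also have "\<dots> = 10 * K * sqrt (a n) * ((sqrt x * sqrt x) / x\<^sup>2)"
        using s by (simp add: field_simps)
      also have "\<dots> = 10 * K * (sqrt (a n) / x)"
        unfolding s(2) using x by (simp add: power2_eq_square)
      finally show ?thesis .
    qed
    also have "\<dots> = cmod (of_real (10 * K) * v n x)"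
      using True K(1) x a(1)[of n] by (simp add: v_def norm_mult norm_divide)
    finally show ?thesis .
  next
    case False
    then have "A n x = 0" using Ab[OF x, of n] A0[of n x] by simp
    then show ?thesis by (simp add: h_def)
  qed
  have hm: "h n \<in> borel_measurable halfline" for n unfolding h_def by measurable
  have hL: "h n \<in> L2 halfline" for n
    by (rule L2_bound[OF L2_scale[OF v(1)] hm, where C = 1])
       (use hb in \<open>auto intro!: halfline_AE_I\<close>)
  have hn: "norm (cls (h n)) \<le> 10 * K" for n
  proof -
    have "norm (cls (h n)) \<le> norm (cls (\<lambda>x. of_real (10 * K) * v n x))"
      by (rule norm_cls_mono[OF hL L2_scale[OF v(1)]]) (intro halfline_AE_I hb)
    also have "\<dots> = 10 * K"
      unfolding cls_cmul[OF v(1)] norm_cmul norm_of_real v(2) using K(1) by simp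
    finally show ?thesis .
  qed
  have eq: "inner (cls (\<lambda>x. of_real (A n x) * G x)) q = inner (cls (h n)) (cls (\<lambda>x. of_real (w n x) * f x))" for n
  proof -
    have "L2_inner halfline (\<lambda>x. of_real (A n x) * G x) f = L2_inner halfline (h n) (\<lambda>x. of_real (w n x) * f x)"
      unfolding L2_inner_def
    proof (rule Bochner_Integration.integral_cong[OF refl])
      fix x assume "x \<in> space halfline"
      then have x: "0 < x" by (simp add: halfline_def)
      show "of_real (A n x) * G x * cnj (f x) = h n x * cnj (of_real (w n x) * f x)"
      proof (cases "a n \<le> x")
        case True
        then have "w n x \<noteq> 0" using x a(1)[of n] by (simp add: w_def)
        then show ?thesis by (simp add: h_def)
      next
        case False
        then have "A n x = 0" using Ab[OF x, of n] A0[of n x] by simp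
        then show ?thesis by (simp add: h_def)
      qed
    qed
    then show ?thesis using inner_cls[OF AL f(1)] inner_cls[OF hL wL] f(2) by simp
  qed
  have "(\<lambda>n. inner (cls (\<lambda>x. of_real (A n x) * G x)) q) \<longlonglongrightarrow> 0"
  proof (rule Lim_null_comparison[of _ "\<lambda>n. (10 * K) * norm (cls (\<lambda>x. of_real (w n x) * f x))"])
    show "\<forall>\<^sub>F n in sequentially. norm (inner (cls (\<lambda>x. of_real (A n x) * G x)) q)
        \<le> (10 * K) * norm (cls (\<lambda>x. of_real (w n x) * f x))"
      unfolding eq by (intro always_eventually allI order_trans[OF Cauchy_Schwarz_ineq2[unfolded real_norm_def[symmetric]]]
          mult_right_mono hn norm_ge_zero)
    show "(\<lambda>n. (10 * K) * norm (cls (\<lambda>x. of_real (w n x) * f x))) \<longlonglongrightarrow> 0"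
      using tendsto_mult_right_zero[OF tendsto_norm_zero[OF wq]] .
  qed
  then show ?thesis by (simp add: A_def G_def)
qed

text \<open>Testing with y orthogonal to the closed graph reduces the claim to weak convergence of
  the cut-off Gaussians and of their images under L. All terms converge in norm except the left
  cut-off error, which is handled by \<open>chi_left_weak_limit\<close>.\<close>

lemma gauss_form_graph:
  assumes c: "1/2 \<le> c" and z: "0 < Re z"
  shows "(cls (\<lambda>x. k * gauss c z x), cls (\<lambda>x. - z * of_real x * (k * gauss c z x))) \<in> form_graph c"
proof (rule mem_closed_subspace_if_orthogonal[OF form_graph_subspace form_graph_closed])
  fix y assume orth: "\<And>m. m \<in> form_graph c \<Longrightarrow> inner m y = 0"
  obtain p q where y: "y = (p, q)" by (cases y)
  define G where "G x = k * gauss c z x" for x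
  define LG where "LG x = - z * of_real x * G x" for x
  have c0: "0 \<le> c" using c by simp
  have GL: "G \<in> L2 halfline" "LG \<in> L2 halfline"
    using L2_scale[OF gauss_L2[OF z c0, of 0], of k] L2_scale[OF gauss_L2[OF z c0, of 1], of "- z * k"]
    by (simp_all add: G_def[abs_def] LG_def[abs_def] mult_ac)
  \<comment> \<open>The shift by 2 gives a n < 1 < b n also at n = 0, where a shift by 1 would make
    the two endpoints equal.\<close>
  define a where "a n = 1 / (real n + 2)" for n
  define b where "b n = real n + 2" for n
  have a: "0 < a n" "a n < b n" for n
  proof -
    show "0 < a n" by (simp add: a_def)
    have "1 / (real n + 2) \<le> 1" by simp
    then show "a n < b n" unfolding a_def b_def by linarith
  qed
  have a0: "a \<longlonglongrightarrow> 0"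
    unfolding a_def[abs_def] by real_asymp
  have binf: "filterlim b at_top sequentially"
    unfolding b_def[abs_def] by real_asymp
  define X where "X n x = chi (a n) (b n) x" for n x
  define A where "A n x = chi (a n) (b n) x * (a n / (x - a n)\<^sup>2)" for n x
  define B where "B n x = chi (a n) (b n) x * (1 / (b n - x)\<^sup>2)" for n x
  have [measurable]: "X n \<in> borel_measurable halfline" "A n \<in> borel_measurable halfline"
    "B n \<in> borel_measurable halfline" for n
    unfolding X_def A_def B_def by measurable
  have X01: "0 \<le> X n x" "X n x \<le> 1" for n x
    using chi_nonneg chi_le_one[OF a(1)] by (simp_all add: X_def)
  have Bb: "\<bar>B n x\<bar> \<le> 4" for n x
    using chi_right_bound[OF a(1), of n "b n" x] chi_nonneg[of "a n" "b n" x] by (simp add: B_def)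
  have Ab: "\<bar>A n x\<bar> \<le> 10 / a n" if x: "0 < x" for n x
  proof -
    have "0 \<le> A n x" using chi_nonneg a(1)[of n] by (simp add: A_def less_imp_le)
    moreover have "A n x \<le> (if a n \<le> x then 10 * (a n / x\<^sup>2) else 0)"
      unfolding A_def by (rule chi_left_bound[OF a(1) x])
    moreover have "a n / x\<^sup>2 \<le> 1 / a n" if "a n \<le> x"
    proof -
      have "a n * a n \<le> x * x" using that a(1)[of n] by (intro mult_mono) auto
      then show ?thesis using x a(1)[of n] by (simp add: field_simps power2_eq_square)
    qed
    moreover have "0 \<le> 10 / a n" using a(1)[of n] by simp
    ultimately show ?thesis by (auto split: if_splits)
  qed
  have ev: "\<forall>\<^sub>F n in sequentially. x \<in> {a n<..<b n} \<and> b n \<ge> 2 * x" if x: "0 < x" for x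
  proof -
    have "\<forall>\<^sub>F n in sequentially. a n < x" using order_tendstoD(2)[OF a0 x] .
    moreover have "\<forall>\<^sub>F n in sequentially. b n > 2 * x"
      using binf by (simp add: filterlim_at_top_dense)
    ultimately show ?thesis by eventually_elim (use x in auto)
  qed
  have Xlim: "(\<lambda>n. X n x - 1) \<longlonglongrightarrow> 0" if x: "0 < x" for x
  proof -
    have "(\<lambda>n. exp (- (a n / (x - a n)) - 1 / (b n - x)) - 1) \<longlonglongrightarrow> exp (- (0 / (x - 0)) - 0) - 1"
    proof (intro tendsto_intros a0)
      have "filterlim (\<lambda>n. b n - x) at_top sequentially" unfolding b_def by real_asymp
      then show "(\<lambda>n. 1 / (b n - x)) \<longlonglongrightarrow> 0"
        using tendsto_inverse_0_at_top by (simp add: divide_inverse)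
    qed (use x in simp)
    then have "(\<lambda>n. exp (- (a n / (x - a n)) - 1 / (b n - x)) - 1) \<longlonglongrightarrow> 0" by simp
    then show ?thesis
      by (rule Lim_transform_eventually)
         (use ev[OF x] in \<open>eventually_elim, simp add: X_def chi_def\<close>)
  qed
  have Blim: "(\<lambda>n. B n x) \<longlonglongrightarrow> 0" if x: "0 < x" for x
  proof (rule Lim_null_comparison)
    show "(\<lambda>n. 1 / (b n - x)\<^sup>2) \<longlonglongrightarrow> 0" unfolding b_def by real_asymp
    show "\<forall>\<^sub>F n in sequentially. norm (B n x) \<le> 1 / (b n - x)\<^sup>2"
    proof (intro always_eventually allI)
      fix n
      have "\<bar>X n x\<bar> * (1 / (b n - x)\<^sup>2) \<le> 1 * (1 / (b n - x)\<^sup>2)"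
        using X01[of n x] by (intro mult_right_mono) auto
      then show "norm (B n x) \<le> 1 / (b n - x)\<^sup>2" by (simp add: B_def X_def abs_mult)
    qed
  qed
  have XL: "(\<lambda>x. of_real (X n x) * F x) \<in> L2 halfline" "(\<lambda>x. of_real (X n x - 1) * F x) \<in> L2 halfline"
    if "F \<in> L2 halfline" for n F
  proof -
    show "(\<lambda>x. of_real (X n x) * F x) \<in> L2 halfline"
      by (rule L2_multiplier[OF that, of _ 1]) (use X01 in auto)
    show "(\<lambda>x. of_real (X n x - 1) * F x) \<in> L2 halfline"
    proof (rule L2_multiplier[OF that, of _ 1])
      show "\<bar>X n x - 1\<bar> \<le> 1" for x using X01[of n x] by auto
    qed measurable
  qed
  have AL: "(\<lambda>x. of_real (A n x) * G x) \<in> L2 halfline" for n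
    by (rule L2_multiplier[OF GL(1), of _ "10 / a n"]) (use Ab in auto)
  have BL: "(\<lambda>x. of_real (B n x) * G x) \<in> L2 halfline" for n
    by (rule L2_multiplier[OF GL(1), of _ 4]) (use Bb in auto)
  have Xcls: "cls (\<lambda>x. of_real (X n x) * F x) = cls F + cls (\<lambda>x. of_real (X n x - 1) * F x)"
    if "F \<in> L2 halfline" for n F
    using that XL(2)[OF that, of n] by (simp add: algebra_simps flip: cls_add)
  have Xconv: "(\<lambda>n. cls (\<lambda>x. of_real (X n x) * F x)) \<longlonglongrightarrow> cls F" if "F \<in> L2 halfline" for F
  proof -
    have "(\<lambda>n. cls (\<lambda>x. of_real (X n x - 1) * F x)) \<longlonglongrightarrow> 0"
    proof (rule L2_multiplier_tendsto_zero[OF that, of _ 1])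
      show "\<bar>X n x - 1\<bar> \<le> 1" for n x using X01[of n x] by auto
    qed (use Xlim in auto)
    from tendsto_add[OF tendsto_const this, of "cls F"] show ?thesis
      unfolding Xcls[OF that] by simp
  qed
  have Bconv: "(\<lambda>n. cls (\<lambda>x. of_real (B n x) * G x)) \<longlonglongrightarrow> 0"
    by (rule L2_multiplier_tendsto_zero[OF GL(1), of _ 4]) (use Bb Blim in auto)
  have Aconv: "(\<lambda>n. inner (cls (\<lambda>x. of_real (A n x) * G x)) q) \<longlonglongrightarrow> 0"
    using chi_left_weak_limit[OF c z a(1) a0, of b k q] AL unfolding A_def G_def by blast
  define \<phi> where "\<phi> n = cut_fun (a n) (b n) c z (\<lambda>_. k)" for n
  have t: "\<phi> n \<in> test_functions" for n
    unfolding \<phi>_def by (intro cut_fun_test_function a ratfun.const)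
  have e1: "cls (\<phi> n) = cls (\<lambda>x. of_real (X n x) * G x)" for n
    by (rule cls_cong(1)[symmetric, OF XL(1)[OF GL(1)] L2_measurable[OF test_function_L2(1)[OF t]]])
       (simp add: X_def G_def \<phi>_def cut_fun_const a)
  have e2: "cls (Lt c (\<phi> n)) = cls (\<lambda>x. of_real (X n x) * LG x) + cls (\<lambda>x. of_real (A n x) * G x)
      - cls (\<lambda>x. of_real (B n x) * G x)" for n
  proof -
    have "cls (Lt c (\<phi> n)) = cls (\<lambda>x. of_real (X n x) * LG x + of_real (A n x) * G x - of_real (B n x) * G x)"
      by (rule cls_cong(1)[symmetric, OF _ L2_measurable[OF test_function_L2(2)[OF t]]])
         (intro L2_add L2_diff XL GL AL BL,
          simp only: X_def A_def B_def LG_def G_def \<phi>_def Lt_cut_fun[OF a])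
    then show ?thesis by (simp add: cls_add cls_diff L2_add XL GL AL BL)
  qed
  have "(cls (\<phi> n), cls (Lt c (\<phi> n))) \<in> form_graph c" for n
    unfolding form_graph_def test_graph_def by (intro subsetD[OF closure_subset]) (use t in blast)
  from orth[OF this] have "inner (cls (\<phi> n)) p + inner (cls (Lt c (\<phi> n))) q = 0" for n
    by (simp add: y inner_Pair)
  then have z0: "inner (cls (\<lambda>x. of_real (X n x) * G x)) p + (inner (cls (\<lambda>x. of_real (X n x) * LG x)) q
      + inner (cls (\<lambda>x. of_real (A n x) * G x)) q - inner (cls (\<lambda>x. of_real (B n x) * G x)) q) = 0" for n
    unfolding e1 e2 inner_add_left inner_diff_left .
  have "(\<lambda>n. inner (cls (\<lambda>x. of_real (X n x) * G x)) p + (inner (cls (\<lambda>x. of_real (X n x) * LG x)) q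
      + inner (cls (\<lambda>x. of_real (A n x) * G x)) q - inner (cls (\<lambda>x. of_real (B n x) * G x)) q))
      \<longlonglongrightarrow> inner (cls G) p + (inner (cls LG) q + 0 - inner 0 q)"
    by (intro tendsto_intros Xconv GL Aconv Bconv)
  then have "inner (cls G) p + inner (cls LG) q = 0"
    unfolding z0 using LIMSEQ_unique[OF tendsto_const] by fastforce
  then show "inner (cls (\<lambda>x. k * gauss c z x), cls (\<lambda>x. - z * of_real x * (k * gauss c z x))) y = 0"
    by (simp add: y inner_Pair G_def[abs_def] LG_def[abs_def])
qed

lemma inverse_Re_pos: "0 < Re \<zeta> \<Longrightarrow> 0 < Re (1 / \<zeta>)"
  by (auto simp: Re_divide intro!: divide_pos_pos add_pos_nonneg)

text \<open>For (u, s) in the closed graph it remains to compare <s, L \<phi>> with <g, \<phi>> for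
  test functions, where Green's formula applies because \<phi> has compact support.\<close>

lemma cls_scaled_gauss_friedrichs:
  assumes c: "1/2 \<le> c" and z: "0 < Re z"
  shows "(cls (\<lambda>x. k * gauss c z x),
      cls (\<lambda>x. (z * of_real (1 + 2 * c) - z\<^sup>2 * of_real (x\<^sup>2)) * (k * gauss c z x))) \<in> friedrichs c"
proof -
  define u where "u x = k * gauss c z x" for x
  define s where "s x = - z * of_real x * u x" for x
  define g where "g x = (z * of_real (1 + 2 * c) - z\<^sup>2 * of_real (x\<^sup>2)) * u x" for x
  have c0: "0 \<le> c" using c by simp
  have C2: "C2_on_halfline u (\<lambda>x. k * gauss' c z x) (\<lambda>x. k * gauss'' c z x)"
    unfolding u_def[abs_def] by (rule C2_scale[OF gauss_C2])
  have L: "u \<in> L2 halfline" "s \<in> L2 halfline"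
    using L2_scale[OF gauss_L2[OF z c0, of 0], of k] L2_scale[OF gauss_L2[OF z c0, of 1], of "- z * k"]
    by (simp_all add: u_def[abs_def] s_def[abs_def] mult_ac)
  have "(\<lambda>x. (z * of_real (1 + 2 * c) * k) * (of_real (x ^ 0) * gauss c z x)
      - (z\<^sup>2 * k) * (of_real (x ^ 2) * gauss c z x)) \<in> L2 halfline"
    by (intro L2_diff L2_scale gauss_L2 z c0)
  then have gL: "g \<in> L2 halfline" by (simp add: g_def[abs_def] u_def algebra_simps)
  have "(cls u, cls s) \<in> form_graph c"
    using gauss_form_graph[OF c z, of k] by (simp add: u_def[abs_def] s_def[abs_def])
  moreover have "inner (cls s) q = inner (cls g) p" if "(p, q) \<in> form_graph c" for p q
  proof (rule form_graph_induct[OF that])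
    fix \<phi> assume t: "\<phi> \<in> test_functions"
    have "L2_inner halfline s (Lt c \<phi>) = L2_inner halfline (L_op c u (\<lambda>x. k * gauss' c z x)) (Lt c \<phi>)"
      unfolding L2_inner_def u_def[abs_def]
      by (rule Bochner_Integration.integral_cong[OF refl]) (simp add: halfline_def L_op_gauss s_def u_def)
    also have "\<dots> = L2_inner halfline (S_op c u (\<lambda>x. k * gauss'' c z x)) \<phi>"
      by (rule test_function_green(1)[OF t C2])
    also have "\<dots> = L2_inner halfline g \<phi>"
      unfolding L2_inner_def u_def[abs_def]
      by (rule Bochner_Integration.integral_cong[OF refl]) (simp add: halfline_def S_op_gauss g_def u_def)
    finally show "inner (cls s) (cls (Lt c \<phi>)) = inner (cls g) (cls \<phi>)"
      by (simp add: inner_cls L gL test_function_L2 t)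
  qed
  ultimately have "(cls u, cls g) \<in> friedrichs c" unfolding friedrichs_def by blast
  then show ?thesis by (simp add: u_def[abs_def] g_def[abs_def])
qed

text \<open>At z = 1/\<zeta> the quadratic polynomial by which S acts equals -2
  \<open>dgam_factor\<close>; the term z (1 + 2 c) is reproduced by the power - (c + 1/2) of \<zeta>
  in \<open>gam\<close>.\<close>

lemma Gam_friedrichs:
  assumes c: "1/2 \<le> c" and \<zeta>: "0 < Re \<zeta>"
  shows "(cmul a (Gam c \<zeta>), cmul a (- 2 *\<^sub>R dGam c \<zeta>)) \<in> friedrichs c"
proof -
  have c0: "0 \<le> c" using c by simp
  note L = gam_L2[OF \<zeta> c0]
  define k where "k = \<zeta> powr (- of_real (c + 1/2))"
  have nz: "\<zeta> \<noteq> 0" using \<zeta> by auto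
  have 1: "cmul a (Gam c \<zeta>) = cls (\<lambda>x. (a * k) * gauss c (1 / \<zeta>) x)"
    unfolding Gam_def cls_cmul[OF L(1), symmetric] gam_def k_def by (simp add: mult.assoc)
  have f: "(1 / \<zeta>) * of_real (1 + 2 * c) - (1 / \<zeta>)\<^sup>2 * of_real (x\<^sup>2) = - 2 * dgam_factor c \<zeta> x" for x
  proof -
    have "of_real (1 + 2 * c) = 2 * complex_of_real (c + 1/2)" by simp
    then show ?thesis unfolding dgam_factor_def by (simp add: field_simps power_divide del: of_real_add of_real_power)
  qed
  have "cmul a (- 2 *\<^sub>R dGam c \<zeta>) = cmul (a * of_real (- 2)) (cls (dgam c \<zeta>))"
    unfolding dGam_def cmul_cmul[symmetric] cmul_of_real ..
  also have "\<dots> = cls (\<lambda>x. (a * of_real (- 2)) * dgam c \<zeta> x)"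
    by (rule cls_cmul[OF L(2), symmetric])
  also have "(\<lambda>x. (a * of_real (- 2)) * dgam c \<zeta> x)
      = (\<lambda>x. ((1 / \<zeta>) * of_real (1 + 2 * c) - (1 / \<zeta>)\<^sup>2 * of_real (x\<^sup>2)) * ((a * k) * gauss c (1 / \<zeta>) x))"
    unfolding f dgam_def gam_def k_def[symmetric] by (simp add: mult_ac)
  finally have 2: "cmul a (- 2 *\<^sub>R dGam c \<zeta>)
      = cls (\<lambda>x. ((1 / \<zeta>) * of_real (1 + 2 * c) - (1 / \<zeta>)\<^sup>2 * of_real (x\<^sup>2)) * ((a * k) * gauss c (1 / \<zeta>) x))" .
  show ?thesis unfolding 1 2 by (rule cls_scaled_gauss_friedrichs[OF c inverse_Re_pos[OF \<zeta>]])
qed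

section \<open>Symmetry, closedness and the Gaussian core\<close>

lemma friedE:
  assumes "(u, g) \<in> friedrichs c"
  obtains s where "(u, s) \<in> form_graph c" "\<And>p q. (p, q) \<in> form_graph c \<Longrightarrow> inner s q = inner g p"
  using assms unfolding friedrichs_def by blast

lemma friedI:
  "(u, s) \<in> form_graph c \<Longrightarrow> (\<And>p q. (p, q) \<in> form_graph c \<Longrightarrow> inner s q = inner g p) \<Longrightarrow> (u, g) \<in> friedrichs c"
  unfolding friedrichs_def by blast

lemma friedrichs_symmetric:
  assumes "(u, g) \<in> friedrichs c" "(v, h) \<in> friedrichs c"
  shows "inner g v = inner u h"
proof -
  obtain s where s: "(u, s) \<in> form_graph c" "\<And>p q. (p, q) \<in> form_graph c \<Longrightarrow> inner s q = inner g p"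
    using friedE[OF assms(1)] by blast
  obtain r where r: "(v, r) \<in> form_graph c" "\<And>p q. (p, q) \<in> form_graph c \<Longrightarrow> inner r q = inner h p"
    using friedE[OF assms(2)] by blast
  show ?thesis using s(2)[OF r(1)] r(2)[OF s(1)] by (simp add: inner_commute)
qed

lemma friedrichs_nonneg:
  assumes "(u, g) \<in> friedrichs c"
  shows "0 \<le> inner g u"
proof -
  obtain s where s: "(u, s) \<in> form_graph c" "\<And>p q. (p, q) \<in> form_graph c \<Longrightarrow> inner s q = inner g p"
    using friedE[OF assms] by blast
  show ?thesis using s(2)[OF s(1)] inner_ge_zero[of s] by simp
qed

lemma friedrichs_subspace: "subspace (friedrichs c)"
proof (rule subspaceI)
  have "(0, 0) \<in> form_graph c" using subspace_0[OF form_graph_subspace] by (simp add: zero_prod_def)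
  then show "0 \<in> friedrichs c" unfolding zero_prod_def by (rule friedI) simp
next
  fix x y assume x: "x \<in> friedrichs c" and y: "y \<in> friedrichs c"
  obtain u g v h where xy: "x = (u, g)" "y = (v, h)" by (cases x, cases y)
  obtain s where s: "(u, s) \<in> form_graph c" "\<And>p q. (p, q) \<in> form_graph c \<Longrightarrow> inner s q = inner g p"
    using friedE x unfolding xy by blast
  obtain r where r: "(v, r) \<in> form_graph c" "\<And>p q. (p, q) \<in> form_graph c \<Longrightarrow> inner r q = inner h p"
    using friedE y unfolding xy by blast
  have "(u + v, s + r) \<in> form_graph c"
    using subspace_add[OF form_graph_subspace s(1) r(1)] by simp
  then show "x + y \<in> friedrichs c"
    unfolding xy add_Pair by (rule friedI) (simp add: inner_add_left s r)
next
  fix k and x assume x: "x \<in> friedrichs c"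
  obtain u g where xu: "x = (u, g)" by (cases x)
  obtain s where s: "(u, s) \<in> form_graph c" "\<And>p q. (p, q) \<in> form_graph c \<Longrightarrow> inner s q = inner g p"
    using friedE x unfolding xu by blast
  have "(k *\<^sub>R u, k *\<^sub>R s) \<in> form_graph c"
    using subspace_scale[OF form_graph_subspace s(1), of k] by simp
  then show "k *\<^sub>R x \<in> friedrichs c"
    unfolding xu scaleR_Pair by (rule friedI) (simp add: s)
qed

text \<open>Positivity bounds H + 1 from below by 1, so convergence of (H + 1) u_n forces
  convergence of u_n.\<close>

lemma friedrichs_norm_le:
  assumes "(u, g) \<in> friedrichs c"
  shows "norm u \<le> norm (u + g)"
proof (cases "u = 0")
  case False
  have "norm u * norm u \<le> inner (u + g) u"
    using friedrichs_nonneg[OF assms] by (simp add: inner_add_left power2_eq_square flip: power2_norm_eq_inner)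
  also have "\<dots> \<le> norm (u + g) * norm u" by (rule norm_cauchy_schwarz)
  finally show ?thesis using False by simp
qed simp

text \<open>The form components s_n converge as well: the squared norm of s_m - s_n is the inner
  product of g_m - g_n with u_m - u_n.\<close>

lemma friedrichs_closed: "closed (friedrichs c)"
proof (rule closed_sequential_limits[THEN iffD2], intro allI impI, elim conjE)
  fix X and l assume X: "\<forall>n. X n \<in> friedrichs c" and lim: "X \<longlonglongrightarrow> l"
  obtain u g where l: "l = (u, g)" by (cases l)
  have lu: "(\<lambda>n. fst (X n)) \<longlonglongrightarrow> u" and lg: "(\<lambda>n. snd (X n)) \<longlonglongrightarrow> g"
    using tendsto_fst[OF lim] tendsto_snd[OF lim] by (simp_all add: l)
  have "\<forall>n. \<exists>s. (fst (X n), s) \<in> form_graph c \<and>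
      (\<forall>p q. (p, q) \<in> form_graph c \<longrightarrow> inner s q = inner (snd (X n)) p)"
    using X friedE by (metis prod.collapse)
  then obtain s where s: "\<And>n. (fst (X n), s n) \<in> form_graph c"
    "\<And>n p q. (p, q) \<in> form_graph c \<Longrightarrow> inner (s n) q = inner (snd (X n)) p" by metis
  have nsq: "(norm (s m - s n))\<^sup>2 \<le> norm (snd (X m) - snd (X n)) * norm (fst (X m) - fst (X n))" for m n
  proof -
    have "(fst (X m) - fst (X n), s m - s n) \<in> form_graph c"
      using subspace_diff[OF form_graph_subspace s(1) s(1)] by simp
    then have "inner (s m - s n) (s m - s n) = inner (snd (X m) - snd (X n)) (fst (X m) - fst (X n))"
      using s(2) by (simp add: inner_diff_left)
    then show ?thesis unfolding power2_norm_eq_inner using norm_cauchy_schwarz by metis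
  qed
  have "Cauchy s"
  proof (rule CauchyI)
    fix e :: real assume e: "0 < e"
    obtain M where M: "\<And>m n. m \<ge> M \<Longrightarrow> n \<ge> M \<Longrightarrow> norm (fst (X m) - fst (X n)) < e"
      using CauchyD[OF LIMSEQ_imp_Cauchy[OF lu] e] by blast
    obtain N where N: "\<And>m n. m \<ge> N \<Longrightarrow> n \<ge> N \<Longrightarrow> norm (snd (X m) - snd (X n)) < e"
      using CauchyD[OF LIMSEQ_imp_Cauchy[OF lg] e] by blast
    have "norm (s m - s n) < e" if "m \<ge> max M N" "n \<ge> max M N" for m n
    proof -
      have "(norm (s m - s n))\<^sup>2 < e * e"
        using nsq[of m n] M[of m n] N[of m n] that
        by (auto intro!: le_less_trans[OF nsq] mult_strict_mono')
      then show ?thesis using e by (metis less_imp_le power2_eq_square power2_less_imp_less)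
    qed
    then show "\<exists>M. \<forall>m\<ge>M. \<forall>n\<ge>M. norm (s m - s n) < e" by blast
  qed
  then obtain r where r: "s \<longlonglongrightarrow> r" using Cauchy_convergent_iff convergent_def by blast
  have "(\<lambda>n. (fst (X n), s n)) \<longlonglongrightarrow> (u, r)" using lu r by (rule tendsto_Pair)
  then have "(u, r) \<in> form_graph c" by (rule closed_sequentially[OF form_graph_closed s(1)])
  moreover have "inner r q = inner g p" if "(p, q) \<in> form_graph c" for p q
  proof -
    have "(\<lambda>n. inner (s n) q) \<longlonglongrightarrow> inner r q" using r by (intro tendsto_intros)
    moreover have "(\<lambda>n. inner (s n) q) \<longlonglongrightarrow> inner g p"
      unfolding s(2)[OF that] using lg by (intro tendsto_intros)
    ultimately show ?thesis by (rule LIMSEQ_unique)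
  qed
  ultimately show "l \<in> friedrichs c" unfolding l by (rule friedI)
qed

definition Hgam :: "real \<Rightarrow> complex \<Rightarrow> hl2" where "Hgam c \<zeta> = - 2 *\<^sub>R dGam c \<zeta>"

text \<open>\<open>span\<close> is the real span, so the complex scalars are put into the
  generators.\<close>

definition core_gens :: "real \<Rightarrow> (hl2 \<times> hl2) set" where
  "core_gens c = {(cmul a (Gam c \<zeta>), cmul a (Hgam c \<zeta>)) | a \<zeta>. 0 < Re \<zeta>}"

lemma core_gens_friedrichs:
  assumes "1/2 \<le> c"
  shows "span (core_gens c) \<subseteq> friedrichs c"
proof (rule span_minimal[OF _ friedrichs_subspace])
  show "core_gens c \<subseteq> friedrichs c"
    unfolding core_gens_def Hgam_def using Gam_friedrichs[OF assms] by blast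
qed

lemma Gam_vector_derivative:
  assumes "0 < Re (\<zeta> + of_real s * d)" "0 \<le> c"
  shows "((\<lambda>s. cmul a (Gam c (\<zeta> + of_real s * d))) has_vector_derivative
    cmul (- d / 2) (cmul a (Hgam c (\<zeta> + of_real s * d)))) (at s)"
proof -
  have "cmul (- d / 2) (cmul a (Hgam c \<omega>)) = cmul a (cmul d (dGam c \<omega>))" for \<omega>
  proof -
    have "Hgam c \<omega> = cmul (of_real (- 2)) (dGam c \<omega>)" unfolding Hgam_def cmul_of_real ..
    then show ?thesis by (simp add: mult_ac)
  qed
  then show ?thesis
    using bounded_linear.has_vector_derivative[OF bounded_linear_cmul Gam_has_vector_derivative[OF assms], of a]
    by simp
qed

text \<open>The translation by s is exp (- s H / 2) on the Gaussians, and the squared norm has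
  derivative - <H G, G> \<le> 0.\<close>

lemma heat_norm_le:
  assumes c: "1/2 \<le> c" and \<zeta>: "0 < Re \<zeta>" and s: "0 \<le> s"
  shows "norm (Gam c (\<zeta> + of_real s)) \<le> norm (Gam c \<zeta>)"
proof -
  define n where "n s = inner (Gam c (\<zeta> + of_real s)) (Gam c (\<zeta> + of_real s))" for s
  have c0: "0 \<le> c" using c by simp
  have d: "(n has_real_derivative - inner (Hgam c (\<zeta> + of_real s)) (Gam c (\<zeta> + of_real s))) (at s)"
    if "0 \<le> s" for s
  proof -
    have "((\<lambda>s. Gam c (\<zeta> + of_real s)) has_vector_derivative
        cmul (- 1 / 2) (Hgam c (\<zeta> + of_real s))) (at s)"
      using Gam_vector_derivative[of \<zeta> s 1 c 1] \<zeta> that c0 by simp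
    moreover have "cmul (- 1 / 2) x = (- 1/2) *\<^sub>R x" for x
      using cmul_of_real[of "-1/2" x] by simp
    ultimately have "((\<lambda>s. Gam c (\<zeta> + of_real s)) has_vector_derivative
        (- 1/2) *\<^sub>R (Hgam c (\<zeta> + of_real s))) (at s)" by simp
    from bounded_bilinear.has_vector_derivative[OF bounded_bilinear_inner this this]
    show ?thesis
      unfolding n_def has_real_derivative_iff_has_vector_derivative
      by (simp add: inner_commute)
  qed
  have "n s \<le> n 0"
  proof (rule DERIV_nonpos_imp_nonincreasing[OF s])
    fix t assume t: "0 \<le> t" "t \<le> s"
    have "(Gam c (\<zeta> + of_real t), Hgam c (\<zeta> + of_real t)) \<in> friedrichs c"
      using Gam_friedrichs[OF c, of "\<zeta> + of_real t" 1] \<zeta> t by (simp add: Hgam_def)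
    then have "- inner (Hgam c (\<zeta> + of_real t)) (Gam c (\<zeta> + of_real t)) \<le> 0"
      using friedrichs_nonneg by fastforce
    then show "\<exists>y. (n has_real_derivative y) (at t) \<and> y \<le> 0" using d t by blast
  qed
  then show ?thesis by (simp add: n_def norm_eq_sqrt_inner)
qed

text \<open>If \<open>y\<close> is orthogonal to \<open>(H + 1) G\<^sub>\<zeta>\<close> for all \<open>\<zeta>\<close>, then \<open>m(s) = \<langle>exp (- s H) G\<^sub>\<zeta>, y\<rangle>\<close> satisfies \<open>m' = m\<close>, but
  it is bounded.\<close>

lemma range_H_plus_one_dense:
  assumes c: "1/2 \<le> c"
    and y: "\<And>a \<zeta>. 0 < Re \<zeta> \<Longrightarrow> inner (cmul a (Gam c \<zeta>) + cmul a (Hgam c \<zeta>)) y = 0"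
  shows "y = 0"
proof (rule Gam_orthogonal_zero[of c])
  show c0: "0 \<le> c" using c by simp
  fix \<zeta> a assume \<zeta>: "0 < Re \<zeta>"
  define m where "m s = inner (cmul a (Gam c (\<zeta> + of_real s * 2))) y" for s
  have Re: "0 < Re (\<zeta> + of_real s * 2)" if "0 \<le> s" for s using \<zeta> that by simp
  have d: "((\<lambda>s. exp (- s) * m s) has_real_derivative 0) (at s)" if "0 \<le> s" for s
  proof -
    have "((\<lambda>s. cmul a (Gam c (\<zeta> + of_real s * 2))) has_vector_derivative
      - cmul a (Hgam c (\<zeta> + of_real s * 2))) (at s)"
      using Gam_vector_derivative[OF Re[OF that] c0, of a] cmul_minus_left[of a] by simp
    then have "(m has_vector_derivative inner (- cmul a (Hgam c (\<zeta> + of_real s * 2))) y) (at s)"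
      unfolding m_def by (rule bounded_linear.has_vector_derivative[OF bounded_linear_inner_left])
    moreover have "inner (- cmul a (Hgam c (\<zeta> + of_real s * 2))) y = m s"
      using y[OF Re[OF that], of a] by (simp add: m_def inner_add_left)
    ultimately have "(m has_real_derivative m s) (at s)"
      by (simp add: has_real_derivative_iff_has_vector_derivative)
    then show ?thesis by (auto intro!: derivative_eq_intros)
  qed
  have const: "exp (- s) * m s = m 0" if s: "0 \<le> s" for s
  proof (cases "s = 0")
    case False
    then have "0 < s" using s by simp
    have "exp (- s) * m s = exp (- 0) * m 0"
      by (rule DERIV_isconst2[OF \<open>0 < s\<close>, where f = "\<lambda>s. exp (- s) * m s"])
         (use d s in \<open>auto intro!: DERIV_isCont continuous_at_imp_continuous_on\<close>)
    then show ?thesis by simp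
  qed simp
  define B where "B = cmod a * norm (Gam c \<zeta>) * norm y"
  have bound: "\<bar>m s\<bar> \<le> B" if s: "0 \<le> s" for s
  proof -
    have "norm (Gam c (\<zeta> + of_real s * 2)) \<le> norm (Gam c \<zeta>)"
      using heat_norm_le[OF c \<zeta>, of "2 * s"] s by (simp add: mult.commute)
    then have "norm (cmul a (Gam c (\<zeta> + of_real s * 2))) * norm y \<le> B"
      unfolding B_def norm_cmul by (intro mult_right_mono mult_left_mono) auto
    then show ?thesis unfolding m_def using Cauchy_Schwarz_ineq2 order_trans by blast
  qed
  have "((\<lambda>s. exp (- s) * m s) \<longlongrightarrow> 0) at_top"
  proof (rule Lim_null_comparison)
    show "\<forall>\<^sub>F s in at_top. norm (exp (- s) * m s) \<le> exp (- s) * B"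
      using eventually_ge_at_top[of 0] by eventually_elim (simp add: abs_mult bound)
    show "((\<lambda>s::real. exp (- s) * B) \<longlongrightarrow> 0) at_top" by real_asymp
  qed
  moreover have "\<forall>\<^sub>F s in at_top. exp (- s) * m s = m 0"
    using eventually_ge_at_top[of 0] by eventually_elim (rule const)
  ultimately have "((\<lambda>s::real. m 0) \<longlongrightarrow> 0) at_top"
    by (rule Lim_transform_eventually)
  then have "m 0 = 0" by (simp add: tendsto_const_iff)
  then show "inner (cmul a (Gam c \<zeta>)) y = 0" by (simp add: m_def)
qed

lemma core_plus_approx:
  assumes c: "1/2 \<le> c"
  obtains d where "\<And>n. d n \<in> span (core_gens c)" "(\<lambda>n. fst (d n) + snd (d n)) \<longlonglongrightarrow> f"
proof -
  define R where "R = (\<lambda>d. fst d + snd d) ` span (core_gens c)"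
  have "linear (\<lambda>d::hl2 \<times> hl2. fst d + snd d)"
    by (intro linearI) (auto simp: scaleR_add_right)
  then have R: "subspace R" unfolding R_def by (intro linear_subspace_image subspace_span)
  have "f \<in> closure R"
  proof (rule mem_closed_subspace_if_orthogonal)
    show "subspace (closure R)" "closed (closure R)" using R by (simp_all add: subspace_closure_real_normed)
    fix y assume y: "\<And>m. m \<in> closure R \<Longrightarrow> inner m y = 0"
    have "y = 0"
    proof (rule range_H_plus_one_dense[OF c])
      fix a \<zeta> assume "0 < Re \<zeta>"
      then have "(cmul a (Gam c \<zeta>), cmul a (Hgam c \<zeta>)) \<in> span (core_gens c)"
        by (intro span_base) (auto simp: core_gens_def)
      then have "cmul a (Gam c \<zeta>) + cmul a (Hgam c \<zeta>) \<in> R" unfolding R_def by force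
      then show "inner (cmul a (Gam c \<zeta>) + cmul a (Hgam c \<zeta>)) y = 0"
        using y closure_subset by blast
    qed
    then show "inner f y = 0" by simp
  qed
  then obtain X where X: "\<And>n. X n \<in> R" "X \<longlonglongrightarrow> f" unfolding closure_sequential by blast
  then have "\<forall>n. \<exists>d. d \<in> span (core_gens c) \<and> X n = fst d + snd d" unfolding R_def by blast
  then obtain d where "\<And>n. d n \<in> span (core_gens c)" "\<And>n. X n = fst (d n) + snd (d n)" by metis
  then show ?thesis using that[of d] X(2) by presburger
qed

text \<open>u + g is approximated by (H + 1) d_n with d_n in the span, and the lower bound of H + 1
  turns this into convergence of both components.\<close>

lemma friedrichs_core:
  assumes c: "1/2 \<le> c" and ug: "(u, g) \<in> friedrichs c"
  obtains d where "\<And>n. d n \<in> span (core_gens c)" "d \<longlonglongrightarrow> (u, g)"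
proof -
  obtain d where d: "\<And>n. d n \<in> span (core_gens c)" "(\<lambda>n. fst (d n) + snd (d n)) \<longlonglongrightarrow> u + g"
    using core_plus_approx[OF c, of "u + g"] by blast
  have "norm (fst (d n) - u) \<le> norm (fst (d n) + snd (d n) - (u + g))" for n
  proof -
    have "d n - (u, g) \<in> friedrichs c"
      using subspace_diff[OF friedrichs_subspace _ ug] core_gens_friedrichs[OF c] d(1) by blast
    then have "(fst (d n) - u, snd (d n) - g) \<in> friedrichs c" by (metis diff_Pair prod.collapse)
    from friedrichs_norm_le[OF this] show ?thesis by (simp add: algebra_simps)
  qed
  moreover have "(\<lambda>n. norm (fst (d n) + snd (d n) - (u + g))) \<longlonglongrightarrow> 0"
    using d(2) by (intro tendsto_norm_zero LIM_zero)
  ultimately have "(\<lambda>n. fst (d n) - u) \<longlonglongrightarrow> 0"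
    by (intro Lim_null_comparison[of "\<lambda>n. fst (d n) - u"]) (auto intro: always_eventually)
  then have 1: "(\<lambda>n. fst (d n)) \<longlonglongrightarrow> u" by (simp add: LIM_zero_iff)
  from tendsto_diff[OF d(2) this] have 2: "(\<lambda>n. snd (d n)) \<longlonglongrightarrow> g" by simp
  have "d \<longlonglongrightarrow> (u, g)" using tendsto_Pair[OF 1 2] by simp
  with d(1) show ?thesis using that by blast
qed

text \<open>Essential self-adjointness on the span of the Gaussians. Approximating f + g by the
  range of H + 1 on the core and using closedness gives w with (H + 1) w = f + g; then f - w is
  orthogonal to the dense range of H + 1 on the core, so f = w.\<close>

lemma friedrichs_of_core:
  assumes c: "1/2 \<le> c" and f: "\<And>p. p \<in> core_gens c \<Longrightarrow> inner f (snd p) = inner g (fst p)"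
  shows "(f, g) \<in> friedrichs c"
proof -
  have fs: "inner f (snd p) = inner g (fst p)" if "p \<in> span (core_gens c)" for p
    using that
  proof (induction rule: span_induct_alt)
    case (step k x y)
    then show ?case using f by (simp add: inner_add_right)
  qed simp
  obtain d where d: "\<And>n. d n \<in> span (core_gens c)" "(\<lambda>n. fst (d n) + snd (d n)) \<longlonglongrightarrow> f + g"
    using core_plus_approx[OF c, of "f + g"] by blast
  have "norm (fst (d m) - fst (d n)) \<le> norm ((fst (d m) + snd (d m)) - (fst (d n) + snd (d n)))" for m n
  proof -
    have "d m - d n \<in> friedrichs c"
      using subspace_diff[OF friedrichs_subspace] core_gens_friedrichs[OF c] d(1) by blast
    then have "(fst (d m) - fst (d n), snd (d m) - snd (d n)) \<in> friedrichs c" by (metis diff_Pair prod.collapse)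
    from friedrichs_norm_le[OF this] show ?thesis by (simp add: algebra_simps)
  qed
  then have "Cauchy (\<lambda>n. fst (d n))"
    using LIMSEQ_imp_Cauchy[OF d(2)] unfolding Cauchy_iff by (meson order_le_less_trans)
  then obtain w where w: "(\<lambda>n. fst (d n)) \<longlonglongrightarrow> w" using Cauchy_convergent_iff convergent_def by blast
  from tendsto_diff[OF d(2) this] have 2: "(\<lambda>n. snd (d n)) \<longlonglongrightarrow> f + g - w" by simp
  have "(\<lambda>n. (fst (d n), snd (d n))) \<longlonglongrightarrow> (w, f + g - w)" using w 2 by (rule tendsto_Pair)
  moreover have "(fst (d n), snd (d n)) \<in> friedrichs c" for n using d(1) core_gens_friedrichs[OF c] by auto
  ultimately have wf: "(w, f + g - w) \<in> friedrichs c" by (rule closed_sequentially[OF friedrichs_closed, rotated])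
  have "f - w = 0"
  proof (rule range_H_plus_one_dense[OF c])
    fix a \<zeta> assume "0 < Re \<zeta>"
    then have p: "(cmul a (Gam c \<zeta>), cmul a (Hgam c \<zeta>)) \<in> span (core_gens c)"
      by (intro span_base) (auto simp: core_gens_def)
    have "inner f (cmul a (Hgam c \<zeta>)) = inner g (cmul a (Gam c \<zeta>))" using fs[OF p] by simp
    moreover have "inner (f + g - w) (cmul a (Gam c \<zeta>)) = inner w (cmul a (Hgam c \<zeta>))"
      using friedrichs_symmetric[OF wf] core_gens_friedrichs[OF c] p by blast
    ultimately show "inner (cmul a (Gam c \<zeta>) + cmul a (Hgam c \<zeta>)) (f - w) = 0"
      by (simp add: inner_simps inner_commute)
  qed
  then show ?thesis using wf by simp
qed

section \<open>The unitary group\<close>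

text \<open>The closure of the span of S is the graph of the extension. Preservation of inner
  products passes to the span by bilinearity, preservation of norms to the closure by continuity,
  and this makes the graph single-valued; its domain is everything by density and
  completeness.\<close>

lemma isometry_extension:
  fixes S :: "('a::{real_inner, complete_space} \<times> 'a) set"
  assumes iso: "\<And>p q. p \<in> S \<Longrightarrow> q \<in> S \<Longrightarrow> inner (fst p) (fst q) = inner (snd p) (snd q)"
    and dense: "\<And>y. (\<And>p. p \<in> S \<Longrightarrow> inner (fst p) y = 0) \<Longrightarrow> y = 0"
  obtains V where "linear V" "\<And>x. norm (V x) = norm x" "\<And>p. p \<in> S \<Longrightarrow> V (fst p) = snd p"
proof -
  define N where "N = closure (span S)"
  have N: "subspace N" "closed N" unfolding N_def by (simp_all add: subspace_closure_real_normed)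
  have iso1: "inner (fst p) (fst q) = inner (snd p) (snd q)" if "p \<in> span S" "q \<in> S" for p q
    using that(1)
  proof (induction rule: span_induct_alt)
    case (step k x y)
    then show ?case using iso[OF _ that(2)] by (simp add: inner_add_left)
  qed simp
  have iso2: "inner (fst p) (fst q) = inner (snd p) (snd q)" if "p \<in> span S" "q \<in> span S" for p q
    using that(2)
  proof (induction rule: span_induct_alt)
    case (step k x y)
    then show ?case using iso1[OF that(1)] by (simp add: inner_add_right)
  qed simp
  have nspan: "norm (fst p) = norm (snd p)" if "p \<in> span S" for p
    using iso2[OF that that] by (simp add: norm_eq_sqrt_inner)
  have nN: "norm (fst p) = norm (snd p)" if "p \<in> N" for p
  proof -
    have "N \<subseteq> {p. norm (fst p) = norm (snd p)}"
      unfolding N_def by (rule closure_minimal) (use nspan in \<open>auto intro!: closed_Collect_eq continuous_intros\<close>)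
    then show ?thesis using that by blast
  qed
  have ex: "\<exists>g. (f, g) \<in> N" for f
  proof -
    have sub: "subspace (fst ` span S)"
      by (intro linear_subspace_image subspace_span linear_fst)
    have "f \<in> closure (fst ` span S)"
    proof (rule mem_closed_subspace_if_orthogonal)
      show "subspace (closure (fst ` span S))" using sub by (rule subspace_closure_real_normed)
      fix y assume y: "\<And>m. m \<in> closure (fst ` span S) \<Longrightarrow> inner m y = 0"
      have "y = 0"
      proof (rule dense)
        fix p assume "p \<in> S"
        then have "fst p \<in> closure (fst ` span S)"
          using closure_subset[of "fst ` span S"] span_base[of p S] by blast
        then show "inner (fst p) y = 0" by (rule y)
      qed
      then show "inner f y = 0" by simp
    qed simp
    then obtain X where X: "\<And>n. X n \<in> fst ` span S" "X \<longlonglongrightarrow> f" unfolding closure_sequential by blast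
    then have "\<forall>n. \<exists>p. p \<in> span S \<and> X n = fst p" by blast
    then obtain P where P: "\<And>n. P n \<in> span S" "\<And>n. X n = fst (P n)" by metis
    have eq: "norm (snd (P m) - snd (P n)) = norm (X m - X n)" for m n
      using nspan[OF span_diff[OF P(1) P(1)], of m n] by (simp add: P(2))
    have "Cauchy (\<lambda>n. snd (P n))"
      using LIMSEQ_imp_Cauchy[OF X(2)] unfolding Cauchy_iff eq .
    then obtain g where g: "(\<lambda>n. snd (P n)) \<longlonglongrightarrow> g" using Cauchy_convergent_iff convergent_def by blast
    have "(\<lambda>n. (fst (P n), snd (P n))) \<longlonglongrightarrow> (f, g)"
      using X(2) g unfolding P(2) by (rule tendsto_Pair)
    moreover have "(fst (P n), snd (P n)) \<in> span S" for n using P(1) by simp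
    ultimately have "(f, g) \<in> N"
      unfolding N_def closure_sequential by (intro exI[of _ "\<lambda>n. (fst (P n), snd (P n))"]) auto
    then show ?thesis ..
  qed
  then obtain V where V: "\<And>f. (f, V f) \<in> N" by metis
  have uniq: "g = V f" if "(f, g) \<in> N" for f g
  proof -
    have "(f, g) - (f, V f) \<in> N" by (rule subspace_diff[OF N(1) that V])
    from nN[OF this] show ?thesis by simp
  qed
  show ?thesis
  proof
    show "linear V"
    proof (rule linearI)
      show "V (x + y) = V x + V y" for x y
        using subspace_add[OF N(1) V V, of x y] by (auto intro: uniq[symmetric])
      show "V (k *\<^sub>R x) = k *\<^sub>R V x" for k x
        using subspace_scale[OF N(1) V, of k x] by (auto intro: uniq[symmetric])
    qed
    show "norm (V x) = norm x" for x using nN[OF V, of x] by simp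
    fix p assume "p \<in> S"
    then have "(fst p, snd p) \<in> N" unfolding N_def using closure_subset[of "span S"] span_base[of p S] by auto
    then show "V (fst p) = snd p" by (rule uniq[symmetric])
  qed
qed

section \<open>Unitary flows on classes and their generators\<close>

definition hl2_flow :: "(real \<Rightarrow> hl2 \<Rightarrow> hl2) \<Rightarrow> bool" where
  "hl2_flow V \<longleftrightarrow> (\<forall>t. linear (V t)) \<and> (\<forall>t a x. V t (cmul a x) = cmul a (V t x)) \<and>
     (\<forall>t x. norm (V t x) = norm x) \<and> (\<forall>x. V 0 x = x) \<and> (\<forall>s t x. V (s + t) x = V s (V t x)) \<and>
     (\<forall>x. ((\<lambda>t. V t x) \<longlongrightarrow> x) (at 0))"

text \<open>The counterpart of \<open>generated_by\<close> on classes, where the limit of difference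
  quotients in norm becomes a vector derivative and relations almost everywhere become
  equations.\<close>

definition hl2_flow_of :: "(real \<Rightarrow> hl2 \<Rightarrow> hl2) \<Rightarrow> (hl2 \<times> hl2) set \<Rightarrow> bool" where
  "hl2_flow_of V K \<longleftrightarrow> hl2_flow V \<and>
     (\<forall>u g. (u, g) \<in> K \<longleftrightarrow> ((\<lambda>t. V t u) has_vector_derivative cmul (- \<i>) g) (at 0))"

context
  fixes V assumes V: "hl2_flow V"
begin

lemma flow_linear: "linear (V t)" and flow_cmul: "V t (cmul a x) = cmul a (V t x)"
  and flow_norm: "norm (V t x) = norm x" and flow_zero: "V 0 x = x"
  and flow_add: "V (s + t) x = V s (V t x)" and flow_tendsto: "((\<lambda>t. V t x) \<longlongrightarrow> x) (at 0)"
  using V by (auto simp: hl2_flow_def)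

lemma flow_bounded_linear: "bounded_linear (V t)"
  by (rule bounded_linear_intro[where K = 1])
     (auto simp: linear_add[OF flow_linear] linear_scale[OF flow_linear] flow_norm)

lemma flow_inverse: "V t (V (- t) x) = x" "V (- t) (V t x) = x"
  using flow_add[of t "-t" x] flow_add[of "-t" t x] by (simp_all add: flow_zero)

lemma flow_inner: "inner (V t x) (V t y) = inner x y"
proof -
  have "(norm (V t x + V t y))\<^sup>2 = (norm (x + y))\<^sup>2"
    by (simp add: flow_norm flip: linear_add[OF flow_linear])
  moreover have "inner (V t z) (V t z) = inner z z" for z
    using flow_norm[of t z] by (simp add: norm_eq_sqrt_inner)
  ultimately show ?thesis
    using inner_commute[of "V t y" "V t x"] inner_commute[of y x]
    by (simp add: power2_norm_eq_inner inner_add_left inner_add_right)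
qed

lemma flow_inner_adjoint: "inner (V t x) y = inner x (V (- t) y)"
  using flow_inner[of t x "V (- t) y"] by (simp add: flow_inverse)

lemma flow_vector_derivative:
  assumes "((\<lambda>t. V t u) has_vector_derivative u') (at 0)"
  shows "((\<lambda>t. V t u) has_vector_derivative V t u') (at t)"
proof -
  have 1: "((\<lambda>s. s - t) has_vector_derivative 1) (at t)"
    by (auto intro!: derivative_eq_intros)
  have "((\<lambda>r. V r u) \<circ> (\<lambda>s. s - t) has_vector_derivative 1 *\<^sub>R u') (at t)"
    by (rule vector_diff_chain_at[OF 1]) (use assms in simp)
  then have "((\<lambda>s. V t (((\<lambda>r. V r u) \<circ> (\<lambda>s. s - t)) s)) has_vector_derivative V t (1 *\<^sub>R u')) (at t)"
    by (rule bounded_linear.has_vector_derivative[OF flow_bounded_linear])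
  moreover have "V t (V (s - t) u) = V s u" for s using flow_add[of t "s - t" u] by simp
  ultimately show ?thesis by (simp add: o_def)
qed

lemma flow_continuous: "continuous_on UNIV (\<lambda>t. V t x)"
proof (rule continuous_at_imp_continuous_on, rule ballI)
  fix t
  have "((\<lambda>h. V t (V h x)) \<longlongrightarrow> V t x) (at 0)"
    by (rule bounded_linear.tendsto[OF flow_bounded_linear flow_tendsto])
  then show "isCont (\<lambda>t. V t x) t"
    unfolding isCont_iff LIM_def flow_add .
qed

end

lemma Gam_imaginary_derivative:
  assumes "0 < Re \<zeta>" "0 \<le> c"
  shows "((\<lambda>t. cmul a (Gam c (\<zeta> + of_real t * (2 * \<i>)))) has_vector_derivative
    cmul (- \<i>) (cmul a (Hgam c (\<zeta> + of_real t * (2 * \<i>))))) (at t)"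
  using Gam_vector_derivative[of \<zeta> t "2 * \<i>" c a] assms by simp

lemma Gam_friedrichs': "1/2 \<le> c \<Longrightarrow> 0 < Re \<zeta> \<Longrightarrow> (cmul a (Gam c \<zeta>), cmul a (Hgam c \<zeta>)) \<in> friedrichs c"
  unfolding Hgam_def by (rule Gam_friedrichs)

text \<open>The derivative in t is zero: H is symmetric and the factor - \<i> in the equation of
  motion is skew.\<close>

lemma Gam_inner_translate:
  assumes c: "1/2 \<le> c" and \<zeta>: "0 < Re \<zeta>" and \<omega>: "0 < Re \<omega>"
  shows "inner (cmul a (Gam c (\<zeta> + of_real t * (2 * \<i>)))) (cmul b (Gam c (\<omega> + of_real t * (2 * \<i>))))
    = inner (cmul a (Gam c \<zeta>)) (cmul b (Gam c \<omega>))"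
proof -
  have c0: "0 \<le> c" using c by simp
  define f where "f t = inner (cmul a (Gam c (\<zeta> + of_real t * (2 * \<i>)))) (cmul b (Gam c (\<omega> + of_real t * (2 * \<i>))))" for t
  have "(f has_vector_derivative 0) (at t)" for t
  proof -
    let ?z = "\<zeta> + of_real t * (2 * \<i>)" and ?w = "\<omega> + of_real t * (2 * \<i>)"
    have "inner (cmul a (Gam c ?z)) (cmul (- \<i>) (cmul b (Hgam c ?w)))
        = inner (cmul (\<i> * a) (Gam c ?z)) (cmul b (Hgam c ?w))"
      by (simp add: inner_commute[of "cmul (\<i> * a) _"] inner_commute[of "cmul a _"] inner_cmul_left flip: cmul_cmul)
    also have "\<dots> = inner (cmul (\<i> * a) (Hgam c ?z)) (cmul b (Gam c ?w))"
      by (rule friedrichs_symmetric[symmetric, of _ _ c]; rule Gam_friedrichs'; use c \<zeta> \<omega> in simp)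
    also have "\<dots> = - inner (cmul (- \<i>) (cmul a (Hgam c ?z))) (cmul b (Gam c ?w))"
      by (simp add: cmul_minus_left)
    finally have 0: "inner (cmul a (Gam c ?z)) (cmul (- \<i>) (cmul b (Hgam c ?w)))
        + inner (cmul (- \<i>) (cmul a (Hgam c ?z))) (cmul b (Gam c ?w)) = 0" by simp
    show ?thesis
      unfolding f_def
      using bounded_bilinear.has_vector_derivative[OF bounded_bilinear_inner
          Gam_imaginary_derivative[OF \<zeta> c0, of a t] Gam_imaginary_derivative[OF \<omega> c0, of b t]]
      unfolding 0 .
  qed
  then have "f t = f 0"
    using has_vector_derivative_zero_constant[of UNIV f] by (metis UNIV_I convex_UNIV)
  then show ?thesis by (simp add: f_def)
qed

text \<open>The set where A and B agree is a closed subspace, and it contains a total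
  family.\<close>

lemma linear_eq_on_Gam:
  assumes A: "bounded_linear A" and B: "bounded_linear B" and c: "0 \<le> c"
    and eq: "\<And>a \<zeta>. 0 < Re \<zeta> \<Longrightarrow> A (cmul a (Gam c \<zeta>)) = B (cmul a (Gam c \<zeta>))"
  shows "A x = B x"
proof -
  define M where "M = {x. A x = B x}"
  have "x \<in> M"
  proof (rule mem_closed_subspace_if_orthogonal)
    show "subspace M"
      unfolding M_def using A B
      by (auto intro!: subspaceI simp: linear_simps)
    show "closed M"
      unfolding M_def using A B
      by (intro closed_Collect_eq linear_continuous_on)
    fix y assume y: "\<And>m. m \<in> M \<Longrightarrow> inner m y = 0"
    have "y = 0" by (rule Gam_orthogonal_zero[OF c]) (use y eq in \<open>auto simp: M_def\<close>)
    then show "inner x y = 0" by simp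
  qed
  then show ?thesis by (simp add: M_def)
qed

text \<open>The translation by 2 \<i> t preserves Re \<zeta> > 0 and inner products, so it extends
  to an isometry for each t. Complex linearity and the group law hold on the Gaussians and hence
  everywhere; strong continuity passes to the closure because all V t are isometries.\<close>

lemma flow_exists:
  assumes c: "1/2 \<le> c"
  obtains V where "hl2_flow V"
    "\<And>t \<zeta>. 0 < Re \<zeta> \<Longrightarrow> V t (Gam c \<zeta>) = Gam c (\<zeta> + of_real t * (2 * \<i>))"
proof -
  have c0: "0 \<le> c" using c by simp
  have "\<exists>V. linear V \<and> (\<forall>x. norm (V x) = norm x) \<and>
      (\<forall>a \<zeta>. 0 < Re \<zeta> \<longrightarrow> V (cmul a (Gam c \<zeta>)) = cmul a (Gam c (\<zeta> + of_real t * (2 * \<i>))))" for t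
  proof -
    define S where "S = {(cmul a (Gam c \<zeta>), cmul a (Gam c (\<zeta> + of_real t * (2 * \<i>)))) | a \<zeta>. 0 < Re \<zeta>}"
    obtain V where V: "linear V" "\<And>x. norm (V x) = norm x" "\<And>p. p \<in> S \<Longrightarrow> V (fst p) = snd p"
    proof (rule isometry_extension[of S])
      show "inner (fst p) (fst q) = inner (snd p) (snd q)" if "p \<in> S" "q \<in> S" for p q
        using that Gam_inner_translate[OF c] unfolding S_def by auto
      show "y = 0" if "\<And>p. p \<in> S \<Longrightarrow> inner (fst p) y = 0" for y
      proof (rule Gam_orthogonal_zero[OF c0])
        fix \<zeta> a assume "0 < Re \<zeta>"
        then have "(cmul a (Gam c \<zeta>), cmul a (Gam c (\<zeta> + of_real t * (2 * \<i>)))) \<in> S"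
          unfolding S_def by blast
        from that[OF this] show "inner (cmul a (Gam c \<zeta>)) y = 0" by simp
      qed
    qed blast
    have "V (cmul a (Gam c \<zeta>)) = cmul a (Gam c (\<zeta> + of_real t * (2 * \<i>)))" if "0 < Re \<zeta>" for a \<zeta>
    proof -
      have "(cmul a (Gam c \<zeta>), cmul a (Gam c (\<zeta> + of_real t * (2 * \<i>)))) \<in> S"
        using that unfolding S_def by blast
      from V(3)[OF this] show ?thesis by simp
    qed
    with V show ?thesis by blast
  qed
  then obtain V where lin: "\<And>t. linear (V t)" and norm: "\<And>t x. norm (V t x) = norm x"
    and G: "\<And>t a \<zeta>. 0 < Re \<zeta> \<Longrightarrow> V t (cmul a (Gam c \<zeta>)) = cmul a (Gam c (\<zeta> + of_real t * (2 * \<i>)))"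
    by metis
  have bl: "bounded_linear (V t)" for t
    by (rule bounded_linear_intro[where K = 1]) (auto simp: linear_add[OF lin] linear_scale[OF lin] norm)
  have "V t (cmul a x) = cmul a (V t x)" for t a x
    by (rule linear_eq_on_Gam[OF bounded_linear_compose[OF bl bounded_linear_cmul]
          bounded_linear_compose[OF bounded_linear_cmul bl] c0]) (simp add: G)
  moreover have "V 0 x = x" for x
    by (rule linear_eq_on_Gam[OF bl bounded_linear_ident c0]) (simp add: G)
  moreover have "V (s + t) x = V s (V t x)" for s t x
    by (rule linear_eq_on_Gam[OF bl bounded_linear_compose[OF bl bl] c0]) (simp add: G algebra_simps)
  moreover have "((\<lambda>t. V t x) \<longlongrightarrow> x) (at 0)" for x
  proof -
    define M where "M = {x. ((\<lambda>t. V t x) \<longlongrightarrow> x) (at 0)}"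
    have "x \<in> M"
    proof (rule mem_closed_subspace_if_orthogonal)
      show "subspace M"
        unfolding M_def
        by (rule subspaceI)
           (auto simp: linear_0[OF lin] linear_add[OF lin] linear_scale[OF lin] intro!: tendsto_intros)
      show "closed M"
      proof (rule closed_sequential_limits[THEN iffD2], intro allI impI, elim conjE)
        fix X l assume X: "\<forall>n. X n \<in> M" and lim: "X \<longlonglongrightarrow> l"
        have "((\<lambda>t. V t l) \<longlongrightarrow> l) (at 0)"
        proof (rule tendstoI)
          fix e :: real assume e: "0 < e"
          then obtain n where n: "dist (X n) l < e / 3"
            using lim[unfolded lim_sequentially, rule_format, of "e/3"] by auto
          have "((\<lambda>t. V t (X n)) \<longlongrightarrow> X n) (at 0)" using X by (simp add: M_def)
          from tendstoD[OF this, of "e/3"] have "\<forall>\<^sub>F t in at 0. dist (V t (X n)) (X n) < e / 3"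
            using e by simp
          then show "\<forall>\<^sub>F t in at 0. dist (V t l) l < e"
          proof eventually_elim
            case (elim t)
            have "dist (V t l) (V t (X n)) = dist l (X n)"
              by (simp add: dist_norm norm flip: linear_diff[OF lin])
            then show ?case
              using elim n dist_triangle[of "V t l" l "V t (X n)"] dist_triangle[of "V t (X n)" l "X n"]
              by (simp add: dist_commute)
          qed
        qed
        then show "l \<in> M" by (simp add: M_def)
      qed
      fix y assume y: "\<And>m. m \<in> M \<Longrightarrow> inner m y = 0"
      have "y = 0"
      proof (rule Gam_orthogonal_zero[OF c0], rule y)
        fix \<zeta> a assume \<zeta>: "0 < Re \<zeta>"
        have "isCont (\<lambda>t. cmul a (Gam c (\<zeta> + of_real t * (2 * \<i>)))) 0"
          by (rule has_vector_derivative_continuous[OF Gam_imaginary_derivative[OF \<zeta> c0]])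
        then show "cmul a (Gam c \<zeta>) \<in> M" by (simp add: M_def G[OF \<zeta>] isCont_def)
      qed
      then show "inner x y = 0" by simp
    qed
    then show ?thesis by (simp add: M_def)
  qed
  ultimately have "hl2_flow V" unfolding hl2_flow_def using lin norm by blast
  moreover have "V t (Gam c \<zeta>) = Gam c (\<zeta> + of_real t * (2 * \<i>))" if "0 < Re \<zeta>" for t \<zeta>
    using G[OF that, of t 1] by simp
  ultimately show ?thesis using that by blast
qed

text \<open>The Friedrichs operator is contained in the generator by approximation from the core.
  Conversely, pairing a differentiable orbit with the orbits of core vectors gives the weak relation
  that \<open>friedrichs_of_core\<close> asks for.\<close>

lemma flow_of_friedrichs:
  assumes c: "1/2 \<le> c" and V: "hl2_flow V"
    and G: "\<And>t \<zeta>. 0 < Re \<zeta> \<Longrightarrow> V t (Gam c \<zeta>) = Gam c (\<zeta> + of_real t * (2 * \<i>))"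
  shows "hl2_flow_of V (friedrichs c)"
proof -
  have c0: "0 \<le> c" using c by simp
  note lin = flow_linear[OF V]
  have dG: "((\<lambda>t. V t (fst p)) has_vector_derivative cmul (- \<i>) (snd p)) (at 0)" if pc: "p \<in> core_gens c" for p
  proof -
    obtain a \<zeta> where p: "p = (cmul a (Gam c \<zeta>), cmul a (Hgam c \<zeta>))" and \<zeta>: "0 < Re \<zeta>"
      using pc unfolding core_gens_def by blast
    show ?thesis
      using Gam_imaginary_derivative[OF \<zeta> c0, of a 0] by (simp add: p flow_cmul[OF V] G[OF \<zeta>])
  qed
  have dS: "((\<lambda>t. V t (fst p)) has_vector_derivative cmul (- \<i>) (snd p)) (at 0)"
    if "p \<in> span (core_gens c)" for p
    using that
  proof (induction rule: span_induct_alt)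
    case base
    show ?case by (simp add: linear_0[OF lin] has_vector_derivative_const linear_0[OF bounded_linear.linear[OF bounded_linear_cmul]])
  next
    case (step k x y)
    have "((\<lambda>t. k *\<^sub>R V t (fst x) + V t (fst y)) has_vector_derivative
        k *\<^sub>R cmul (- \<i>) (snd x) + cmul (- \<i>) (snd y)) (at 0)"
      using dG[OF step(1)] step(2)
      by (intro has_vector_derivative_add bounded_linear.has_vector_derivative[OF bounded_linear_scaleR_right])
    then show ?case by (simp add: linear_add[OF lin] linear_scale[OF lin] cmul_add cmul_scaleR)
  qed
  have "((\<lambda>t. V t u) has_vector_derivative cmul (- \<i>) g) (at 0)" if ug: "(u, g) \<in> friedrichs c" for u g
    unfolding has_vector_derivative_def has_derivative_at_alt
  proof (intro conjI allI impI)
    show "bounded_linear (\<lambda>h. h *\<^sub>R cmul (- \<i>) g)" by (rule bounded_linear_scaleR_left)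
    fix e :: real assume e: "0 < e"
    have "isCont (\<lambda>t. V t g) 0"
      using flow_tendsto[OF V, of g] by (simp add: isCont_def flow_zero[OF V])
    then have "\<exists>\<delta>>0. \<forall>s. dist s 0 < \<delta> \<longrightarrow> dist (V s g) (V 0 g) < e / 2"
      unfolding continuous_at_eps_delta using e half_gt_zero by blast
    then have "\<exists>\<delta>>0. \<forall>s. \<bar>s\<bar> < \<delta> \<longrightarrow> norm (V s g - g) < e / 2"
      by (simp add: dist_norm flow_zero[OF V])
    then obtain \<delta> where \<delta>: "0 < \<delta>" "\<And>s. \<bar>s\<bar> < \<delta> \<Longrightarrow> norm (V s g - g) < e / 2"
      by blast
    obtain d where d: "\<And>n. d n \<in> span (core_gens c)" "d \<longlonglongrightarrow> (u, g)"
      using friedrichs_core[OF c ug] by blast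
    have l: "(\<lambda>n. fst (d n)) \<longlonglongrightarrow> u" "(\<lambda>n. snd (d n)) \<longlonglongrightarrow> g"
      using tendsto_fst[OF d(2)] tendsto_snd[OF d(2)] by simp_all
    \<comment> \<open>The mean value estimate is made for core vectors, with \<delta> chosen from g
      alone, so that it survives the limit in n. The vector V s h differs from h by at most e/4 +
      e/2 + e/4, the two quarters being the distance from h to g.\<close>
    have est: "norm (V t u - u - t *\<^sub>R cmul (- \<i>) g) \<le> \<bar>t\<bar> * e" if t: "\<bar>t\<bar> < \<delta>" for t
    proof -
      have "\<forall>\<^sub>F n in sequentially. norm (V t (fst (d n)) - fst (d n) - t *\<^sub>R cmul (- \<i>) (snd (d n))) \<le> \<bar>t\<bar> * e"
      proof -
        have "\<forall>\<^sub>F n in sequentially. dist (snd (d n)) g < e / 4"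
          using tendstoD[OF l(2), of "e/4"] e by simp
        then show ?thesis
        proof eventually_elim
          case (elim n)
          define h where "h = snd (d n)"
          have "norm (V t (fst (d n)) - V 0 (fst (d n)) - (t - 0) *\<^sub>R V 0 (cmul (- \<i>) h)) \<le> norm (t - 0) * e"
          proof (rule vector_differentiable_bound_linearization[of "closed_segment 0 t"])
            show "((\<lambda>t. V t (fst (d n))) has_vector_derivative V s (cmul (- \<i>) h)) (at s within closed_segment 0 t)"
              for s
              unfolding h_def
              by (rule has_vector_derivative_at_within[OF flow_vector_derivative[OF V dS[OF d(1)]]])
            fix s assume "s \<in> closed_segment 0 t"
            then have "\<bar>s\<bar> < \<delta>" using t by (auto simp: closed_segment_eq_real_ivl split: if_splits)
            then have "norm (V s g - g) < e / 2" by (rule \<delta>(2))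
            moreover have "norm (V s h - V s g) = norm (h - g)" by (simp add: flow_norm[OF V] flip: linear_diff[OF lin])
            moreover have "V s h - h = (V s h - V s g) + ((V s g - g) + (g - h))" by simp
            ultimately have "norm (V s h - h) \<le> e"
              using norm_triangle_ineq[of "V s h - V s g" "(V s g - g) + (g - h)"]
                norm_triangle_ineq[of "V s g - g" "g - h"] elim
              by (simp add: dist_norm h_def norm_minus_commute)
            moreover have "V s (cmul (- \<i>) h) - V 0 (cmul (- \<i>) h) = cmul (- \<i>) (V s h - h)"
              by (simp add: flow_cmul[OF V] flow_zero[OF V] linear_diff[OF bounded_linear.linear[OF bounded_linear_cmul]])
            ultimately show "norm (V s (cmul (- \<i>) h) - V 0 (cmul (- \<i>) h)) \<le> e" by simp
          qed auto
          then show ?case by (simp add: flow_zero[OF V] h_def)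
        qed
      qed
      moreover have "(\<lambda>n. norm (V t (fst (d n)) - fst (d n) - t *\<^sub>R cmul (- \<i>) (snd (d n))))
          \<longlonglongrightarrow> norm (V t u - u - t *\<^sub>R cmul (- \<i>) g)"
        by (intro tendsto_intros l bounded_linear.tendsto[OF flow_bounded_linear[OF V]]
            bounded_linear.tendsto[OF bounded_linear_cmul])
      ultimately show ?thesis by (intro tendsto_upperbound) auto
    qed
    have "\<forall>y. norm (y - 0) < \<delta> \<longrightarrow> norm (V y u - V 0 u - (y - 0) *\<^sub>R cmul (- \<i>) g) \<le> e * norm (y - 0)"
      using est by (simp add: flow_zero[OF V] mult.commute)
    then show "\<exists>d>0. \<forall>y. norm (y - 0) < d \<longrightarrow> norm (V y u - V 0 u - (y - 0) *\<^sub>R cmul (- \<i>) g) \<le> e * norm (y - 0)"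
      using \<delta>(1) by blast
  qed
  moreover have "(u, g) \<in> friedrichs c"
    if ug: "((\<lambda>t. V t u) has_vector_derivative cmul (- \<i>) g) (at 0)" for u g
  proof (rule friedrichs_of_core[OF c])
    fix p assume "p \<in> core_gens c"
    then obtain a \<zeta> where p: "p = (cmul a (Gam c \<zeta>), cmul a (Hgam c \<zeta>))" and \<zeta>: "0 < Re \<zeta>"
      unfolding core_gens_def by blast
    \<comment> \<open>The factor - \<i> a cancels the - \<i> of the equation of motion, so that the
      comparison of the two derivatives is a relation for the scalar a itself.\<close>
    let ?v = "cmul (- \<i> * a) (Gam c \<zeta>)" and ?h = "cmul (- \<i> * a) (Hgam c \<zeta>)"
    have "(?v, ?h) \<in> core_gens c" unfolding core_gens_def using \<zeta> by blast
    from dG[OF this] have "((\<lambda>t. V t ?v) has_vector_derivative cmul (- \<i>) ?h) (at (- 0))" by simp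
    then have "((\<lambda>t. V t ?v) \<circ> uminus has_vector_derivative (- 1) *\<^sub>R cmul (- \<i>) ?h) (at 0)"
      by (intro vector_diff_chain_at) (auto intro!: derivative_eq_intros)
    then have d2: "((\<lambda>t. V (- t) ?v) has_vector_derivative - cmul (- \<i>) ?h) (at 0)" by (simp add: o_def)
    have "((\<lambda>t. inner u (V (- t) ?v)) has_vector_derivative inner u (- cmul (- \<i>) ?h)) (at 0)"
      using d2 by (rule bounded_linear.has_vector_derivative[OF bounded_linear_inner_right])
    moreover have "((\<lambda>t. inner (V t u) ?v) has_vector_derivative inner (cmul (- \<i>) g) ?v) (at 0)"
      using ug by (rule bounded_linear.has_vector_derivative[OF bounded_linear_inner_left])
    ultimately have "inner u (- cmul (- \<i>) ?h) = inner (cmul (- \<i>) g) ?v"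
      unfolding flow_inner_adjoint[OF V] using vector_derivative_unique_at by blast
    then have "inner u (cmul a (Hgam c \<zeta>)) = inner g (cmul a (Gam c \<zeta>))"
      by (simp add: inner_cmul_left cmul_minus_left linear_neg[OF bounded_linear.linear[OF bounded_linear_cmul]])
    then show "inner u (snd p) = inner g (fst p)" by (simp add: p)
  qed
  ultimately show ?thesis unfolding hl2_flow_of_def using V by blast
qed

text \<open>Uniqueness of the evolution: V (- t) applied to the translated Gaussian has derivative
  zero in t. The flow that comes from \<open>exp_minus_i\<close> is known only through its
  generator, and this determines it on the Gaussians.\<close>

lemma flow_of_friedrichs_Gam:
  assumes c: "1/2 \<le> c" and V: "hl2_flow_of V (friedrichs c)" and \<zeta>: "0 < Re \<zeta>"
  shows "V t (Gam c \<zeta>) = Gam c (\<zeta> + of_real t * (2 * \<i>))"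
proof -
  have c0: "0 \<le> c" using c by simp
  have flow: "hl2_flow V" using V by (simp add: hl2_flow_of_def)
  note lin = flow_linear[OF flow]
  define \<gamma> where "\<gamma> t = Gam c (\<zeta> + of_real t * (2 * \<i>))" for t
  define \<eta> where "\<eta> t = cmul (- \<i>) (Hgam c (\<zeta> + of_real t * (2 * \<i>)))" for t
  define p where "p t = V (- t) (\<gamma> t)" for t
  have "(p has_vector_derivative 0) (at t)" for t
  proof -
    have 1: "(\<gamma> has_vector_derivative \<eta> t) (at t)"
      using Gam_imaginary_derivative[OF \<zeta> c0, of 1 t] by (simp add: \<gamma>_def[abs_def] \<eta>_def)
    have "(\<gamma> t, Hgam c (\<zeta> + of_real t * (2 * \<i>))) \<in> friedrichs c"
      using Gam_friedrichs'[OF c, of "\<zeta> + of_real t * (2 * \<i>)" 1] \<zeta> by (simp add: \<gamma>_def)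
    then have "((\<lambda>s. V s (\<gamma> t)) has_vector_derivative \<eta> t) (at (t - t))"
      using V unfolding hl2_flow_of_def \<eta>_def by simp
    then have "((\<lambda>s. V s (\<gamma> t)) \<circ> (\<lambda>r. r - t) has_vector_derivative 1 *\<^sub>R \<eta> t) (at t)"
      by (intro vector_diff_chain_at) (auto intro!: derivative_eq_intros)
    then have 2: "((\<lambda>r. V (r - t) (\<gamma> t)) has_vector_derivative \<eta> t) (at t)" by (simp add: o_def)
    have "((\<lambda>r. \<gamma> r - V (r - t) (\<gamma> t)) has_vector_derivative 0) (at t)"
      using has_vector_derivative_diff[OF 1 2] by simp
    then have d: "\<And>e. 0 < e \<Longrightarrow> \<exists>d>0. \<forall>y. norm (y - t) < d \<longrightarrow>
        norm ((\<gamma> y - V (y - t) (\<gamma> t)) - (\<gamma> t - V (t - t) (\<gamma> t)) - (y - t) *\<^sub>R 0) \<le> e * norm (y - t)"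
      unfolding has_vector_derivative_def has_derivative_at_alt by blast
    \<comment> \<open>Pulling out the isometry V (- y) leaves the difference of two curves with the
      same value and the same derivative at t. This avoids a product rule for the operator-valued V
      (- y).\<close>
    have eq: "norm (p y - p t - (y - t) *\<^sub>R 0)
        = norm ((\<gamma> y - V (y - t) (\<gamma> t)) - (\<gamma> t - V (t - t) (\<gamma> t)) - (y - t) *\<^sub>R 0)" for y
    proof -
      have "p t = V (- y) (V (y - t) (\<gamma> t))"
        unfolding p_def using flow_add[OF flow, of "- y" "y - t" "\<gamma> t"] by simp
      then have "p y - p t = V (- y) (\<gamma> y - V (y - t) (\<gamma> t))"
        by (simp add: p_def linear_diff[OF lin])
      then show ?thesis by (simp add: flow_norm[OF flow] flow_zero[OF flow])
    qed
    show ?thesis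
      unfolding has_vector_derivative_def has_derivative_at_alt eq
      using d bounded_linear_scaleR_left by blast
  qed
  then have "p t = p 0"
    using has_vector_derivative_zero_constant[of UNIV p] by (metis UNIV_I convex_UNIV)
  then have "V (- t) (\<gamma> t) = Gam c \<zeta>"
    by (simp add: p_def flow_zero[OF flow] \<gamma>_def)
  then have "V t (V (- t) (\<gamma> t)) = V t (Gam c \<zeta>)" by simp
  then show ?thesis by (simp add: flow_inverse[OF flow] \<gamma>_def)
qed

section \<open>Passage between flows on classes and groups on functions\<close>

lemma has_vector_derivative_at_0_iff:
  fixes f :: "real \<Rightarrow> 'a::real_normed_vector"
  shows "(f has_vector_derivative f') (at 0) \<longleftrightarrow>
    ((\<lambda>h. norm ((1 / h) *\<^sub>R (f h - f 0) - f')) \<longlongrightarrow> 0) (at 0)"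
proof -
  have "(f has_vector_derivative f') (at 0) \<longleftrightarrow>
      ((\<lambda>h. norm (f h - f 0 - h *\<^sub>R f') / norm h) \<longlongrightarrow> 0) (at 0)"
    unfolding has_vector_derivative_def has_derivative_at
    by (simp add: bounded_linear_scaleR_left)
  also have "\<dots> \<longleftrightarrow> ((\<lambda>h. norm ((1 / h) *\<^sub>R (f h - f 0) - f')) \<longlongrightarrow> 0) (at 0)"
  proof (rule tendsto_cong)
    have "norm (f h - f 0 - h *\<^sub>R f') / norm h = norm ((1 / h) *\<^sub>R (f h - f 0) - f')" if "h \<noteq> 0" for h
    proof -
      have "(1 / h) *\<^sub>R (f h - f 0) - f' = (1 / h) *\<^sub>R (f h - f 0 - h *\<^sub>R f')"
        using that by (simp add: algebra_simps)
      then show ?thesis by (simp add: divide_inverse mult.commute)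
    qed
    then show "\<forall>\<^sub>F h in at 0. norm (f h - f 0 - h *\<^sub>R f') / norm h = norm ((1 / h) *\<^sub>R (f h - f 0) - f')"
      by (auto simp: eventually_at_filter)
  qed
  finally show ?thesis .
qed

lemma L2_derivative_quotient_norm:
  assumes f: "f \<in> L2 halfline" and g: "g \<in> L2 halfline" and h: "h \<in> L2 halfline"
  shows "L2_norm halfline (\<lambda>x. (h x - f x) / complex_of_real t - (- \<i> * g x))
    = norm ((1 / t) *\<^sub>R (cls h - cls f) - cmul (- \<i>) (cls g))"
proof -
  have "(\<lambda>x. (h x - f x) / complex_of_real t - (- \<i> * g x))
      = (\<lambda>x. of_real (1 / t) * (h x - f x) - (- \<i>) * g x)" by (auto simp: divide_inverse)
  moreover have "cls (\<lambda>x. of_real (1 / t) * (h x - f x) - (- \<i>) * g x)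
      = cmul (of_real (1 / t)) (cls h - cls f) - cmul (- \<i>) (cls g)"
    by (simp only: cls_diff cls_cmul L2_diff L2_scale f g h)
  moreover have "(\<lambda>x. of_real (1 / t) * (h x - f x) - (- \<i>) * g x) \<in> L2 halfline"
    by (intro L2_diff L2_scale f g h)
  ultimately show ?thesis
    by (simp only: norm_cls[symmetric] cmul_of_real)
qed

lemma generated_by_of_flow:
  assumes c: "c = \<nu> + 1/2" and V: "hl2_flow_of V (friedrichs c)"
  shows "generated_by halfline (\<lambda>t f. rep_hl2 (V t (cls f))) (H_op \<nu>)"
proof -
  have fl: "hl2_flow V" using V by (simp add: hl2_flow_of_def)
  have "unitary_group halfline (\<lambda>t f. rep_hl2 (V t (cls f)))"
    unfolding unitary_group_def
  proof (intro conjI allI ballI)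
    fix f assume f: "f \<in> L2 halfline"
    show "rep_hl2 (V t (cls f)) \<in> L2 halfline" for t by simp
    show "L2_norm halfline (rep_hl2 (V t (cls f))) = L2_norm halfline f" for t
      by (simp add: flow_norm[OF fl] f flip: norm_cls)
    show "AE x in halfline. rep_hl2 (V 0 (cls f)) x = f x"
      unfolding flow_zero[OF fl] by (rule rep_cls[OF f])
    show "AE x in halfline. rep_hl2 (V (s + t) (cls f)) x = rep_hl2 (V s (cls (rep_hl2 (V t (cls f))))) x" for s t
      by (simp add: flow_add[OF fl])
    show "((\<lambda>t. L2_norm halfline (\<lambda>x. rep_hl2 (V t (cls f)) x - f x)) \<longlongrightarrow> 0) (at 0)"
      using tendsto_norm_zero[OF LIM_zero[OF flow_tendsto[OF fl, of "cls f"]]]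
      by (simp add: f L2_diff cls_diff flip: norm_cls)
    fix g t a b assume g: "g \<in> L2 halfline"
    have "cls (rep_hl2 (V t (cls (\<lambda>y. a * f y + b * g y))))
        = cls (\<lambda>x. a * rep_hl2 (V t (cls f)) x + b * rep_hl2 (V t (cls g)) x)"
      by (simp add: cls_add cls_cmul L2_scale f g linear_add[OF flow_linear[OF fl]] flow_cmul[OF fl])
    then show "AE x in halfline. rep_hl2 (V t (cls (\<lambda>y. a * f y + b * g y))) x
        = a * rep_hl2 (V t (cls f)) x + b * rep_hl2 (V t (cls g)) x"
      by (subst (asm) cls_eq_iff) (auto intro!: L2_add L2_scale)
  qed
  moreover have "(f, g) \<in> H_op \<nu> \<longleftrightarrow> ((\<lambda>t. L2_norm halfline
      (\<lambda>x. (rep_hl2 (V t (cls f)) x - f x) / complex_of_real t - (- \<i> * g x))) \<longlongrightarrow> 0) (at 0)"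
    if f: "f \<in> L2 halfline" and g: "g \<in> L2 halfline" for f g
    unfolding H_op_iff[OF c f g] L2_derivative_quotient_norm[OF f g rep_L2] cls_rep
    using V has_vector_derivative_at_0_iff[of "\<lambda>t. V t (cls f)"]
    by (simp add: hl2_flow_of_def flow_zero[OF fl])
  ultimately show ?thesis unfolding generated_by_def by blast
qed

lemma flow_of_generated_by:
  assumes c: "c = \<nu> + 1/2" and U: "generated_by halfline U (H_op \<nu>)"
  obtains V where "hl2_flow_of V (friedrichs c)" "\<And>t f. f \<in> L2 halfline \<Longrightarrow> cls (U t f) = V t (cls f)"
proof -
  have ug: "unitary_group halfline U" using U by (simp add: generated_by_def)
  have UL: "\<And>t f. f \<in> L2 halfline \<Longrightarrow> U t f \<in> L2 halfline"
    and Ulin: "\<And>t f g a b. f \<in> L2 halfline \<Longrightarrow> g \<in> L2 halfline \<Longrightarrow>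
        AE x in halfline. U t (\<lambda>y. a * f y + b * g y) x = a * U t f x + b * U t g x"
    and Unorm: "\<And>t f. f \<in> L2 halfline \<Longrightarrow> L2_norm halfline (U t f) = L2_norm halfline f"
    and U0: "\<And>f. f \<in> L2 halfline \<Longrightarrow> AE x in halfline. U 0 f x = f x"
    and Uadd: "\<And>s t f. f \<in> L2 halfline \<Longrightarrow> AE x in halfline. U (s + t) f x = U s (U t f) x"
    and Ucont: "\<And>f. f \<in> L2 halfline \<Longrightarrow>
        ((\<lambda>t. L2_norm halfline (\<lambda>x. U t f x - f x)) \<longlongrightarrow> 0) (at 0)"
    using ug unfolding unitary_group_def by blast+
  have lin: "cls (U t (\<lambda>y. a * f y + b * g y)) = cmul a (cls (U t f)) + cmul b (cls (U t g))"
    if "f \<in> L2 halfline" "g \<in> L2 halfline" for t f g a b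
  proof -
    have "cls (U t (\<lambda>y. a * f y + b * g y)) = cls (\<lambda>x. a * U t f x + b * U t g x)"
      by (subst cls_eq_iff) (intro UL L2_add L2_scale that Ulin)+
    then show ?thesis by (simp add: cls_add cls_cmul L2_scale UL that)
  qed
  have nrm: "norm (cls (U t f)) = norm (cls f)" if "f \<in> L2 halfline" for t f
    using Unorm[OF that] by (simp add: norm_cls UL that)
  define V where "V t x = cls (U t (rep_hl2 x))" for t x
  \<comment> \<open>Independence of the representative: linearity and preservation of the norm are
    applied to f minus the representative of its class, a function of norm zero.\<close>
  have V: "cls (U t f) = V t (cls f)" if f: "f \<in> L2 halfline" for t f
  proof -
    have "cls (U t (\<lambda>y. 1 * f y + (- 1) * rep_hl2 (cls f) y)) = cls (U t f) - V t (cls f)"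
      unfolding lin[OF f rep_L2] V_def by (simp add: cmul_minus_left)
    moreover have "norm (cls (U t (\<lambda>y. 1 * f y + (- 1) * rep_hl2 (cls f) y))) = 0"
      using f by (subst nrm) (simp_all add: L2_add L2_diff cls_diff)
    ultimately show ?thesis by simp
  qed
  have Vc: "V t (cmul a x + cmul b y) = cmul a (V t x) + cmul b (V t y)" for t a b x y
  proof -
    have "cmul a x + cmul b y = cls (\<lambda>z. a * rep_hl2 x z + b * rep_hl2 y z)"
      by (simp add: cls_add cls_cmul L2_scale)
    then have "V t (cmul a x + cmul b y) = cls (U t (\<lambda>z. a * rep_hl2 x z + b * rep_hl2 y z))"
      by (simp add: V L2_add L2_scale)
    also have "\<dots> = cmul a (V t x) + cmul b (V t y)" by (simp add: lin V_def)
    finally show ?thesis .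
  qed
  have "linear (V t)" for t
  proof (rule linearI)
    show "V t (x + y) = V t x + V t y" for x y using Vc[of t 1 x 1 y] by simp
    show "V t (r *\<^sub>R x) = r *\<^sub>R V t x" for r x using Vc[of t "of_real r" x 0 x] by simp
  qed
  moreover have "V t (cmul a x) = cmul a (V t x)" for t a x using Vc[of t a x 0 x] by simp
  moreover have "norm (V t x) = norm x" for t x using nrm[of "rep_hl2 x" t] by (simp add: V_def)
  moreover have V0: "V 0 x = x" for x
  proof -
    have "cls (U 0 (rep_hl2 x)) = cls (rep_hl2 x)"
      by (subst cls_eq_iff) (intro UL U0 rep_L2)+
    then show ?thesis by (simp add: V_def)
  qed
  moreover have "V (s + t) x = V s (V t x)" for s t x
  proof -
    have "V (s + t) x = cls (U s (U t (rep_hl2 x)))"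
      unfolding V_def by (subst cls_eq_iff) (intro UL Uadd rep_L2)+
    then show ?thesis by (simp add: V UL)
  qed
  moreover have "((\<lambda>t. V t x) \<longlongrightarrow> x) (at 0)" for x
  proof -
    have "((\<lambda>t. norm (V t x - x)) \<longlongrightarrow> 0) (at 0)"
      using Ucont[OF rep_L2, of x] by (simp add: V_def UL L2_diff cls_diff flip: norm_cls)
    then show ?thesis by (simp add: tendsto_norm_zero_iff LIM_zero_iff)
  qed
  ultimately have fl: "hl2_flow V" unfolding hl2_flow_def by blast
  have "(u, g) \<in> friedrichs c \<longleftrightarrow> ((\<lambda>t. V t u) has_vector_derivative cmul (- \<i>) g) (at 0)" for u g
  proof -
    have "(u, g) \<in> friedrichs c \<longleftrightarrow> (rep_hl2 u, rep_hl2 g) \<in> H_op \<nu>"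
      by (simp add: H_op_iff[OF c])
    also have "\<dots> \<longleftrightarrow> ((\<lambda>t. L2_norm halfline
        (\<lambda>x. (U t (rep_hl2 u) x - rep_hl2 u x) / complex_of_real t - (- \<i> * rep_hl2 g x))) \<longlongrightarrow> 0) (at 0)"
      using U unfolding generated_by_def by simp
    also have "\<dots> \<longleftrightarrow> ((\<lambda>t. V t u) has_vector_derivative cmul (- \<i>) g) (at 0)"
      unfolding has_vector_derivative_at_0_iff L2_derivative_quotient_norm[OF rep_L2 rep_L2 UL[OF rep_L2]]
      by (simp add: V0 V_def[symmetric])
    finally show ?thesis .
  qed
  with fl have "hl2_flow_of V (friedrichs c)" unfolding hl2_flow_of_def by blast
  with V show ?thesis using that by blast
qed

text \<open>The explicit flow W serves to show that some group is generated; the choice operator may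
  pick another one. The V obtained here is the flow of the chosen group, so later results are stated
  for every flow generated by \<open>friedrichs\<close>.\<close>

lemma sol_flow:
  assumes \<nu>: "0 \<le> \<nu>"
  obtains V where "hl2_flow_of V (friedrichs (\<nu> + 1/2))"
    "\<And>t f. f \<in> L2 halfline \<Longrightarrow> sol \<nu> f t \<in> L2 halfline"
    "\<And>t f. f \<in> L2 halfline \<Longrightarrow> cls (sol \<nu> f t) = V t (cls f)"
proof -
  have c: "1/2 \<le> \<nu> + 1/2" using \<nu> by simp
  obtain W where "hl2_flow W" "\<And>t \<zeta>. 0 < Re \<zeta> \<Longrightarrow> W t (Gam (\<nu> + 1/2) \<zeta>) = Gam (\<nu> + 1/2) (\<zeta> + of_real t * (2 * \<i>))"
    using flow_exists[OF c] by blast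
  then have "hl2_flow_of W (friedrichs (\<nu> + 1/2))" by (rule flow_of_friedrichs[OF c])
  then have "\<exists>U. generated_by halfline U (H_op \<nu>)" using generated_by_of_flow[OF refl] by blast
  then have U: "generated_by halfline (exp_minus_i halfline (H_op \<nu>)) (H_op \<nu>)"
    unfolding exp_minus_i_def by (rule someI_ex)
  have s: "sol \<nu> f t = exp_minus_i halfline (H_op \<nu>) t f" for f t by (auto simp: sol_def)
  have "unitary_group halfline (exp_minus_i halfline (H_op \<nu>))" using U by (simp add: generated_by_def)
  then have L: "sol \<nu> f t \<in> L2 halfline" if "f \<in> L2 halfline" for f t
    using that by (simp add: s unitary_group_def)
  obtain V where V: "hl2_flow_of V (friedrichs (\<nu> + 1/2))"
    "\<And>t f. f \<in> L2 halfline \<Longrightarrow> cls (exp_minus_i halfline (H_op \<nu>) t f) = V t (cls f)"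
    using flow_of_generated_by[OF refl U] by blast
  show ?thesis
    by (rule that[OF V(1) L]) (simp_all add: s V(2))
qed

section \<open>The intertwining relation\<close>

lemma C2_mult:
  assumes u: "C2_on_halfline u u' u''" and v: "C2_on_halfline v v' v''"
  shows "C2_on_halfline (\<lambda>x. u x * v x) (\<lambda>x. u x * v' x + u' x * v x)
    (\<lambda>x. u x * v'' x + 2 * (u' x * v' x) + u'' x * v x)"
  unfolding C2_on_halfline_def
proof (intro conjI allI impI)
  fix x :: real assume x: "0 < x"
  have d: "(u has_vector_derivative u' x) (at x)" "(u' has_vector_derivative u'' x) (at x)"
    "(v has_vector_derivative v' x) (at x)" "(v' has_vector_derivative v'' x) (at x)"
    using u v x by (auto simp: C2_on_halfline_def)
  show "((\<lambda>x. u x * v x) has_vector_derivative u x * v' x + u' x * v x) (at x)"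
    by (intro has_vector_derivative_mult d)
  have "((\<lambda>x. u x * v' x + u' x * v x) has_vector_derivative
      (u x * v'' x + u' x * v' x) + (u' x * v' x + u'' x * v x)) (at x)"
    by (intro has_vector_derivative_add has_vector_derivative_mult d)
  then show "((\<lambda>x. u x * v' x + u' x * v x) has_vector_derivative
      u x * v'' x + 2 * (u' x * v' x) + u'' x * v x) (at x)"
    by (simp add: algebra_simps)
next
  show "continuous_on {0<..} (\<lambda>x. u x * v'' x + 2 * (u' x * v' x) + u'' x * v x)"
    by (intro continuous_intros C2_continuous[OF u] C2_continuous[OF v])
qed

definition phase :: "real \<Rightarrow> real \<Rightarrow> complex" where
  "phase \<theta> x = exp (\<i> * of_real (\<theta> * x\<^sup>2))"

definition wave :: "real \<Rightarrow> real \<Rightarrow> complex" where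
  "wave k x = exp (\<i> * of_real (k * x))"

lemma norm_phase [simp]: "cmod (phase \<theta> x) = 1" and norm_wave [simp]: "cmod (wave k x) = 1"
  by (simp_all add: phase_def wave_def del: of_real_mult of_real_power)

lemma phase_minus: "phase (- \<theta>) x * phase \<theta> x = 1"
  by (simp add: phase_def flip: exp_add)

lemma cnj_phase: "cnj (phase \<theta> x) = phase (- \<theta>) x"
  by (simp add: phase_def exp_cnj)

lemma phase_measurable [measurable]: "phase \<theta> \<in> borel_measurable halfline" "wave k \<in> borel_measurable halfline"
  unfolding phase_def[abs_def] wave_def[abs_def]
  by (intro continuous_on_halfline_measurable continuous_intros)+

lemma wave_C2: "C2_on_halfline (wave k) (\<lambda>x. (\<i> * of_real k) * wave k x) (\<lambda>x. - of_real (k\<^sup>2) * wave k x)"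
proof -
  have d: "(wave k has_vector_derivative (\<i> * of_real k) * wave k x) (at x)" for x
  proof -
    have "((\<lambda>x. k * x) has_field_derivative k) (at x)" by (auto intro!: derivative_eq_intros)
    from has_vector_derivative_mult_right[OF has_vector_derivative_of_real[OF this], of \<i>]
    have "((\<lambda>x. \<i> * of_real (k * x)) has_vector_derivative \<i> * of_real k) (at x)" .
    from field_vector_diff_chain_at[OF this DERIV_exp] show ?thesis
      unfolding wave_def[abs_def] by (simp add: o_def)
  qed
  have "((\<lambda>x. (\<i> * of_real k) * wave k x) has_vector_derivative (\<i> * of_real k) * ((\<i> * of_real k) * wave k x)) (at x)" for x
    by (intro has_vector_derivative_mult_right d)
  then have d2: "((\<lambda>x. (\<i> * of_real k) * wave k x) has_vector_derivative - of_real (k\<^sup>2) * wave k x) (at x)" for x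
    by (simp add: power2_eq_square algebra_simps)
  have "continuous_on {0<..} (\<lambda>x. - of_real (k\<^sup>2) * wave k x)"
    unfolding wave_def[abs_def] by (intro continuous_intros)
  then show ?thesis using d d2 by (simp add: C2_on_halfline_def)
qed

lemma phase_C2:
  obtains p' p'' where "C2_on_halfline (phase \<theta>) p' p''"
proof -
  define q where "q x = \<i> * complex_of_real (2 * \<theta> * x)" for x
  have d: "(phase \<theta> has_vector_derivative q x * phase \<theta> x) (at x)" for x
  proof -
    have "((\<lambda>x. \<theta> * x\<^sup>2) has_field_derivative 2 * \<theta> * x) (at x)" by (auto intro!: derivative_eq_intros)
    from has_vector_derivative_mult_right[OF has_vector_derivative_of_real[OF this], of \<i>]
    have "((\<lambda>x. \<i> * of_real (\<theta> * x\<^sup>2)) has_vector_derivative q x) (at x)" unfolding q_def .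
    from field_vector_diff_chain_at[OF this DERIV_exp] show ?thesis
      unfolding phase_def[abs_def] by (simp add: o_def)
  qed
  have dq: "(q has_vector_derivative \<i> * of_real (2 * \<theta>)) (at x)" for x
  proof -
    have "((\<lambda>x. 2 * \<theta> * x) has_field_derivative 2 * \<theta>) (at x)" by (auto intro!: derivative_eq_intros)
    from has_vector_derivative_mult_right[OF has_vector_derivative_of_real[OF this], of \<i>]
    show ?thesis unfolding q_def[abs_def] .
  qed
  have d2: "((\<lambda>x. q x * phase \<theta> x) has_vector_derivative
      q x * (q x * phase \<theta> x) + \<i> * of_real (2 * \<theta>) * phase \<theta> x) (at x)" for x
    by (intro has_vector_derivative_mult dq d)
  have "continuous_on {0<..} (\<lambda>x. q x * (q x * phase \<theta> x) + \<i> * of_real (2 * \<theta>) * phase \<theta> x)"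
    unfolding q_def phase_def[abs_def] by (intro continuous_intros)
  with d d2 have "C2_on_halfline (phase \<theta>) (\<lambda>x. q x * phase \<theta> x)
      (\<lambda>x. q x * (q x * phase \<theta> x) + \<i> * of_real (2 * \<theta>) * phase \<theta> x)"
    by (simp add: C2_on_halfline_def)
  then show ?thesis by (rule that)
qed

lemma phase_mult_gauss: "phase \<theta> x * gauss c z x = gauss c (z - 2 * \<i> * of_real \<theta>) x"
proof -
  have "\<i> * of_real (\<theta> * x\<^sup>2) + - z * of_real (x\<^sup>2) / 2 = - (z - 2 * \<i> * of_real \<theta>) * of_real (x\<^sup>2) / 2"
    by (simp add: algebra_simps diff_divide_distrib add_divide_distrib)
  then have "exp (\<i> * of_real (\<theta> * x\<^sup>2)) * exp (- z * of_real (x\<^sup>2) / 2)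
      = exp (- (z - 2 * \<i> * of_real \<theta>) * of_real (x\<^sup>2) / 2)"
    unfolding exp_add[symmetric] by (rule arg_cong)
  then show ?thesis unfolding phase_def gauss_def by (simp only: mult.left_commute)
qed

text \<open>V t is bounded and linear and therefore commutes with the derivative of
  \<open>Gam\<close> along the real direction of \<zeta>.\<close>

lemma flow_dGam:
  assumes c: "1/2 \<le> c" and V: "hl2_flow_of V (friedrichs c)" and \<zeta>: "0 < Re \<zeta>"
  shows "V t (dGam c \<zeta>) = dGam c (\<zeta> + of_real t * (2 * \<i>))"
proof -
  have c0: "0 \<le> c" using c by simp
  have flow: "hl2_flow V" using V by (simp add: hl2_flow_of_def)
  let ?w = "\<zeta> + of_real t * (2 * \<i>)"
  have "((\<lambda>s. Gam c (\<zeta> + of_real s * 1)) has_vector_derivative dGam c \<zeta>) (at 0)"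
    using Gam_has_vector_derivative[of \<zeta> 0 1 c] \<zeta> c0 by simp
  then have 1: "((\<lambda>s. V t (Gam c (\<zeta> + of_real s * 1))) has_vector_derivative V t (dGam c \<zeta>)) (at 0)"
    by (rule bounded_linear.has_vector_derivative[OF flow_bounded_linear[OF flow]])
  have "((\<lambda>s. Gam c (?w + of_real s * 1)) has_vector_derivative V t (dGam c \<zeta>)) (at 0)"
  proof (rule has_vector_derivative_transform_within_open[OF 1])
    show "open {- Re \<zeta><..}" "(0::real) \<in> {- Re \<zeta><..}" using \<zeta> by auto
    fix s assume "s \<in> {- Re \<zeta><..}"
    then show "V t (Gam c (\<zeta> + of_real s * 1)) = Gam c (?w + of_real s * 1)"
      using flow_of_friedrichs_Gam[OF c V, of "\<zeta> + of_real s" t] by (simp add: algebra_simps)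
  qed
  moreover have "((\<lambda>s. Gam c (?w + of_real s * 1)) has_vector_derivative dGam c ?w) (at 0)"
    using Gam_has_vector_derivative[of ?w 0 1 c] \<zeta> c0 by simp
  ultimately show ?thesis using vector_derivative_unique_at by blast
qed

text \<open>Conjugating \<open>4 t\<^sup>2 H\<close> with \<open>exp (i x\<^sup>2 / 4 t)\<close> turns it into \<open>exp (i t H) x\<^sup>2 exp (- i t H)\<close>.\<close>

lemma intertwining_symbol:
  fixes \<omega> :: complex
  assumes t: "t \<noteq> 0" and w: "\<omega>' = \<omega> - 2 * \<i> * of_real t" "\<omega>' \<noteq> 0"
  defines "z \<equiv> 1 / \<omega>' - 2 * \<i> * of_real (1 / (4 * t))"
  shows "of_real (4 * t\<^sup>2) * (z * of_real (1 + 2 * c) - z\<^sup>2 * of_real (x\<^sup>2))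
    = 2 * \<omega>\<^sup>2 * dgam_factor c \<omega>' x + \<omega> * of_real (1 + 2 * c)"
proof -
  define T where "T = complex_of_real t"
  define k where "k = complex_of_real (1 + 2 * c)"
  define y where "y = complex_of_real (x\<^sup>2)"
  have T: "T \<noteq> 0" using t by (simp add: T_def)
  have om: "\<omega> = \<omega>' + 2 * \<i> * T" using w(1) by (simp add: T_def)
  have k2: "complex_of_real (c + 1/2) = k / 2" by (simp add: k_def)
  \<comment> \<open>The coefficient 1/(4 t) of the phase is the one that makes z proportional to
    \<omega>: it contributes 1/(2 \<i> t) to z, and \<omega>' + 2 \<i> t = \<omega>.\<close>
  have z: "z = \<omega> / (2 * \<i> * T * \<omega>')"
    unfolding z_def om using T w(2) by (simp add: field_simps T_def)
  have "of_real (4 * t\<^sup>2) * (z * k - z\<^sup>2 * y) = 4 * T\<^sup>2 * z * k - (4 * T\<^sup>2 * z\<^sup>2) * y"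
    by (simp add: T_def algebra_simps)
  also have "4 * T\<^sup>2 * z = - (2 * \<i> * T) * \<omega> / \<omega>'"
    unfolding z using T w(2) by (simp add: field_simps power2_eq_square)
  also have "4 * T\<^sup>2 * z\<^sup>2 = - (\<omega>\<^sup>2 / \<omega>'\<^sup>2)"
    unfolding z using T w(2) by (simp add: field_simps power2_eq_square)
  also have "- (2 * \<i> * T) * \<omega> / \<omega>' * k - - (\<omega>\<^sup>2 / \<omega>'\<^sup>2) * y = 2 * \<omega>\<^sup>2 * (y / (2 * \<omega>'\<^sup>2) - (k / 2) / \<omega>') + \<omega> * k"
    unfolding om using w(2) by (simp add: field_simps power2_eq_square)
  finally show ?thesis unfolding dgam_factor_def k2 k_def y_def .
qed

lemma C2_L2_mult_phase:
  assumes "f \<in> L2 halfline"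
  shows "(\<lambda>x. phase \<theta> x * f x) \<in> L2 halfline" "(\<lambda>x. wave k x * f x) \<in> L2 halfline"
proof -
  have [measurable]: "f \<in> borel_measurable halfline" using assms by (rule L2_measurable)
  show "(\<lambda>x. phase \<theta> x * f x) \<in> L2 halfline" "(\<lambda>x. wave k x * f x) \<in> L2 halfline"
    by (rule L2_bound[OF assms, where C = 1]; simp add: norm_mult)+
qed

lemma norm_cls_unimodular:
  assumes f: "f \<in> L2 halfline"
  shows "norm (cls (\<lambda>x. phase \<theta> x * f x)) = norm (cls f)" "norm (cls (\<lambda>x. wave k x * f x)) = norm (cls f)"
  by (simp_all add: norm_cls C2_L2_mult_phase f L2_norm_def norm_mult)

text \<open>The difference of both sides is tested against real Gaussians at \<omega> = 1/(n+1). V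
  (- t) moves them to \<omega>' = \<omega> - 2 \<i> t, Green's formula moves S onto them, and
  \<open>intertwining_symbol\<close> matches the result with x^2 at \<omega>. The relation is
  pointwise because square integrability of x^2 times the evolved function is not known in advance,
  whereas its products with Gaussians are integrable.\<close>

proposition flow_intertwining:
  assumes c: "1/2 \<le> c" and V: "hl2_flow_of V (friedrichs c)" and t: "t \<noteq> 0"
    and \<phi>: "C2_on_halfline \<phi> \<phi>' \<phi>''" and ab: "0 < a" "a \<le> b"
    and supp: "\<And>x. 0 < x \<Longrightarrow> x \<notin> {a..b} \<Longrightarrow> \<phi> x = 0"
  defines "\<theta> \<equiv> 1 / (4 * t)"
  shows "AE x in halfline. rep_hl2 (V t (cls (\<lambda>x. phase (- \<theta>) x * (of_real (4 * t\<^sup>2) * S_op c \<phi> \<phi>'' x)))) x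
    = of_real (x\<^sup>2) * rep_hl2 (V t (cls (\<lambda>x. phase (- \<theta>) x * \<phi> x))) x"
proof -
  have c0: "0 \<le> c" using c by simp
  have flow: "hl2_flow V" using V by (simp add: hl2_flow_of_def)
  note lin = flow_linear[OF flow]
  define f where "f x = phase (- \<theta>) x * \<phi> x" for x
  define w where "w x = phase (- \<theta>) x * (of_real (4 * t\<^sup>2) * S_op c \<phi> \<phi>'' x)" for x
  note \<phi>L = L2_of_C2_compact_support[OF \<phi> ab(1) supp]
  have fL: "f \<in> L2 halfline" unfolding f_def[abs_def] by (intro C2_L2_mult_phase \<phi>L)
  have wL: "w \<in> L2 halfline" unfolding w_def[abs_def] by (intro C2_L2_mult_phase L2_scale \<phi>L)
  have step: "L2_inner halfline w (gam c (\<omega> - 2 * \<i> * of_real t))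
      = L2_inner halfline f (\<lambda>x. (2 * \<omega>\<^sup>2 * dgam_factor c (\<omega> - 2 * \<i> * of_real t) x + \<omega> * of_real (1 + 2 * c))
          * gam c (\<omega> - 2 * \<i> * of_real t) x)"
    if \<omega>: "0 < Re \<omega>" for \<omega>
  proof -
    define \<omega>' where "\<omega>' = \<omega> - 2 * \<i> * of_real t"
    have w': "\<omega>' \<noteq> 0" using \<omega> by (auto simp: \<omega>'_def complex_eq_iff)
    define k where "k = \<omega>' powr (- of_real (c + 1/2))"
    define z where "z = 1 / \<omega>' - 2 * \<i> * of_real (1 / (4 * t))"
    define v where "v x = k * gauss c z x" for x
    have pg: "phase \<theta> x * gam c \<omega>' x = v x" for x
      unfolding gam_def v_def k_def z_def \<theta>_def using phase_mult_gauss[of "1 / (4 * t)" x c "1 / \<omega>'"]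
      by (simp add: mult.left_commute)
    have Cv: "C2_on_halfline v (\<lambda>x. k * gauss' c z x) (\<lambda>x. k * gauss'' c z x)"
      unfolding v_def[abs_def] by (rule C2_scale[OF gauss_C2])
    have "L2_inner halfline w (gam c \<omega>') = of_real (4 * t\<^sup>2) * L2_inner halfline (S_op c \<phi> \<phi>'') v"
    proof -
      have "w x * cnj (gam c \<omega>' x) = of_real (4 * t\<^sup>2) * (S_op c \<phi> \<phi>'' x * cnj (v x))" for x
        unfolding w_def pg[symmetric] by (simp add: cnj_phase mult_ac)
      then show ?thesis unfolding L2_inner_def by simp
    qed
    also have "L2_inner halfline (S_op c \<phi> \<phi>'') v = L2_inner halfline \<phi> (S_op c v (\<lambda>x. k * gauss'' c z x))"
      by (rule green_symmetric[OF \<phi> Cv ab]) (use supp in blast)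
    also have "of_real (4 * t\<^sup>2) * L2_inner halfline \<phi> (S_op c v (\<lambda>x. k * gauss'' c z x))
      = L2_inner halfline f (\<lambda>x. (2 * \<omega>\<^sup>2 * dgam_factor c \<omega>' x + \<omega> * of_real (1 + 2 * c)) * gam c \<omega>' x)"
    proof -
      have "of_real (4 * t\<^sup>2) * (\<phi> x * cnj (S_op c v (\<lambda>x. k * gauss'' c z x) x))
        = f x * cnj ((2 * \<omega>\<^sup>2 * dgam_factor c \<omega>' x + \<omega> * of_real (1 + 2 * c)) * gam c \<omega>' x)"
        if x: "x \<in> space halfline" for x
      proof -
        have "0 < x" using x by (simp add: halfline_def)
        have 1: "of_real (4 * t\<^sup>2) * cnj (S_op c v (\<lambda>x. k * gauss'' c z x) x)
            = cnj (of_real (4 * t\<^sup>2) * (z * of_real (1 + 2 * c) - z\<^sup>2 * of_real (x\<^sup>2)) * v x)"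
          unfolding v_def[abs_def] S_op_gauss[OF \<open>0 < x\<close>] by simp
        have 2: "of_real (4 * t\<^sup>2) * (z * of_real (1 + 2 * c) - z\<^sup>2 * of_real (x\<^sup>2))
            = 2 * \<omega>\<^sup>2 * dgam_factor c \<omega>' x + \<omega> * of_real (1 + 2 * c)"
          unfolding z_def by (rule intertwining_symbol[OF t \<omega>'_def w'])
        have "of_real (4 * t\<^sup>2) * (\<phi> x * cnj (S_op c v (\<lambda>x. k * gauss'' c z x) x))
          = \<phi> x * cnj ((2 * \<omega>\<^sup>2 * dgam_factor c \<omega>' x + \<omega> * of_real (1 + 2 * c)) * v x)"
          using 1 unfolding 2 by (simp add: mult.left_commute)
        also have "\<dots> = f x * cnj ((2 * \<omega>\<^sup>2 * dgam_factor c \<omega>' x + \<omega> * of_real (1 + 2 * c)) * gam c \<omega>' x)"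
          unfolding pg[symmetric] f_def by (simp add: cnj_phase mult_ac)
        finally show ?thesis .
      qed
      then have "(LINT x|halfline. of_real (4 * t\<^sup>2) * (\<phi> x * cnj (S_op c v (\<lambda>x. k * gauss'' c z x) x)))
        = (LINT x|halfline. f x * cnj ((2 * \<omega>\<^sup>2 * dgam_factor c \<omega>' x + \<omega> * of_real (1 + 2 * c)) * gam c \<omega>' x))"
        by (rule Bochner_Integration.integral_cong[OF refl])
      then show ?thesis unfolding L2_inner_def by simp
    qed
    finally show ?thesis unfolding \<omega>'_def .
  qed
  define F where "F = V t (cls f)"
  define W where "W = V t (cls w)"
  have "AE x in halfline. rep_hl2 W x - of_real (x\<^sup>2) * rep_hl2 F x = 0"
  proof (rule gauss_orthogonal_AE_zero[of _ c])
    fix n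
    define g where "g = gauss c (of_nat (Suc n))"
    define g2 where "g2 x = of_real (x ^ 2) * g x" for x
    define \<omega> where "\<omega> = 1 / complex_of_nat (Suc n)"
    have Re: "0 < Re \<omega>" unfolding \<omega>_def by (simp add: Re_divide_of_nat del: of_nat_Suc)
    have w0: "\<omega> \<noteq> 0" using Re by auto
    define \<omega>' where "\<omega>' = \<omega> - 2 * \<i> * of_real t"
    have Re': "0 < Re \<omega>'" using Re by (simp add: \<omega>'_def)
    have \<omega>'_eq: "\<omega> + of_real (- t) * (2 * \<i>) = \<omega>'" by (simp add: \<omega>'_def)
    define p where "p = \<omega> powr (- of_real (c + 1/2))"
    have p: "p \<noteq> 0" using w0 by (simp add: p_def)
    have gL: "g \<in> L2 halfline" "g2 \<in> L2 halfline"
      using gauss_L2[of "of_nat (Suc n)" c 0] gauss_L2[of "of_nat (Suc n)" c 2] c0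
      by (simp_all add: g_def g2_def[abs_def])
    have greal: "cnj (g x) = g x" for x unfolding g_def gauss_def by (simp add: exp_cnj)
    have gam_g: "gam c \<omega> = (\<lambda>x. p * g x)"
      by (simp add: fun_eq_iff gam_real_eq \<omega>_def p_def g_def del: of_nat_Suc)
    have clsg: "cmul p (cls g) = Gam c \<omega>" unfolding Gam_def gam_g by (simp add: cls_cmul gL)
    \<comment> \<open>On the Gaussians multiplication by x^2 is the first order operator 2
      \<omega>^2 d/d\<omega> + \<omega> (1 + 2 c) in the parameter. V (- t) replaces \<omega> by
      \<omega>' in \<open>Gam\<close> and \<open>dGam\<close> but not in these coefficients, which
      is how \<omega> and \<omega>' both enter \<open>intertwining_symbol\<close>.\<close>
    have clsg2: "cmul p (cls g2) = cmul (2 * \<omega>\<^sup>2) (dGam c \<omega>) + cmul (\<omega> * of_real (1 + 2 * c)) (Gam c \<omega>)"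
    proof -
      have "p * g2 x = 2 * \<omega>\<^sup>2 * dgam c \<omega> x + \<omega> * of_real (1 + 2 * c) * gam c \<omega> x" for x
      proof -
        have "2 * \<omega>\<^sup>2 * dgam_factor c \<omega> x + \<omega> * of_real (1 + 2 * c) = of_real (x ^ 2)"
        proof -
          have "complex_of_real (1 + 2 * c) = 2 * of_real (c + 1/2)" by simp
          then show ?thesis unfolding dgam_factor_def using w0
            by (simp add: field_simps power2_eq_square del: of_real_add)
        qed
        then have "of_real (x ^ 2) * gam c \<omega> x = 2 * \<omega>\<^sup>2 * dgam c \<omega> x + \<omega> * of_real (1 + 2 * c) * gam c \<omega> x"
          unfolding dgam_def by (metis distrib_right mult.assoc)
        then show ?thesis unfolding gam_g g2_def by (simp add: mult_ac)
      qed
      then have "cls (\<lambda>x. p * g2 x) = cls (\<lambda>x. 2 * \<omega>\<^sup>2 * dgam c \<omega> x + \<omega> * of_real (1 + 2 * c) * gam c \<omega> x)" by simp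
      then show ?thesis
        unfolding Gam_def dGam_def by (simp only: cls_add cls_cmul L2_scale gL gam_L2[OF Re c0])
    qed
    have Vg: "V (- t) (cmul p (cls g)) = Gam c \<omega>'"
      unfolding clsg using flow_of_friedrichs_Gam[OF c V Re, of "- t"] unfolding \<omega>'_eq .
    have Vg2: "V (- t) (cmul p (cls g2))
        = cls (\<lambda>x. (2 * \<omega>\<^sup>2 * dgam_factor c \<omega>' x + \<omega> * of_real (1 + 2 * c)) * gam c \<omega>' x)"
    proof -
      have "V (- t) (cmul p (cls g2)) = cmul (2 * \<omega>\<^sup>2) (dGam c \<omega>') + cmul (\<omega> * of_real (1 + 2 * c)) (Gam c \<omega>')"
        unfolding clsg2 using flow_of_friedrichs_Gam[OF c V Re, of "- t"] flow_dGam[OF c V Re, of "- t"]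
        unfolding \<omega>'_eq by (simp add: linear_add[OF lin] flow_cmul[OF flow])
      also have "\<dots> = cls (\<lambda>x. 2 * \<omega>\<^sup>2 * dgam c \<omega>' x + \<omega> * of_real (1 + 2 * c) * gam c \<omega>' x)"
        unfolding Gam_def dGam_def by (simp only: cls_add cls_cmul L2_scale gam_L2[OF Re' c0])
      finally show ?thesis unfolding dgam_def by (simp only: distrib_right mult.assoc)
    qed
    have mL: "(\<lambda>x. (2 * \<omega>\<^sup>2 * dgam_factor c \<omega>' x + \<omega> * of_real (1 + 2 * c)) * gam c \<omega>' x) \<in> L2 halfline"
    proof -
      have "(\<lambda>x. 2 * \<omega>\<^sup>2 * dgam c \<omega>' x + \<omega> * of_real (1 + 2 * c) * gam c \<omega>' x) \<in> L2 halfline"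
        by (intro L2_add L2_scale gam_L2[OF Re' c0])
      then show ?thesis unfolding dgam_def by (simp only: distrib_right mult.assoc)
    qed
    \<comment> \<open>The scalars q = 1 and q = \<i> give the real and the imaginary part of the
      complex identity.\<close>
    have key: "inner W (cmul q (cls g)) = inner F (cmul q (cls g2))" for q
    proof -
      define r where "r = q / p"
      have qr: "cmul q x = cmul r (cmul p x)" for x using p by (simp add: r_def)
      have *: "inner (cls u) (cmul r (cls v)) = Re (cnj r * L2_inner halfline u v)"
        if "u \<in> L2 halfline" "v \<in> L2 halfline" for u v
      proof -
        have "L2_inner halfline u (\<lambda>x. r * v x) = cnj r * L2_inner halfline u v"
          unfolding L2_inner_def by (simp flip: integral_mult_right_zero add: mult_ac)
        then show ?thesis
          unfolding cls_cmul[OF that(2), symmetric] inner_cls[OF that(1) L2_scale[OF that(2)]] by simp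
      qed
      have "inner W (cmul q (cls g)) = inner (cls w) (cmul r (cls (gam c \<omega>')))"
        unfolding W_def qr flow_inner_adjoint[OF flow] flow_cmul[OF flow, of "- t" r] Vg Gam_def ..
      also have "\<dots> = inner (cls f) (cmul r (cls (\<lambda>x. (2 * \<omega>\<^sup>2 * dgam_factor c \<omega>' x
          + \<omega> * of_real (1 + 2 * c)) * gam c \<omega>' x)))"
        unfolding *[OF wL gam_L2(1)[OF Re' c0]] *[OF fL mL] using step[OF Re] unfolding \<omega>'_def by simp
      also have "\<dots> = inner F (cmul q (cls g2))"
        unfolding F_def qr flow_inner_adjoint[OF flow] flow_cmul[OF flow, of "- t" r] Vg2 ..
      finally show ?thesis .
    qed
    have i1: "integrable halfline (\<lambda>x. rep_hl2 W x * g x)"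
      using L2_inner_integrable[OF rep_L2 gL(1), of W] unfolding greal .
    have i2: "integrable halfline (\<lambda>x. rep_hl2 F x * g2 x)"
      using L2_inner_integrable[OF rep_L2 gL(2), of F] by (simp add: g2_def greal)
    have Z: "(rep_hl2 W x - of_real (x\<^sup>2) * rep_hl2 F x) * g x = rep_hl2 W x * g x - rep_hl2 F x * g2 x" for x
      by (simp add: g2_def algebra_simps)
    show "integrable halfline (\<lambda>x. (rep_hl2 W x - of_real (x\<^sup>2) * rep_hl2 F x) * gauss c (of_nat (Suc n)) x)"
      unfolding g_def[symmetric] Z by (intro Bochner_Integration.integrable_diff i1 i2)
    have "L2_inner halfline (rep_hl2 W) g = L2_inner halfline (rep_hl2 F) g2"
      using key[of 1] key[of \<i>] by (simp add: L2_inner_eq_inner gL)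
    then have "(LINT x|halfline. rep_hl2 W x * g x) = (LINT x|halfline. rep_hl2 F x * g2 x)"
      unfolding L2_inner_def by (simp add: g2_def greal)
    then show "(LINT x|halfline. (rep_hl2 W x - of_real (x\<^sup>2) * rep_hl2 F x) * gauss c (of_nat (Suc n)) x) = 0"
      unfolding g_def[symmetric] Z using i1 i2 by simp
  qed
  then show ?thesis unfolding F_def W_def f_def[abs_def] w_def[abs_def] by simp
qed

section \<open>Wave packets leave bounded sets\<close>

definition restr :: "real set \<Rightarrow> hl2 \<Rightarrow> hl2" where
  "restr B u = cls (\<lambda>x. of_real (indicator B x) * rep_hl2 u x)"

lemma restr_fun_L2:
  assumes "f \<in> L2 halfline" "B \<in> sets borel"
  shows "(\<lambda>x. of_real (indicator B x) * f x) \<in> L2 halfline"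
proof (rule L2_multiplier[OF assms(1), of _ 1])
  show "(indicator B :: real \<Rightarrow> real) \<in> borel_measurable halfline"
    using measurable_compose[OF measurable_halfline_ident borel_measurable_indicator[OF assms(2)]] .
qed (auto simp: indicator_def)

lemma restr_cls:
  assumes f: "f \<in> L2 halfline" and B: "B \<in> sets borel"
  shows "restr B (cls f) = cls (\<lambda>x. of_real (indicator B x) * f x)"
  unfolding restr_def cls_eq_iff[OF restr_fun_L2[OF rep_L2 B] restr_fun_L2[OF f B]]
  using rep_cls[OF f] by eventually_elim simp

lemma norm_restr_cls_power2:
  assumes f: "f \<in> L2 halfline" and B: "B \<in> sets borel"
  shows "(norm (restr B (cls f)))\<^sup>2 = (LINT x:B|halfline. (cmod (f x))\<^sup>2)"
proof -
  have "(cmod (of_real (indicator B x) * f x))\<^sup>2 = indicator B x *\<^sub>R (cmod (f x))\<^sup>2" for x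
    by (simp add: indicator_def)
  then show ?thesis
    unfolding restr_cls[OF f B] norm_cls_power2[OF restr_fun_L2[OF f B]] set_lebesgue_integral_def by simp
qed

lemma norm_restr_le: "B \<in> sets borel \<Longrightarrow> norm (restr B u) \<le> norm u"
  using norm_cls_mono[OF restr_fun_L2[OF rep_L2] rep_L2, of B u u]
  by (simp add: restr_def norm_mult indicator_def)

lemma restr_bounded_linear:
  assumes B: "B \<in> sets borel"
  shows "bounded_linear (restr B)"
proof (rule bounded_linear_intro[where K = 1])
  fix x y :: hl2 and r :: real
  have "restr B (x + y) = restr B (cls (\<lambda>z. rep_hl2 x z + rep_hl2 y z))"
    by (simp add: cls_add)
  also have "\<dots> = restr B x + restr B y"
    unfolding restr_cls[OF L2_add[OF rep_L2 rep_L2] B] unfolding restr_def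
    by (simp add: distrib_left cls_add restr_fun_L2 B)
  finally show "restr B (x + y) = restr B x + restr B y" .
  have "restr B (r *\<^sub>R x) = restr B (cls (\<lambda>z. of_real r * rep_hl2 x z))"
    by (simp add: cls_cmul)
  also have "\<dots> = cls (\<lambda>z. of_real r * (of_real (indicator B z) * rep_hl2 x z))"
    unfolding restr_cls[OF L2_scale[OF rep_L2] B] by (simp add: mult.left_commute)
  also have "\<dots> = r *\<^sub>R restr B x"
    unfolding restr_def by (simp only: cls_cmul[OF restr_fun_L2[OF rep_L2 B]] cmul_of_real)
  finally show "restr B (r *\<^sub>R x) = r *\<^sub>R restr B x" .
  show "norm (restr B x) \<le> norm x * 1" using norm_restr_le[OF B] by simp
qed

lemma norm_restr_le_of_intertwining:
  assumes B: "B \<in> sets borel" "\<And>x. x \<in> B \<Longrightarrow> 0 < x \<Longrightarrow> x\<^sup>2 \<le> K" and K: "0 \<le> K"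
    and eq: "AE x in halfline. rep_hl2 w x = of_real (x\<^sup>2) * rep_hl2 u x"
  shows "norm (restr B w) \<le> K * norm u"
proof -
  have "norm (restr B w) \<le> norm (cls (\<lambda>x. of_real K * rep_hl2 u x))"
    unfolding restr_def
  proof (rule norm_cls_mono[OF restr_fun_L2[OF rep_L2 B(1)] L2_scale[OF rep_L2]])
    have "AE x in halfline. 0 < x" by (rule halfline_AE_I)
    with eq show "AE x in halfline. cmod (of_real (indicator B x) * rep_hl2 w x) \<le> cmod (of_real K * rep_hl2 u x)"
    proof eventually_elim
      case (elim x)
      show ?case
      proof (cases "x \<in> B")
        case True
        then show ?thesis using elim B(2)[OF True] K
          by (simp add: norm_mult norm_power mult_right_mono)
      qed simp
    qed
  qed
  also have "\<dots> = K * norm u" using K by (simp add: cls_cmul)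
  finally show ?thesis .
qed

proposition packet_escapes:
  assumes c: "1/2 \<le> c" and V: "hl2_flow_of V (friedrichs c)" and t: "t \<noteq> 0"
    and \<beta>: "C2_on_halfline \<beta> \<beta>' \<beta>''" and ab: "0 < a" "a \<le> b"
    and supp: "\<And>x. 0 < x \<Longrightarrow> x \<notin> {a..b} \<Longrightarrow> \<beta> x = 0"
    and B: "B \<in> sets borel" "bounded B"
  shows "(\<lambda>k. norm (restr B (V t (cls (\<lambda>x. wave (real (Suc k)) x * \<beta> x))))) \<longlonglongrightarrow> 0"
proof -
  have flow: "hl2_flow V" using V by (simp add: hl2_flow_of_def)
  define \<theta> where "\<theta> = 1 / (4 * t)"
  obtain p' p'' where P: "C2_on_halfline (phase \<theta>) p' p''" using phase_C2 by blast
  note \<eta>C = C2_mult[OF P \<beta>]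
  \<comment> \<open>The intertwining relation is about
    \<open>phase (- \<theta>) x * \<phi> x\<close>, so the opposite phase is put into the amplitude.
    The amplitude then depends on t, the packet itself does not.\<close>
  define \<eta> where "\<eta> x = phase \<theta> x * \<beta> x" for x
  define \<eta>' where "\<eta>' x = phase \<theta> x * \<beta>' x + p' x * \<beta> x" for x
  define \<eta>'' where "\<eta>'' x = phase \<theta> x * \<beta>'' x + 2 * (p' x * \<beta>' x) + p'' x * \<beta> x" for x
  have \<eta>: "C2_on_halfline \<eta> \<eta>' \<eta>''"
    using \<eta>C unfolding \<eta>_def[abs_def] \<eta>'_def[abs_def] \<eta>''_def[abs_def] .
  have \<eta>s: "\<eta> x = 0" if "0 < x" "x \<notin> {a..b}" for x using supp[OF that] by (simp add: \<eta>_def)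
  have \<eta>L: "\<eta>' \<in> L2 halfline" "S_op c \<eta> \<eta>'' \<in> L2 halfline"
    using L2_continuous_compact_support[OF ab(1) C2_continuous(2)[OF \<eta>], of b] C2_support(1)[OF \<eta> \<eta>s]
      L2_of_C2_compact_support(3)[OF \<eta> ab(1) \<eta>s] by blast+
  have \<beta>L: "\<beta> \<in> L2 halfline" by (rule L2_of_C2_compact_support(1)[OF \<beta> ab(1) supp])
  obtain R where R: "\<And>x. x \<in> B \<Longrightarrow> \<bar>x\<bar> \<le> R" using B(2) by (auto simp: bounded_iff)
  have K: "x\<^sup>2 \<le> R\<^sup>2" if "x \<in> B" "0 < x" for x
    using R[OF that(1)] by (intro abs_le_square_iff[THEN iffD1]) (use that in auto)
  define F where "F k = cls (\<lambda>x. wave (real (Suc k)) x * \<beta> x)" for k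
  define M where "M = 2 * norm (cls \<eta>') + norm (cls (S_op c \<eta> \<eta>''))"
  define D where "D = M + R\<^sup>2 / (4 * t\<^sup>2) * norm (cls \<beta>)"
  have "norm (restr B (V t (F k))) \<le> D / real (Suc k)" for k
  proof -
    define \<kappa> where "\<kappa> = real (Suc k)"
    have \<kappa>: "1 \<le> \<kappa>" by (simp add: \<kappa>_def)
    define f where "f x = wave \<kappa> x * \<beta> x" for x
    have Fk: "F k = cls f" by (simp add: F_def f_def[abs_def] \<kappa>_def)
    define \<phi> where "\<phi> x = wave \<kappa> x * \<eta> x" for x
    define \<phi>' where "\<phi>' x = wave \<kappa> x * \<eta>' x + (\<i> * of_real \<kappa>) * wave \<kappa> x * \<eta> x" for x
    define \<phi>'' where "\<phi>'' x = wave \<kappa> x * \<eta>'' x + 2 * ((\<i> * of_real \<kappa>) * wave \<kappa> x * \<eta>' x)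
        + (- of_real (\<kappa>\<^sup>2) * wave \<kappa> x) * \<eta> x" for x
    have \<phi>: "C2_on_halfline \<phi> \<phi>' \<phi>''"
      using C2_mult[OF wave_C2 \<eta>, of \<kappa>] unfolding \<phi>_def[abs_def] \<phi>'_def[abs_def] \<phi>''_def[abs_def] .
    have \<phi>s: "\<phi> x = 0" if "0 < x" "x \<notin> {a..b}" for x using \<eta>s[OF that] by (simp add: \<phi>_def)
    have f: "f = (\<lambda>x. phase (- \<theta>) x * \<phi> x)"
    proof
      fix x
      have "phase (- \<theta>) x * \<phi> x = (phase (- \<theta>) x * phase \<theta> x) * f x"
        by (simp add: \<phi>_def \<eta>_def f_def mult_ac)
      then show "f x = phase (- \<theta>) x * \<phi> x" by (simp add: phase_minus)
    qed
    define w where "w x = phase (- \<theta>) x * (of_real (4 * t\<^sup>2) * S_op c \<phi> \<phi>'' x)" for x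
    \<comment> \<open>With e = \<open>wave \<kappa>\<close> the product rule gives S (e \<eta>) =
      \<kappa>^2 e \<eta> - 2 \<i> \<kappa> e \<eta>' + e S \<eta>. Solving for e \<eta> yields f =
      r + q w: r collects the terms where at most one derivative falls on the wave and has norm of
      order 1/\<kappa>, and q cancels the factor 4 t^2 in w.\<close>
    define r where "r x = phase (- \<theta>) x * (wave \<kappa> x *
        (of_real (1 / \<kappa>\<^sup>2) * (2 * \<i> * of_real \<kappa> * \<eta>' x - S_op c \<eta> \<eta>'' x)))" for x
    have fL: "f \<in> L2 halfline" unfolding f_def[abs_def] by (intro C2_L2_mult_phase \<beta>L)
    have wL: "w \<in> L2 halfline" unfolding w_def[abs_def]
      by (intro C2_L2_mult_phase L2_scale L2_of_C2_compact_support(3)[OF \<phi> ab(1) \<phi>s])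
    have iL: "(\<lambda>x. 2 * \<i> * of_real \<kappa> * \<eta>' x - S_op c \<eta> \<eta>'' x) \<in> L2 halfline"
      by (intro L2_diff L2_scale \<eta>L)
    have rL: "r \<in> L2 halfline" unfolding r_def[abs_def] by (intro C2_L2_mult_phase L2_scale iL)
    define q where "q = 1 / (4 * t\<^sup>2 * \<kappa>\<^sup>2)"
    have split: "f x = r x + of_real q * w x" for x
    proof -
      define e where "e = wave \<kappa> x"
      define v where "v = complex_of_real ((c\<^sup>2 - c) * (1 / x\<^sup>2))"
      define m where "m = complex_of_real (1 / \<kappa>\<^sup>2)"
      have m: "m * of_real (\<kappa>\<^sup>2) = 1" using \<kappa> by (simp add: m_def flip: of_real_mult)
      have qm: "of_real q * of_real (4 * t\<^sup>2) = m" 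
      proof -
        have "q * (4 * t\<^sup>2) = 1 / \<kappa>\<^sup>2" using t by (simp add: q_def)
        then show ?thesis unfolding m_def of_real_mult[symmetric] by (rule arg_cong)
      qed
      have "r x + of_real q * w x = phase (- \<theta>) x * (e * (m * (2 * \<i> * of_real \<kappa> * \<eta>' x - S_op c \<eta> \<eta>'' x))
          + (of_real q * of_real (4 * t\<^sup>2)) * S_op c \<phi> \<phi>'' x)"
        unfolding r_def w_def e_def m_def by (simp only: distrib_left mult_ac)
      also have "\<dots> = phase (- \<theta>) x * ((m * of_real (\<kappa>\<^sup>2)) * (e * \<eta> x))"
        unfolding qm S_op_def \<phi>''_def \<phi>_def e_def[symmetric] v_def[symmetric] by (simp add: algebra_simps del: of_real_power)
      also have "\<dots> = f x" unfolding m f \<phi>_def e_def by simp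
      finally show ?thesis by simp
    qed
    have "f = (\<lambda>x. r x + of_real q * w x)" using split by blast
    then have "cls f = cls r + q *\<^sub>R cls w"
      using cls_add[OF rL L2_scale[OF wL]] cls_cmul[OF wL] by simp
    then have VF: "restr B (V t (F k)) = restr B (V t (cls r)) + q *\<^sub>R restr B (V t (cls w))"
      unfolding Fk by (simp add: linear_add[OF flow_linear[OF flow]] linear_scale[OF flow_linear[OF flow]]
          linear_simps[OF restr_bounded_linear[OF B(1)]])
    have n1: "norm (restr B (V t (cls r))) \<le> M / \<kappa>"
    proof -
      have "norm (restr B (V t (cls r))) \<le> norm (cls r)"
        using norm_restr_le[OF B(1)] flow_norm[OF flow] by metis
      also have "\<dots> = (1 / \<kappa>\<^sup>2) * norm (cls (\<lambda>x. 2 * \<i> * of_real \<kappa> * \<eta>' x - S_op c \<eta> \<eta>'' x))"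
        unfolding r_def[abs_def] norm_cls_unimodular(1)[OF C2_L2_mult_phase(2)[OF L2_scale[OF iL]]]
          norm_cls_unimodular(2)[OF L2_scale[OF iL]] cls_cmul[OF iL] norm_cmul norm_of_real by simp
      also have "cls (\<lambda>x. 2 * \<i> * of_real \<kappa> * \<eta>' x - S_op c \<eta> \<eta>'' x)
          = cmul (2 * \<i> * of_real \<kappa>) (cls \<eta>') - cls (S_op c \<eta> \<eta>'')"
        by (simp only: cls_diff cls_cmul L2_scale \<eta>L)
      also have "(1 / \<kappa>\<^sup>2) * norm (cmul (2 * \<i> * of_real \<kappa>) (cls \<eta>') - cls (S_op c \<eta> \<eta>''))
          \<le> (1 / \<kappa>\<^sup>2) * (2 * \<kappa> * norm (cls \<eta>') + \<kappa> * norm (cls (S_op c \<eta> \<eta>'')))"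
      proof (rule mult_left_mono)
        have "norm (cmul (2 * \<i> * of_real \<kappa>) (cls \<eta>') - cls (S_op c \<eta> \<eta>''))
            \<le> norm (cmul (2 * \<i> * of_real \<kappa>) (cls \<eta>')) + norm (cls (S_op c \<eta> \<eta>''))"
          by (rule norm_triangle_ineq4)
        also have "norm (cmul (2 * \<i> * of_real \<kappa>) (cls \<eta>')) = 2 * \<kappa> * norm (cls \<eta>')"
          using \<kappa> by (simp add: norm_mult)
        also have "norm (cls (S_op c \<eta> \<eta>'')) \<le> \<kappa> * norm (cls (S_op c \<eta> \<eta>''))"
          using mult_right_mono[OF \<kappa>, of "norm (cls (S_op c \<eta> \<eta>''))"] by simp
        finally show "norm (cmul (2 * \<i> * of_real \<kappa>) (cls \<eta>') - cls (S_op c \<eta> \<eta>''))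
            \<le> 2 * \<kappa> * norm (cls \<eta>') + \<kappa> * norm (cls (S_op c \<eta> \<eta>''))" by simp
      qed simp
      also have "\<dots> = M / \<kappa>" using \<kappa> by (simp add: M_def field_simps power2_eq_square)
      finally show ?thesis .
    qed
    have n2: "norm (restr B (V t (cls w))) \<le> R\<^sup>2 * norm (cls \<beta>)"
    proof -
      have "AE x in halfline. rep_hl2 (V t (cls w)) x = of_real (x\<^sup>2) * rep_hl2 (V t (cls f)) x"
        using flow_intertwining[OF c V t \<phi> ab \<phi>s] unfolding f w_def[abs_def] \<theta>_def by simp
      then have "norm (restr B (V t (cls w))) \<le> R\<^sup>2 * norm (V t (cls f))"
        by (intro norm_restr_le_of_intertwining B K) auto
      also have "norm (V t (cls f)) = norm (cls \<beta>)"
        unfolding flow_norm[OF flow] f_def[abs_def] by (rule norm_cls_unimodular(2)[OF \<beta>L])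
      finally show ?thesis .
    qed
    have q: "0 \<le> q" "q \<le> 1 / (4 * t\<^sup>2) / \<kappa>"
    proof -
      show "0 \<le> q" by (simp add: q_def)
      have "\<kappa> \<le> \<kappa>\<^sup>2" using \<kappa> by (simp add: power2_eq_square)
      then have "1 / (4 * t\<^sup>2 * \<kappa>\<^sup>2) \<le> 1 / (4 * t\<^sup>2 * \<kappa>)"
        using \<kappa> t by (intro divide_left_mono mult_left_mono mult_pos_pos) auto
      then show "q \<le> 1 / (4 * t\<^sup>2) / \<kappa>" by (simp add: q_def)
    qed
    have "norm (restr B (V t (F k))) \<le> M / \<kappa> + q * (R\<^sup>2 * norm (cls \<beta>))"
      unfolding VF using norm_triangle_ineq[of "restr B (V t (cls r))" "q *\<^sub>R restr B (V t (cls w))"]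
        n1 mult_left_mono[OF n2 q(1)] q(1) by simp
    also have "\<dots> \<le> M / \<kappa> + (1 / (4 * t\<^sup>2) / \<kappa>) * (R\<^sup>2 * norm (cls \<beta>))"
      by (intro add_left_mono mult_right_mono q) simp
    also have "\<dots> = D / \<kappa>" by (simp add: D_def add_divide_distrib)
    finally show ?thesis by (simp add: \<kappa>_def)
  qed
  then have "\<forall>\<^sub>F k in sequentially. norm (norm (restr B (V t (F k)))) \<le> D / real (Suc k)" by simp
  moreover have "(\<lambda>k. D / real (Suc k)) \<longlonglongrightarrow> 0" by real_asymp
  ultimately show ?thesis unfolding F_def by (rule Lim_null_comparison)
qed

section \<open>The three statements on solutions\<close>

lemma normalized_bump:
  assumes ab: "0 < a" "a < b"
  obtains \<beta> where "\<beta> \<in> test_functions" "\<And>x. x \<notin> {a..b} \<Longrightarrow> \<beta> x = 0" "norm (cls \<beta>) = 1"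
proof -
  define \<psi> where "\<psi> = cut_fun a b 0 0 (\<lambda>_. 1)"
  have t: "\<psi> \<in> test_functions" unfolding \<psi>_def by (intro cut_fun_test_function ab ratfun.const)
  have supp: "\<psi> x = 0" if "x \<notin> {a..b}" for x using that by (auto simp: \<psi>_def cut_fun_def)
  have "cls \<psi> \<noteq> 0"
  proof
    assume "cls \<psi> = 0"
    then have "cls \<psi> = cls (\<lambda>x. 0)" by (simp add: cls_abs L2_zero zero_hl2_def)
    then have "AE x in lebesgue. 0 < x \<longrightarrow> \<psi> x = 0"
      using cls_eq_iff[OF test_function_L2(1)[OF t] L2_zero] by (simp add: AE_halfline)
    then have "AE x in lebesgue. x \<notin> {a<..<b}"
      by eventually_elim (use ab in \<open>auto simp: \<psi>_def cut_fun_def\<close>)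
    then have "{a<..<b} \<in> null_sets lebesgue"
      using AE_iff_null_sets[of "{a<..<b}" lebesgue] by simp
    then show False using ab by (simp add: null_sets_def)
  qed
  define \<beta> where "\<beta> x = of_real (1 / norm (cls \<psi>)) * \<psi> x" for x
  have "cls \<beta> = (1 / norm (cls \<psi>)) *\<^sub>R cls \<psi>"
    unfolding \<beta>_def[abs_def] cls_cmul[OF test_function_L2(1)[OF t]] by (rule cmul_of_real)
  then have "norm (cls \<beta>) = 1" using \<open>cls \<psi> \<noteq> 0\<close> by simp
  moreover have "\<beta> \<in> test_functions" unfolding \<beta>_def[abs_def] by (rule test_function_scale(1)[OF t])
  ultimately show ?thesis using that[of \<beta>] supp by (simp add: \<beta>_def)
qed

text \<open>The sequence is fixed before V, t and B are: the time average needs one sequence that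
  leaves bounded sets at all nonzero times.\<close>

lemma packets:
  assumes \<nu>: "0 \<le> \<nu>" and a: "0 \<le> a1" "a1 < a2"
  obtains f :: "nat \<Rightarrow> real \<Rightarrow> complex" where "\<And>k. f k \<in> L2 halfline" "\<And>k. norm (cls (f k)) = 1"
    "\<And>k x. x \<notin> {a1..a2} \<Longrightarrow> f k x = 0"
    "\<And>V t B. hl2_flow_of V (friedrichs (\<nu> + 1/2)) \<Longrightarrow> t \<noteq> 0 \<Longrightarrow> B \<in> sets borel \<Longrightarrow> bounded B \<Longrightarrow>
      (\<lambda>k. norm (restr B (V t (cls (f k))))) \<longlonglongrightarrow> 0"
proof -
  \<comment> \<open>For a1 = 0 the interval touches the origin; the bump is placed in its right
    half, at a positive distance from 0.\<close>
  define a where "a = (a1 + a2) / 2"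
  have aa: "0 < a" "a < a2" "a1 \<le> a" using a by (auto simp: a_def)
  obtain \<beta> where \<beta>: "\<beta> \<in> test_functions" "\<And>x. x \<notin> {a..a2} \<Longrightarrow> \<beta> x = 0" "norm (cls \<beta>) = 1"
    using normalized_bump[OF aa(1,2)] by blast
  have \<beta>L: "\<beta> \<in> L2 halfline" by (rule test_function_L2(1)[OF \<beta>(1)])
  show ?thesis
  proof (rule that[of "\<lambda>k x. wave (real (Suc k)) x * \<beta> x"])
    show "(\<lambda>x. wave (real (Suc k)) x * \<beta> x) \<in> L2 halfline" for k by (rule C2_L2_mult_phase(2)[OF \<beta>L])
    show "norm (cls (\<lambda>x. wave (real (Suc k)) x * \<beta> x)) = 1" for k
      unfolding norm_cls_unimodular(2)[OF \<beta>L] by (rule \<beta>(3))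
    show "wave (real (Suc k)) x * \<beta> x = 0" if "x \<notin> {a1..a2}" for k x
      using \<beta>(2)[of x] that aa by auto
    show "(\<lambda>k. norm (restr B (V t (cls (\<lambda>x. wave (real (Suc k)) x * \<beta> x))))) \<longlonglongrightarrow> 0"
      if "hl2_flow_of V (friedrichs (\<nu> + 1/2))" "t \<noteq> 0" "B \<in> sets borel" "bounded B" for V t B
      by (rule packet_escapes[OF _ that(1,2) test_function_C2[OF \<beta>(1)] aa(1) _ _ that(3,4), of a2])
         (use \<nu> aa \<beta>(2) in auto)
  qed
qed

lemma outside_integral_zero:
  assumes "f \<in> L2 halfline" "AE x in halfline. f x = g x" "\<And>x. x \<notin> A \<Longrightarrow> g x = 0" "A \<in> sets borel"
  shows "(LINT x:{0<..} - A|halfline. (cmod (f x))\<^sup>2) = 0"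
proof -
  have "(LINT x:{0<..} - A|halfline. (cmod (f x))\<^sup>2) = (LINT x|halfline. 0)"
    unfolding set_lebesgue_integral_def
  proof (rule integral_cong_AE)
    have [measurable]: "f \<in> borel_measurable halfline" using assms(1) by (rule L2_measurable)
    have [measurable]: "(indicator ({0<..} - A) :: real \<Rightarrow> real) \<in> borel_measurable halfline"
      by (rule measurable_compose[OF measurable_halfline_ident borel_measurable_indicator]) (use assms(4) in simp)
    show "(\<lambda>x. indicat_real ({0<..} - A) x *\<^sub>R (cmod (f x))\<^sup>2) \<in> borel_measurable halfline" by measurable
    show "AE x in halfline. indicat_real ({0<..} - A) x *\<^sub>R (cmod (f x))\<^sup>2 = 0"
      using assms(2) by eventually_elim (use assms(3) in \<open>auto simp: indicator_def\<close>)
  qed simp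
  then show ?thesis by simp
qed

lemma tendsto_zero_power2: "(f \<longlongrightarrow> (0::real)) F \<Longrightarrow> ((\<lambda>x. (f x)\<^sup>2) \<longlongrightarrow> 0) F"
  using tendsto_power[of f 0 F 2] by simp

lemma single_time:
  assumes \<nu>: "0 \<le> \<nu>" and a: "0 \<le> a1" "a1 < a2" and T: "0 < T"
  shows "\<exists>u :: nat \<Rightarrow> real \<Rightarrow> complex.
           (\<forall>k. u k \<in> L2 halfline \<and> (LINT x|halfline. (cmod (u k x))\<^sup>2) = 1) \<and>
           (\<lambda>k. LINT x:{0<..} - {a1..a2}|halfline. (cmod (u k x))\<^sup>2) \<longlonglongrightarrow> 0 \<and>
           (\<lambda>k. LINT x:{b1..b2}|halfline. (cmod (sol \<nu> (u k) T x))\<^sup>2) \<longlonglongrightarrow> 0"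
proof -
  obtain V where V: "hl2_flow_of V (friedrichs (\<nu> + 1/2))"
    "\<And>t f. f \<in> L2 halfline \<Longrightarrow> sol \<nu> f t \<in> L2 halfline"
    "\<And>t f. f \<in> L2 halfline \<Longrightarrow> cls (sol \<nu> f t) = V t (cls f)"
    using sol_flow[OF \<nu>] by blast
  obtain f where f: "\<And>k. f k \<in> L2 halfline" "\<And>k. norm (cls (f k)) = 1"
    "\<And>k x. x \<notin> {a1..a2} \<Longrightarrow> f k x = 0"
    "\<And>V t B. hl2_flow_of V (friedrichs (\<nu> + 1/2)) \<Longrightarrow> t \<noteq> 0 \<Longrightarrow> B \<in> sets borel \<Longrightarrow> bounded B \<Longrightarrow>
      (\<lambda>k. norm (restr B (V t (cls (f k))))) \<longlonglongrightarrow> 0"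
    using packets[OF \<nu> a] by blast
  have "(LINT x|halfline. (cmod (f k x))\<^sup>2) = 1" for k
    using norm_cls_power2[OF f(1), of k] f(2)[of k] by simp
  moreover have "(LINT x:{0<..} - {a1..a2}|halfline. (cmod (f k x))\<^sup>2) = 0" for k
    by (rule outside_integral_zero[of "f k" "f k" "{a1..a2}"]) (simp_all add: f(1,3))
  moreover have "(LINT x:{b1..b2}|halfline. (cmod (sol \<nu> (f k) T x))\<^sup>2) = (norm (restr {b1..b2} (V T (cls (f k)))))\<^sup>2" for k
    using norm_restr_cls_power2[OF V(2)[OF f(1)], of "{b1..b2}" k T] V(3)[OF f(1)] by simp
  moreover have "(\<lambda>k. (norm (restr {b1..b2} (V T (cls (f k)))))\<^sup>2) \<longlonglongrightarrow> 0"
    by (intro tendsto_zero_power2 f(4)[OF V(1)]) (use T in auto)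
  ultimately show ?thesis using f(1) by (intro exI[of _ f]) simp
qed

text \<open>The packets are prescribed at time S1 and evolved back to time 0. At each t other than
  S1 the mass in {b1..b2} tends to zero, the time S1 is a null set, and the bound J \<le> 1 allows
  dominated convergence on {0..S2}. Measurability in t comes from strong continuity of the
  flow.\<close>

lemma time_averaged:
  assumes \<nu>: "0 \<le> \<nu>" and a: "0 \<le> a1" "a1 < a2"
  shows "\<exists>u :: nat \<Rightarrow> real \<Rightarrow> complex.
           (\<forall>k. u k \<in> L2 halfline \<and> (LINT x|halfline. (cmod (u k x))\<^sup>2) = 1) \<and>
           (\<lambda>k. LINT x:{0<..} - {a1..a2}|halfline. (cmod (sol \<nu> (u k) S1 x))\<^sup>2) \<longlonglongrightarrow> 0 \<and>
           (\<lambda>k. LINT t:{0..S2}|lebesgue. LINT x:{b1..b2}|halfline. (cmod (sol \<nu> (u k) t x))\<^sup>2)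
             \<longlonglongrightarrow> 0"
proof -
  obtain V where V: "hl2_flow_of V (friedrichs (\<nu> + 1/2))"
    "\<And>t f. f \<in> L2 halfline \<Longrightarrow> sol \<nu> f t \<in> L2 halfline"
    "\<And>t f. f \<in> L2 halfline \<Longrightarrow> cls (sol \<nu> f t) = V t (cls f)"
    using sol_flow[OF \<nu>] by blast
  have flow: "hl2_flow V" using V(1) by (simp add: hl2_flow_of_def)
  obtain f where f: "\<And>k. f k \<in> L2 halfline" "\<And>k. norm (cls (f k)) = 1"
    "\<And>k x. x \<notin> {a1..a2} \<Longrightarrow> f k x = 0"
    "\<And>V t B. hl2_flow_of V (friedrichs (\<nu> + 1/2)) \<Longrightarrow> t \<noteq> 0 \<Longrightarrow> B \<in> sets borel \<Longrightarrow> bounded B \<Longrightarrow>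
      (\<lambda>k. norm (restr B (V t (cls (f k))))) \<longlonglongrightarrow> 0"
    using packets[OF \<nu> a] by blast
  define u where "u k = rep_hl2 (V (- S1) (cls (f k)))" for k
  have uL: "u k \<in> L2 halfline" for k by (simp add: u_def)
  have cu: "cls (u k) = V (- S1) (cls (f k))" for k by (simp add: u_def)
  have cs: "cls (sol \<nu> (u k) t) = V (t - S1) (cls (f k))" for k t
    using flow_add[OF flow, of t "- S1" "cls (f k)"] by (simp add: V(3)[OF uL] cu)
  define J where "J k t = (norm (restr {b1..b2} (V (t - S1) (cls (f k)))))\<^sup>2" for k t
  have J: "(LINT x:{b1..b2}|halfline. (cmod (sol \<nu> (u k) t x))\<^sup>2) = J k t" for k t
    using norm_restr_cls_power2[OF V(2)[OF uL], of "{b1..b2}" k t] by (simp add: cs J_def)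
  have Jc: "continuous_on UNIV (J k)" for k
  proof -
    have "continuous_on UNIV (\<lambda>t. V (t - S1) (cls (f k)))"
      by (rule continuous_on_compose2[OF flow_continuous[OF flow]]) (auto intro!: continuous_intros)
    then show ?thesis
      unfolding J_def
      by (intro continuous_intros bounded_linear.continuous_on[OF restr_bounded_linear]) simp_all
  qed
  have Jm: "J k \<in> borel_measurable lebesgue" for k
    using borel_measurable_continuous_onI[OF Jc] by (intro measurable_completion) simp
  have Jb: "0 \<le> J k t" "J k t \<le> 1" for k t
  proof -
    have "norm (restr {b1..b2} (V (t - S1) (cls (f k)))) \<le> 1"
      using norm_restr_le[of "{b1..b2}" "V (t - S1) (cls (f k))"] by (simp add: flow_norm[OF flow] f(2))
    then show "J k t \<le> 1" unfolding J_def by (simp add: power_le_one)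
    show "0 \<le> J k t" by (simp add: J_def)
  qed
  have "(\<lambda>k. LINT t|lebesgue. indicator {0..S2} t *\<^sub>R J k t) \<longlonglongrightarrow> (LINT t|(lebesgue :: real measure). (0::real))"
  proof (rule integral_dominated_convergence[where w = "indicator {0..S2}"])
    show "(\<lambda>t. indicator {0..S2} t *\<^sub>R J k t) \<in> borel_measurable lebesgue" for k
      using Jm by (intro borel_measurable_scaleR borel_measurable_indicator) simp_all
    show "integrable lebesgue (indicator {0..S2} :: real \<Rightarrow> real)"
      by (rule integrable_real_indicator) (simp_all add: emeasure_lborel_Icc_eq)
    have "AE t in lebesgue. t \<notin> {S1}" by (rule AE_not_in) simp
    then show "AE t in lebesgue. (\<lambda>k. indicator {0..S2} t *\<^sub>R J k t) \<longlonglongrightarrow> 0"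
    proof eventually_elim
      case (elim t)
      then have "(\<lambda>k. J k t) \<longlonglongrightarrow> 0"
        unfolding J_def by (intro tendsto_zero_power2 f(4)[OF V(1)]) auto
      then show ?case using tendsto_mult_right_zero by simp
    qed
    show "AE t in lebesgue. norm (indicator {0..S2} t *\<^sub>R J k t) \<le> indicator {0..S2} t" for k
      using Jb by (auto simp: indicator_def)
  qed simp_all
  then have "(\<lambda>k. LINT t:{0..S2}|lebesgue. J k t) \<longlonglongrightarrow> 0"
    unfolding set_lebesgue_integral_def by simp
  moreover have "(LINT x:{0<..} - {a1..a2}|halfline. (cmod (sol \<nu> (u k) S1 x))\<^sup>2) = 0" for k
  proof (rule outside_integral_zero[of "sol \<nu> (u k) S1" "f k" "{a1..a2}"])
    show "sol \<nu> (u k) S1 \<in> L2 halfline" by (rule V(2)[OF uL])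
    show "f k x = 0" if "x \<notin> {a1..a2}" for x using that by (rule f(3))
    have "cls (sol \<nu> (u k) S1) = cls (f k)" by (simp add: cs flow_zero[OF flow])
    then show "AE x in halfline. sol \<nu> (u k) S1 x = f k x"
      using cls_eq_iff[OF V(2)[OF uL] f(1)] by blast
  qed simp
  moreover have "(LINT x|halfline. (cmod (u k x))\<^sup>2) = 1" for k
    using norm_cls_power2[OF uL, of k] by (simp add: cu flow_norm[OF flow] f(2))
  ultimately show ?thesis using uL by (intro exI[of _ u]) (simp add: J)
qed

lemma no_observability:
  assumes \<nu>: "0 \<le> \<nu>" and A: "A \<in> sets lebesgue" "emeasure lebesgue ({0<..} - A) > 0"
  shows "\<not> (\<exists>C>0. \<forall>u0\<in>L2 halfline.
              (LINT x|halfline. (cmod (u0 x))\<^sup>2)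
                \<le> C * (LINT x:A|halfline. (cmod (sol \<nu> u0 T x))\<^sup>2))"
proof
  assume "\<exists>C>0. \<forall>u0\<in>L2 halfline. (LINT x|halfline. (cmod (u0 x))\<^sup>2)
      \<le> C * (LINT x:A|halfline. (cmod (sol \<nu> u0 T x))\<^sup>2)"
  then obtain C where C: "\<And>u0. u0 \<in> L2 halfline \<Longrightarrow> (LINT x|halfline. (cmod (u0 x))\<^sup>2)
      \<le> C * (LINT x:A|halfline. (cmod (sol \<nu> u0 T x))\<^sup>2)" by blast
  obtain V where V: "hl2_flow_of V (friedrichs (\<nu> + 1/2))"
    "\<And>t f. f \<in> L2 halfline \<Longrightarrow> sol \<nu> f t \<in> L2 halfline"
    "\<And>t f. f \<in> L2 halfline \<Longrightarrow> cls (sol \<nu> f t) = V t (cls f)"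
    using sol_flow[OF \<nu>] by blast
  have flow: "hl2_flow V" using V(1) by (simp add: hl2_flow_of_def)
  have indm: "(indicator E :: real \<Rightarrow> real) \<in> borel_measurable halfline" if "E \<in> sets lebesgue" for E
    unfolding halfline_def
    by (rule measurable_restrict_space1) (use that in simp)
  \<comment> \<open>The decaying factor makes f square-integrable also when the complement of A has
    infinite measure. The datum that evolves into f has the same nonzero norm, while f vanishes on
    A.\<close>
  define f where "f x = of_real (indicator (- A) x) * complex_of_real (exp (- x))" for x
  have nA: "- A \<in> sets lebesgue" using A(1) by (simp add: Compl_in_sets_lebesgue)
  have fL: "f \<in> L2 halfline"
    unfolding f_def[abs_def]
    by (rule L2_multiplier[OF exp_minus_L2 indm[OF nA], of 1]) (simp add: indicator_def)
  have "cls f \<noteq> 0"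
  proof
    assume "cls f = 0"
    then have "cls f = cls (\<lambda>x. 0)" by (simp add: cls_abs L2_zero zero_hl2_def)
    then have "AE x in lebesgue. 0 < x \<longrightarrow> f x = 0"
      using cls_eq_iff[OF fL L2_zero] by (simp add: AE_halfline)
    then have "AE x in lebesgue. x \<notin> {0<..} - A"
      by eventually_elim (auto simp: f_def indicator_def)
    moreover have "{0<..} - A \<in> sets lebesgue" using A(1) by auto
    ultimately have "{0<..} - A \<in> null_sets lebesgue"
      using AE_iff_null_sets by blast
    then show False using A(2) by (simp add: null_sets_def)
  qed
  define u0 where "u0 = rep_hl2 (V (- T) (cls f))"
  have u0: "u0 \<in> L2 halfline" by (simp add: u0_def)
  have "cls (sol \<nu> u0 T) = cls f"
    unfolding V(3)[OF u0] unfolding u0_def cls_rep flow_inverse[OF flow] ..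
  then have ae: "AE x in halfline. sol \<nu> u0 T x = f x"
    using cls_eq_iff[OF V(2)[OF u0] fL] by blast
  have "(LINT x:A|halfline. (cmod (sol \<nu> u0 T x))\<^sup>2) = (LINT x|halfline. 0)"
    unfolding set_lebesgue_integral_def
  proof (rule integral_cong_AE)
    have [measurable]: "sol \<nu> u0 T \<in> borel_measurable halfline" by (rule L2_measurable[OF V(2)[OF u0]])
    note [measurable] = indm[OF A(1)]
    show "(\<lambda>x. indicat_real A x *\<^sub>R (cmod (sol \<nu> u0 T x))\<^sup>2) \<in> borel_measurable halfline" by measurable
    show "AE x in halfline. indicat_real A x *\<^sub>R (cmod (sol \<nu> u0 T x))\<^sup>2 = 0"
      using ae by eventually_elim (simp add: f_def indicator_def)
  qed simp
  then have "(LINT x|halfline. (cmod (u0 x))\<^sup>2) \<le> 0" using C[OF u0] by simp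
  then have "(norm (cls f))\<^sup>2 \<le> 0"
    using norm_cls_power2[OF u0] by (simp add: u0_def flow_norm[OF flow])
  then show False using \<open>cls f \<noteq> 0\<close> by simp
qed

theorem theorem5p1:
  fixes \<nu> :: real
  assumes "\<nu> \<ge> 0"
  shows
    "(\<forall>a1 a2 b1 b2 T :: real. 0 \<le> a1 \<and> a1 < a2 \<and> 0 \<le> b1 \<and> b1 < b2 \<and> 0 < T \<longrightarrow>
        (\<exists>u :: nat \<Rightarrow> real \<Rightarrow> complex.
           (\<forall>k. u k \<in> L2 halfline \<and> (LINT x|halfline. (cmod (u k x))\<^sup>2) = 1) \<and>
           (\<lambda>k. LINT x:{0<..} - {a1..a2}|halfline. (cmod (u k x))\<^sup>2) \<longlonglongrightarrow> 0 \<and>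
           (\<lambda>k. LINT x:{b1..b2}|halfline. (cmod (sol \<nu> (u k) T x))\<^sup>2) \<longlonglongrightarrow> 0)) \<and>
     (\<forall>a1 a2 b1 b2 S1 S2 :: real.
        0 \<le> a1 \<and> a1 < a2 \<and> 0 \<le> b1 \<and> b1 < b2 \<and> 0 < S1 \<and> 0 < S2 \<longrightarrow>
        (\<exists>u :: nat \<Rightarrow> real \<Rightarrow> complex.
           (\<forall>k. u k \<in> L2 halfline \<and> (LINT x|halfline. (cmod (u k x))\<^sup>2) = 1) \<and>
           (\<lambda>k. LINT x:{0<..} - {a1..a2}|halfline. (cmod (sol \<nu> (u k) S1 x))\<^sup>2) \<longlonglongrightarrow> 0 \<and>
           (\<lambda>k. LINT t:{0..S2}|lebesgue. LINT x:{b1..b2}|halfline. (cmod (sol \<nu> (u k) t x))\<^sup>2)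
             \<longlonglongrightarrow> 0)) \<and>
     (\<forall>A T. A \<in> sets lebesgue \<and> A \<subseteq> {0<..} \<and> emeasure lebesgue ({0<..} - A) > 0 \<and> 0 < T \<longrightarrow>
        \<not> (\<exists>C>0. \<forall>u0\<in>L2 halfline.
              (LINT x|halfline. (cmod (u0 x))\<^sup>2)
                \<le> C * (LINT x:A|halfline. (cmod (sol \<nu> u0 T x))\<^sup>2)))"
  using single_time[OF assms] time_averaged[OF assms] no_observability[OF assms]
  by blast

end
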